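(* Let $n\ge2$ and $1\le r\le n$. Let $M$ be a horosphere or an equidistant sphere in $\mathbb{H}^{n+1}$, and let $H_M>0$ denote its (constant) $r$-mean curvature with respect to the orientation given by the mean curvature vector. Let $\Sigma$ be a connected, properly embedded $C^2$ hypersurface in $\mathbb{H}^{n+1}$ which coincides with $M$ outside a compact subset $B$ of $\mathbb{H}^{n+1}$. Choose the orientation on $\Sigma$ such that the $r$-mean curvature $H_r$ of $\Sigma$ is equal to $H_M$ outside the compact set $B$. If, with respect to this orientation, either $H_r\ge H_M$ on $\Sigma$ or $|H_r|\le H_M$ on $\Sigma$, then $\Sigma=M$.
   Context: $r$-mean curvature: given a unit normal field $\nu$ on a hypersurface of $\mathbb{H}^{n+1}$, let $\kappa_1,\dots,\kappa_n$ be the principal curvatures, i.e. the eigenvalues of the shape operator $AX=-\overline\nabla_X\nu$ ($\overline\nabla$ the Levi-Civita connection of $\mathbb{H}^{n+1}$). Then $\binom{n}{r}H_r=\sigma_r(\kappa_1,\dots,\kappa_n)$, where $\sigma_r(\lambda_1,\dots,\lambda_n)=\sum_{i_1<\cdots<i_r}\lambda_{i_1}\cdots\lambda_{i_r}$. The orientation given by the mean curvature vector is the one whose unit normal points in the direction of the mean curvature vector (so that $H_1>0$). In the upper half-space model $\{x_{n+1}>0\}$ with metric $(dx_1^2+\dots+dx_{n+1}^2)/x_{n+1}^2$, horospheres are the horizontal hyperplanes $\{x_{n+1}=\text{constant}\}$ and the Euclidean spheres tangent to $\{x_{n+1}=0\}$ (minus the tangency point). Equidistant spheres are the intersections of the half-space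 with Euclidean spheres crossing $\{x_{n+1}=0\}$ (and their images under isometries of $\mathbb{H}^{n+1}$) which are not totally geodesic; they are totally umbilical with all principal curvatures equal to one nonzero constant of absolute value strictly less than $1$. *)

theory Defs
  imports "HOL-Analysis.Analysis"
begin

section \<open>The upper half-space model\<close>

text \<open>
  The space \<open>\<real>\<^sup>n\<^sup>+\<^sup>1\<close> is the type \<open>(real ^ 'n) \<times> real\<close> with \<open>n = CARD('n)\<close>; the
  distinguished coordinate \<open>x\<^sub>n\<^sub>+\<^sub>1\<close> is the second component.  Tangent vectors of
  \<open>\<bbbH>\<^sup>n\<^sup>+\<^sup>1\<close> are elements of the ambient vector space.
\<close>

type_synonym 'n pt = "(real ^ 'n) \<times> real"

definition halfspace :: "('n::finite pt) set"
  where "halfspace = {p. snd p > 0}"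

definition hyp_metric :: "'n::finite pt \<Rightarrow> 'n pt \<Rightarrow> 'n pt \<Rightarrow> real"
  where "hyp_metric p u v = inner u v / (snd p)\<^sup>2"

text \<open>
  \<open>christoffel p u v\<close> is the value at \<open>p\<close> of the Levi-Civita derivative of the constant field \<open>v\<close>
  in the direction \<open>u\<close>, given by the Koszul formula for the (commuting) constant fields
  \<open>u\<close>, \<open>v\<close>, \<open>z\<close>.
\<close>

definition christoffel :: "'n::finite pt \<Rightarrow> 'n pt \<Rightarrow> 'n pt \<Rightarrow> 'n pt"
  where "christoffel p u v = (THE w. \<forall>z.
    2 * hyp_metric p w z =
        frechet_derivative (\<lambda>q. hyp_metric q v z) (at p) u
      + frechet_derivative (\<lambda>q. hyp_metric q u z) (at p) v
      - frechet_derivative (\<lambda>q. hyp_metric q u v) (at p) z)"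

lemma frechet_derivative_hyp_metric:
  fixes p u v :: "'n::finite pt"
  assumes "p \<in> halfspace"
  shows "frechet_derivative (\<lambda>q. hyp_metric q u v) (at p) z
           = - 2 * inner u v * snd z / (snd p) ^ 3"
proof -
  have p: "snd p \<noteq> 0"
    using assms by (simp add: halfspace_def)
  have real: "((\<lambda>t::real. c / t\<^sup>2) has_real_derivative - 2 * c / s ^ 3) (at s)"
    if "s \<noteq> 0" for c s
    using that by (auto intro!: derivative_eq_intros simp: field_simps eval_nat_numeral)
  have "((\<lambda>q. inner u v / (snd q)\<^sup>2) has_derivative
          (\<lambda>z. (- 2 * inner u v / (snd p) ^ 3) * snd z)) (at p)"
    by (rule has_derivative_compose[OF has_derivative_snd[OF has_derivative_ident]
          real[OF p, unfolded has_field_derivative_def]])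
  from frechet_derivative_at[OF this]
  show ?thesis
    unfolding hyp_metric_def by (metis times_divide_eq_left)
qed

lemma christoffel_eq:
  fixes p u v :: "'n::finite pt"
  assumes "p \<in> halfspace"
  shows "christoffel p u v =
    - (snd u / snd p) *\<^sub>R v - (snd v / snd p) *\<^sub>R u + (inner u v / snd p) *\<^sub>R (0, 1)"
    (is "_ = ?w")
proof -
  define w where "w = ?w"
  have p: "snd p \<noteq> 0"
    using assms by (simp add: halfspace_def)
  have alg: "2 * (- (a / s) * y - (b / s) * x + c / s * d) / s\<^sup>2 =
      - 2 * y * a / s ^ 3 + - 2 * x * b / s ^ 3 - - 2 * c * d / s ^ 3"
    if "s \<noteq> 0" for a b c d s x y :: real
    using that by (simp add: field_simps eval_nat_numeral)
  let ?K = "\<lambda>z. - 2 * inner v z * snd u / (snd p) ^ 3 + - 2 * inner u z * snd v / (snd p) ^ 3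
      - - 2 * inner u v * snd z / (snd p) ^ 3"
  have w: "2 * hyp_metric p w z = ?K z" for z
  proof -
    have e: "inner ((0, 1) :: 'n pt) z = snd z"
      by (cases z) simp
    have "inner w z = - (snd u / snd p) * inner v z - (snd v / snd p) * inner u z
            + inner u v / snd p * snd z"
      unfolding w_def by (simp only: inner_add_left inner_diff_left inner_scaleR_left e)
    then show ?thesis
      unfolding hyp_metric_def using alg[OF p] by (simp only: times_divide_eq_right)
  qed
  have "x = w" if x: "\<forall>z. 2 * hyp_metric p x z = ?K z" for x
  proof -
    have "inner x z = inner w z" for z
    proof -
      have "2 * hyp_metric p x z = 2 * hyp_metric p w z"
        using x w[of z] by (simp only:)
      then show ?thesis
        using p unfolding hyp_metric_def by simp
    qed
    then show ?thesis
      by (metis vector_eq_rdot)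
  qed
  then have "christoffel p u v = w"
    unfolding christoffel_def frechet_derivative_hyp_metric[OF assms]
    using w by (intro the_equality) blast+
  then show ?thesis
    by (simp only: w_def)
qed


section \<open>Hypersurfaces\<close>

definition C2_on :: "'a::real_normed_vector set \<Rightarrow> ('a \<Rightarrow> 'b::real_normed_vector) \<Rightarrow> bool"
  where "C2_on U f \<longleftrightarrow>
    (\<exists>(f' :: 'a \<Rightarrow> 'a \<Rightarrow>\<^sub>L 'b) (f'' :: 'a \<Rightarrow> 'a \<Rightarrow>\<^sub>L ('a \<Rightarrow>\<^sub>L 'b)).
      (\<forall>x\<in>U. (f has_derivative blinfun_apply (f' x)) (at x)) \<and>
      (\<forall>x\<in>U. (f' has_derivative blinfun_apply (f'' x)) (at x)) \<and>
      continuous_on U f'')"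

text \<open>Embedded \<open>C\<^sup>2\<close> hypersurfaces, as sets that are locally regular level sets.\<close>

definition C2_hypersurface :: "('n::finite pt) set \<Rightarrow> bool"
  where "C2_hypersurface S \<longleftrightarrow> S \<subseteq> halfspace \<and>
    (\<forall>p\<in>S. \<exists>U (f :: 'n pt \<Rightarrow> real). open U \<and> p \<in> U \<and> U \<subseteq> halfspace \<and> C2_on U f \<and>
       (\<forall>x\<in>U. frechet_derivative f (at x) \<noteq> (\<lambda>_. 0)) \<and>
       S \<inter> U = {x \<in> U. f x = 0})"

text \<open>The second conjunct says that the inclusion of \<open>S\<close> into the half-space is a proper map.\<close>

definition properly_embedded_C2_hypersurface :: "('n::finite pt) set \<Rightarrow> bool"
  where "properly_embedded_C2_hypersurface S \<longleftrightarrow> C2_hypersurface S \<and>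
    (\<forall>K. compact K \<and> K \<subseteq> halfspace \<longrightarrow> compact (S \<inter> K))"

definition tangent_space :: "('n::finite pt) set \<Rightarrow> 'n pt \<Rightarrow> ('n pt) set"
  where "tangent_space S p = {v. \<exists>(\<gamma> :: real \<Rightarrow> 'n pt) \<epsilon>. \<epsilon> > 0 \<and> \<gamma> ` {-\<epsilon><..<\<epsilon>} \<subseteq> S \<and>
      \<gamma> 0 = p \<and> (\<gamma> has_vector_derivative v) (at 0)}"

text \<open>On a \<open>C\<^sup>2\<close> hypersurface a continuous unit normal field is automatically of class \<open>C\<^sup>1\<close>.\<close>

definition unit_normal_field :: "('n::finite pt) set \<Rightarrow> ('n pt \<Rightarrow> 'n pt) \<Rightarrow> bool"
  where "unit_normal_field S \<nu> \<longleftrightarrow> continuous_on S \<nu> \<and>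
    (\<forall>p\<in>S. hyp_metric p (\<nu> p) (\<nu> p) = 1 \<and>
       (\<forall>X\<in>tangent_space S p. hyp_metric p (\<nu> p) X = 0))"


section \<open>Extrinsic curvature\<close>

text \<open>
  The Levi-Civita derivative of a field \<open>V\<close> defined along \<open>S\<close>, in a direction \<open>X\<close> tangent to \<open>S\<close>.
  The derivative within \<open>S\<close> is determined only on the tangent space of \<open>S\<close>, so the value
  is meaningful only for tangent \<open>X\<close>.
\<close>

definition levi_civita ::
    "('n::finite pt) set \<Rightarrow> ('n pt \<Rightarrow> 'n pt) \<Rightarrow> 'n pt \<Rightarrow> 'n pt \<Rightarrow> 'n pt"
  where "levi_civita S V p X =
    frechet_derivative V (at p within S) X + christoffel p X (V p)"

definition shape_operator ::
    "('n::finite pt) set \<Rightarrow> ('n pt \<Rightarrow> 'n pt) \<Rightarrow> 'n pt \<Rightarrow> 'n pt \<Rightarrow> 'n pt"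
  where "shape_operator S \<nu> p X = - levi_civita S \<nu> p X"

text \<open>
  The eigenvalues of the shape operator, listed with multiplicity along an orthonormal basis of
  eigenvectors of the \<open>n\<close>-dimensional tangent space.  They are unique up to a permutation of \<open>'n\<close>.
\<close>

definition principal_curvatures ::
    "('n::finite pt) set \<Rightarrow> ('n pt \<Rightarrow> 'n pt) \<Rightarrow> 'n pt \<Rightarrow> 'n \<Rightarrow> real"
  where "principal_curvatures S \<nu> p = (SOME \<kappa>. \<exists>e :: 'n \<Rightarrow> 'n pt.
    (\<forall>i. e i \<in> tangent_space S p) \<and>
    (\<forall>i j. hyp_metric p (e i) (e j) = (if i = j then 1 else 0)) \<and>
    (\<forall>i. shape_operator S \<nu> p (e i) = \<kappa> i *\<^sub>R e i))"

definition elem_sym :: "nat \<Rightarrow> ('n::finite \<Rightarrow> real) \<Rightarrow> real"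
  where "elem_sym r \<kappa> = (\<Sum>I | card I = r. \<Prod>i\<in>I. \<kappa> i)"

definition r_mean_curvature ::
    "nat \<Rightarrow> ('n::finite pt) set \<Rightarrow> ('n pt \<Rightarrow> 'n pt) \<Rightarrow> 'n pt \<Rightarrow> real"
  where "r_mean_curvature r S \<nu> p =
    elem_sym r (principal_curvatures S \<nu> p) / real (CARD('n) choose r)"

definition totally_geodesic :: "('n::finite pt) set \<Rightarrow> bool"
  where "totally_geodesic S \<longleftrightarrow> (\<exists>\<nu>. unit_normal_field S \<nu> \<and>
    (\<forall>p\<in>S. \<forall>X\<in>tangent_space S p. shape_operator S \<nu> p X = 0))"


section \<open>Horospheres and equidistant spheres\<close>

definition horosphere :: "('n::finite pt) set \<Rightarrow> bool"
  where "horosphere M \<longleftrightarrow>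
    (\<exists>c>0. M = {p. snd p = c}) \<or>
    (\<exists>a \<rho>. \<rho> > 0 \<and> M = sphere (a, \<rho>) \<rho> - {(a, 0)})"

text \<open>
  Requiring \<open>C\<^sup>2\<close> regularity loses no isometries, since all isometries are smooth.
\<close>

definition hyp_isometry :: "('n::finite pt \<Rightarrow> 'n pt) \<Rightarrow> bool"
  where "hyp_isometry F \<longleftrightarrow> bij_betw F halfspace halfspace \<and> C2_on halfspace F \<and>
    (\<forall>p\<in>halfspace. \<forall>u v. hyp_metric (F p) (frechet_derivative F (at p) u)
                                        (frechet_derivative F (at p) v) = hyp_metric p u v)"

text \<open>
  The condition \<open>\<bar>snd c\<bar> < \<rho>\<close> says that the Euclidean sphere crosses the boundary hyperplane.
  The isometric images include the tilted hyperplanes.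
\<close>

definition equidistant_sphere :: "('n::finite pt) set \<Rightarrow> bool"
  where "equidistant_sphere M \<longleftrightarrow>
    (\<exists>F c \<rho>. hyp_isometry F \<and> \<bar>snd c\<bar> < \<rho> \<and> M = F ` (sphere c \<rho> \<inter> halfspace)) \<and>
    \<not> totally_geodesic M"

end

theory Submission
  imports Defs "HOL-Computational_Algebra.Fundamental_Theorem_Algebra"
begin

text \<open>
  By an isometry \<open>M\<close> may be taken to be the trace on the half-space of an affine hyperplane
  \<open>{x. x \<bullet> N = c}\<close> with \<open>|N| = 1\<close> and \<open>\<beta> = snd N > 0\<close>: the value \<open>\<beta> = 1\<close> gives a horizontal horosphere,
  \<open>0 < \<beta> < 1\<close> an equidistant sphere (\<open>isometric_to_hyperplane\<close>).  All principal curvatures of this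
  hyperplane with respect to the upper normal are equal to \<open>\<beta>\<close>, hence \<open>H\<^sub>M = \<beta>\<^sup>r\<close>.  The parallel
  hyperplanes \<open>{x. x \<bullet> N = \<tau>}\<close> foliate the half-space and have the same curvatures.  Since \<open>\<Sigma>\<close> leaves
  \<open>M\<close> only inside a compact set, the height \<open>x \<bullet> N\<close> attains both its extrema on \<open>\<Sigma>\<close>.

  At an extremum \<open>\<Sigma>\<close> touches a leaf of the foliation from one side, and a strong maximum principle
  shows that the set of contact points is open in the leaf.  It is also closed, so that the whole leaf lies
  in \<open>\<Sigma>\<close>.  Leaves are not relatively compact, and outside a compact set \<open>\<Sigma>\<close> consists of points of
  height \<open>c\<close>; hence this leaf is \<open>M\<close> itself, and then \<open>\<Sigma> = M\<close> because \<open>M\<close> is open and closed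
  in the connected set \<open>\<Sigma>\<close> (\<open>hyperplane_subset_if_open\<close>, \<open>hypersurface_eq_contained_hyperplane\<close>).

  If \<open>|H\<^sub>r| \<le> H\<^sub>M\<close>, the lowest points are used.  There \<open>\<Sigma>\<close> lies above the leaf, a perturbation of the
  leaf forces all principal curvatures of \<open>\<Sigma>\<close> (up to a common sign) to be at least nearly \<open>\<beta>\<close> and to
  exceed it on average, and this makes \<open>|H\<^sub>r|\<close> too large.  The sign is irrelevant, so that no knowledge
  of the orientation of \<open>\<Sigma>\<close> is required (\<open>contact_open_symmetric_curvature\<close>).

  If \<open>H\<^sub>r \<ge> H\<^sub>M\<close>, the highest points are used, and two more facts are needed.  Firstly, the symmetric
  functions \<open>\<sigma>\<^sub>1, \<dots>, \<sigma>\<^sub>r\<close> of the principal curvatures are positive far out, and positivity cannot be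
  lost along \<open>\<Sigma>\<close> while \<open>\<sigma>\<^sub>r > 0\<close>; Maclaurin's inequality \<open>H\<^sub>r \<le> H\<^sub>1\<^sup>r\<close>, valid under this positivity,
  then gives \<open>H\<^sub>1 \<ge> \<beta>\<close> everywhere (\<open>garding_maclaurin\<close>, \<open>mean_curvature_lower_bound\<close>).  Only the mean
  curvature remains to be compared (\<open>contact_open_mean_curvature\<close>).  Secondly, the normal of \<open>\<Sigma>\<close> has to point
  upwards at the highest points as it does far out.  This is a global property of embedded
  hypersurfaces: \<open>\<Sigma>\<close> separates the half-space, and the region above the highest points can be
  joined, without meeting \<open>\<Sigma>\<close>, to the region above a far point (\<open>separating_function\<close>,
  \<open>orientation_at_top\<close>).

  The strong maximum principle is proved by Hopf's barriers, but without writing \<open>\<Sigma>\<close> as a graph: if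
  the contact set were not open, a ball in the leaf would touch it at a single boundary point, and the height
  perturbed by a small Gaussian bump centred at the centre of this ball would have a local maximum on \<open>\<Sigma>\<close>
  near that point (\<open>barrier_contact_points\<close>).  There the shape operator of \<open>\<Sigma>\<close> is compared with that of a
  level set of the perturbed height (\<open>curvature_comparison_at_max\<close>); a sharply peaked bump contradicts the
  assumption on the curvatures.
\<close>


section \<open>Second-order calculus\<close>

text \<open>
  By the mean value theorem the second difference of \<open>f\<close> over the parallelogram spanned by \<open>t u\<close> and \<open>t v\<close>
  is a difference of values of \<open>f'\<close>.  The left-hand side is symmetric in \<open>u\<close> and \<open>v\<close> up to the
  term with \<open>f''\<close>, which gives the symmetry of second derivatives that are not assumed continuous.
\<close>

lemma second_difference_limit:
  fixes f :: "'a::real_normed_vector \<Rightarrow> real"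
  assumes "open U" "p \<in> U"
    and f': "\<And>x. x \<in> U \<Longrightarrow> (f has_derivative blinfun_apply (f' x)) (at x)"
    and f'': "(f' has_derivative blinfun_apply f'') (at p)"
    and e: "e > 0"
  shows "\<exists>d>0. \<forall>t. 0 < t \<and> t < d \<longrightarrow>
    \<bar>f (p + t *\<^sub>R u + t *\<^sub>R v) - f (p + t *\<^sub>R u) - f (p + t *\<^sub>R v) + f p - t\<^sup>2 * f'' v u\<bar> \<le> e * t\<^sup>2"
proof -
  define C where "C = (norm u + norm v + 1)"
  have C: "C > 0" "norm u \<le> C" "norm v \<le> C" by (auto simp: C_def add_nonneg_pos)
  define e' where "e' = e / (4 * C * C)"
  have e': "e' > 0" using e C by (simp add: e'_def)
  obtain d1 where d1: "d1 > 0" "\<And>y. norm (y - p) < d1 \<Longrightarrow> norm (f' y - f' p - f'' (y - p)) \<le> e' * norm (y - p)"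
    using f'' e' unfolding has_derivative_at_alt by blast
  obtain d2 where d2: "d2 > 0" "ball p d2 \<subseteq> U" using assms(1,2) open_contains_ball by blast
  define d where "d = min d1 d2 / (2 * C)"
  have d: "d > 0" using d1 d2 C by (simp add: d_def)
  show ?thesis
  proof (intro exI[of _ d] conjI d allI impI)
    fix t assume t: "0 < t \<and> t < d"
    have tC: "t * (2 * C) < min d1 d2" using t C by (simp add: d_def pos_less_divide_eq)
    have near: "norm (s *\<^sub>R u + r *\<^sub>R v) \<le> t * (2 * C)" if "0 \<le> s" "s \<le> t" "0 \<le> r" "r \<le> t" for s r
    proof -
      have "norm (s *\<^sub>R u + r *\<^sub>R v) \<le> s * norm u + r * norm v"
        using that by (metis abs_of_nonneg norm_scaleR norm_triangle_ineq)
      also have "\<dots> \<le> t * C + t * C"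
        using that C t by (intro add_mono mult_mono) auto
      finally show ?thesis by (simp add: mult.commute mult.left_commute)
    qed
    have inU: "p + s *\<^sub>R u + r *\<^sub>R v \<in> U" if "0 \<le> s" "s \<le> t" "0 \<le> r" "r \<le> t" for s r
    proof -
      have "norm (s *\<^sub>R u + r *\<^sub>R v) < d2" using near[OF that] tC by linarith
      then have "p + s *\<^sub>R u + r *\<^sub>R v \<in> ball p d2"
        by (metis add.assoc add_diff_cancel_left' dist_commute dist_norm mem_ball)
      then show ?thesis using d2 by blast
    qed
    define \<Phi> where "\<Phi> s = f (p + s *\<^sub>R u + t *\<^sub>R v) - f (p + s *\<^sub>R u + 0 *\<^sub>R v)" for s
    define \<Phi>' where "\<Phi>' s = f' (p + s *\<^sub>R u + t *\<^sub>R v) u - f' (p + s *\<^sub>R u + 0 *\<^sub>R v) u" for s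
    have D: "((\<lambda>s. f (p + s *\<^sub>R u + r *\<^sub>R v)) has_derivative (\<lambda>h. h * f' (p + s *\<^sub>R u + r *\<^sub>R v) u)) (at s)"
      if "0 \<le> s" "s \<le> t" "0 \<le> r" "r \<le> t" for s r
    proof -
      have "((\<lambda>s. p + s *\<^sub>R u + r *\<^sub>R v) has_derivative (\<lambda>h. h *\<^sub>R u)) (at s)"
        by (auto intro!: derivative_eq_intros)
      from has_derivative_compose[OF this f'[OF inU[OF that]]]
      show ?thesis by (simp add: blinfun.scaleR_right)
    qed
    have "\<And>s. \<lbrakk>0 \<le> s; s \<le> t\<rbrakk> \<Longrightarrow> DERIV \<Phi> s :> \<Phi>' s"
      unfolding \<Phi>_def \<Phi>'_def has_field_derivative_def
      by (rule has_derivative_eq_rhs[OF has_derivative_diff[OF D D]]) (use t in \<open>auto simp: algebra_simps\<close>)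
    then obtain \<xi> where xi: "0 < \<xi>" "\<xi> < t" "\<Phi> t - \<Phi> 0 = (t - 0) * \<Phi>' \<xi>"
      using MVT2[of 0 t \<Phi> \<Phi>'] t by auto
    have est: "norm (f' (p + \<xi> *\<^sub>R u + r *\<^sub>R v) - f' p - f'' (\<xi> *\<^sub>R u + r *\<^sub>R v)) \<le> e' * (t * (2 * C))"
      if "0 \<le> r" "r \<le> t" for r
    proof -
      have n: "norm (\<xi> *\<^sub>R u + r *\<^sub>R v) \<le> t * (2 * C)" using near xi that by simp
      then have "norm (\<xi> *\<^sub>R u + r *\<^sub>R v) < d1" using tC by linarith
      then have "norm (f' (p + \<xi> *\<^sub>R u + r *\<^sub>R v) - f' p - f'' (\<xi> *\<^sub>R u + r *\<^sub>R v)) \<le> e' * norm (\<xi> *\<^sub>R u + r *\<^sub>R v)"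
        using d1(2)[of "p + \<xi> *\<^sub>R u + r *\<^sub>R v"] by (simp add: add.assoc)
      also have "\<dots> \<le> e' * (t * (2 * C))" using n e' by simp
      finally show ?thesis .
    qed
    let ?A = "f' (p + \<xi> *\<^sub>R u + t *\<^sub>R v) - f' p - f'' (\<xi> *\<^sub>R u + t *\<^sub>R v)"
    let ?B = "f' (p + \<xi> *\<^sub>R u + 0 *\<^sub>R v) - f' p - f'' (\<xi> *\<^sub>R u + 0 *\<^sub>R v)"
    have eq: "\<Phi>' \<xi> - t * f'' v u = blinfun_apply (?A - ?B) u"
      by (simp add: \<Phi>'_def blinfun.diff_left blinfun.add_left blinfun.add_right blinfun.scaleR_right
            blinfun.scaleR_left)
    have "norm (?A - ?B) \<le> e' * (t * (2 * C)) + e' * (t * (2 * C))"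
      using est[of t] est[of 0] t norm_triangle_ineq4[of ?A ?B] by linarith
    then have "norm (blinfun_apply (?A - ?B) u) \<le> (e' * (t * (2 * C)) + e' * (t * (2 * C))) * C"
      by (meson C(2) dual_order.trans mult_mono norm_blinfun norm_ge_zero)
    also have "\<dots> = e * t" using C by (simp add: e'_def field_simps)
    finally have b: "\<bar>\<Phi>' \<xi> - t * f'' v u\<bar> \<le> e * t" using eq by simp
    have "f (p + t *\<^sub>R u + t *\<^sub>R v) - f (p + t *\<^sub>R u) - f (p + t *\<^sub>R v) + f p - t\<^sup>2 * f'' v u
       = t * (\<Phi>' \<xi> - t * f'' v u)"
      using xi(3) by (simp add: \<Phi>_def power2_eq_square algebra_simps)
    then show "\<bar>f (p + t *\<^sub>R u + t *\<^sub>R v) - f (p + t *\<^sub>R u) - f (p + t *\<^sub>R v) + f p - t\<^sup>2 * f'' v u\<bar> \<le> e * t\<^sup>2"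
      using b t by (simp add: abs_mult power2_eq_square)
  qed
qed

lemma second_derivative_symmetric_real:
  fixes f :: "'a::real_normed_vector \<Rightarrow> real"
  assumes "open U" "p \<in> U"
    and f': "\<And>x. x \<in> U \<Longrightarrow> (f has_derivative blinfun_apply (f' x)) (at x)"
    and f'': "(f' has_derivative blinfun_apply f'') (at p)"
  shows "f'' u v = f'' v u"
proof -
  have "\<bar>f'' v u - f'' u v\<bar> \<le> 0 + e" if e: "e > 0" for e
  proof -
    obtain d1 where d1: "d1 > 0" "\<And>t. 0 < t \<and> t < d1 \<Longrightarrow>
        \<bar>f (p + t *\<^sub>R u + t *\<^sub>R v) - f (p + t *\<^sub>R u) - f (p + t *\<^sub>R v) + f p - t\<^sup>2 * f'' v u\<bar> \<le> (e/2) * t\<^sup>2"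
      using second_difference_limit[OF assms, of "e/2" u v] e by auto
    obtain d2 where d2: "d2 > 0" "\<And>t. 0 < t \<and> t < d2 \<Longrightarrow>
        \<bar>f (p + t *\<^sub>R v + t *\<^sub>R u) - f (p + t *\<^sub>R v) - f (p + t *\<^sub>R u) + f p - t\<^sup>2 * f'' u v\<bar> \<le> (e/2) * t\<^sup>2"
      using second_difference_limit[OF assms, of "e/2" v u] e by auto
    define t where "t = min d1 d2 / 2"
    have t: "0 < t" "t < d1" "t < d2" using d1 d2 by (auto simp: t_def)
    have "p + t *\<^sub>R v + t *\<^sub>R u = p + t *\<^sub>R u + t *\<^sub>R v" by simp
    then have "\<bar>t\<^sup>2 * f'' v u - t\<^sup>2 * f'' u v\<bar> \<le> (e/2) * t\<^sup>2 + (e/2) * t\<^sup>2"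
      using d1(2)[of t, OF conjI[OF t(1,2)]] d2(2)[of t, OF conjI[OF t(1,3)]] by (simp only:)
    then have "\<bar>t\<^sup>2 * f'' v u - t\<^sup>2 * f'' u v\<bar> \<le> e * t\<^sup>2" by simp
    moreover have "t\<^sup>2 * \<bar>f'' v u - f'' u v\<bar> = \<bar>t\<^sup>2 * f'' v u - t\<^sup>2 * f'' u v\<bar>"
      by (simp only: right_diff_distrib[symmetric] abs_mult abs_power2)
    ultimately have "t\<^sup>2 * \<bar>f'' v u - f'' u v\<bar> \<le> t\<^sup>2 * e" by (simp only: mult.commute)
    then show ?thesis using t by simp
  qed
  then have "\<bar>f'' v u - f'' u v\<bar> \<le> 0" by (rule field_le_epsilon)
  then show ?thesis by simp
qed

lemma second_derivative_symmetric:
  fixes f :: "'a::real_normed_vector \<Rightarrow> 'b::real_inner"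
  assumes "open U" "p \<in> U"
    and f': "\<And>x. x \<in> U \<Longrightarrow> (f has_derivative blinfun_apply (f' x)) (at x)"
    and f'': "(f' has_derivative blinfun_apply f'') (at p)"
  shows "f'' u v = f'' v u"
proof -
  have "inner w (f'' u v) = inner w (f'' v u)" for w
  proof -
    let ?i = "blinfun_inner_right w"
    let ?c = "blinfun_compose ?i"
    have bl: "bounded_linear (\<lambda>x. ?i o\<^sub>L x)"
      by (rule bounded_bilinear.bounded_linear_right[OF bounded_bilinear_blinfun_compose])
    have 1: "((\<lambda>x. inner w (f x)) has_derivative blinfun_apply (?i o\<^sub>L f' x)) (at x)" if "x \<in> U" for x
      using has_derivative_inner_right[OF f'[OF that], of w]
      by (simp add: blinfun_compose.rep_eq comp_def blinfun_inner_right.rep_eq)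
    have 2: "((\<lambda>x. ?i o\<^sub>L f' x) has_derivative blinfun_apply (Blinfun (\<lambda>x. ?i o\<^sub>L x) o\<^sub>L f'')) (at p)"
      using bounded_linear.has_derivative[OF bl f'']
      by (simp add: blinfun_compose.rep_eq comp_def bounded_linear_Blinfun_apply[OF bl])
    show ?thesis using second_derivative_symmetric_real[OF assms(1,2) 1 2, of u v]
      by (simp add: bounded_linear_Blinfun_apply[OF bl])
  qed
  then show ?thesis by (metis vector_eq_ldot)
qed

text \<open>
  The remainder is estimated along the segment from \<open>p\<close> to \<open>q\<close>, which needs the Hessian at the point \<open>p\<close> only.
\<close>

lemma taylor_at_critical_point:
  fixes F :: "'a::euclidean_space \<Rightarrow> real"
  assumes "open U" "p \<in> U"
    and F: "\<And>x. x \<in> U \<Longrightarrow> (F has_derivative (\<lambda>v. inner (G x) v)) (at x)"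
    and G: "(G has_derivative L) (at p)" and crit: "G p = 0" and e: "e > 0"
  shows "\<exists>d>0. \<forall>q. norm (q - p) < d \<longrightarrow> \<bar>F q - F p - inner (L (q - p)) (q - p) / 2\<bar> \<le> e * (norm (q - p))\<^sup>2"
proof -
  obtain d1 where d1: "d1 > 0" "\<And>y. norm (y - p) < d1 \<Longrightarrow> norm (G y - G p - L (y - p)) \<le> e * norm (y - p)"
    using G e unfolding has_derivative_at_alt by blast
  obtain d2 where d2: "d2 > 0" "ball p d2 \<subseteq> U" using assms(1,2) open_contains_ball by blast
  have lin: "linear L" using G has_derivative_linear by blast
  define d where "d = min d1 d2"
  show ?thesis
  proof (intro exI[of _ d] conjI allI impI)
    show "0 < d" using d1 d2 by (simp add: d_def)
    fix q assume q: "norm (q - p) < d"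
    define w where "w = q - p"
    define \<phi> where "\<phi> s = F (p + s *\<^sub>R w) - s\<^sup>2 * inner (L w) w / 2" for s
    have sm: "norm (s *\<^sub>R w) < d" if "0 \<le> s" "s \<le> 1" for s
    proof -
      have "s * norm w \<le> 1 * norm w" using that by (intro mult_right_mono) auto
      then show ?thesis using q that by (simp add: w_def)
    qed
    have inU: "p + s *\<^sub>R w \<in> U" if "0 \<le> s" "s \<le> 1" for s
    proof -
      have "p + s *\<^sub>R w \<in> ball p d2" using sm[OF that] by (simp add: dist_norm d_def)
      then show ?thesis using d2 by blast
    qed
    define \<phi>' where "\<phi>' s = inner (G (p + s *\<^sub>R w)) w - s * inner (L w) w" for s
    have "DERIV \<phi> s :> \<phi>' s" if "0 \<le> s" "s \<le> 1" for s
    proof -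
      have "((\<lambda>s. p + s *\<^sub>R w) has_derivative (\<lambda>h. h *\<^sub>R w)) (at s)"
        by (auto intro!: derivative_eq_intros)
      from has_derivative_compose[OF this F[OF inU[OF that]]]
      have "DERIV (\<lambda>s. F (p + s *\<^sub>R w)) s :> inner (G (p + s *\<^sub>R w)) w"
        by (simp add: has_field_derivative_def mult_commute_abs)
      then show ?thesis unfolding \<phi>_def \<phi>'_def by (auto intro!: derivative_eq_intros)
    qed
    then obtain \<xi> where xi: "0 < \<xi>" "\<xi> < 1" "\<phi> 1 - \<phi> 0 = (1 - 0) * \<phi>' \<xi>"
      using MVT2[of 0 1 \<phi> \<phi>'] by auto
    have "norm (\<xi> *\<^sub>R w) < d1" using sm[of \<xi>] xi by (simp add: d_def)
    then have "norm (G (p + \<xi> *\<^sub>R w) - \<xi> *\<^sub>R L w) \<le> e * norm (\<xi> *\<^sub>R w)"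
      using d1(2)[of "p + \<xi> *\<^sub>R w"] crit lin by (simp add: linear_cmul)
    also have "\<dots> \<le> e * norm w" using xi e by (simp add: mult_left_le_one_le)
    finally have "norm (G (p + \<xi> *\<^sub>R w) - \<xi> *\<^sub>R L w) * norm w \<le> (e * norm w) * norm w"
      by (intro mult_right_mono) auto
    then have "\<bar>inner (G (p + \<xi> *\<^sub>R w) - \<xi> *\<^sub>R L w) w\<bar> \<le> e * (norm w)\<^sup>2"
      using Cauchy_Schwarz_ineq2[of "G (p + \<xi> *\<^sub>R w) - \<xi> *\<^sub>R L w" w] by (simp add: power2_eq_square)
    moreover have "inner (G (p + \<xi> *\<^sub>R w) - \<xi> *\<^sub>R L w) w = F q - F p - inner (L w) w / 2"
      using xi(3) by (simp add: \<phi>_def \<phi>'_def inner_diff_left w_def)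
    ultimately show "\<bar>F q - F p - inner (L (q - p)) (q - p) / 2\<bar> \<le> e * (norm (q - p))\<^sup>2"
      by (simp add: w_def)
  qed
qed

text \<open>
  The first derivative of \<open>F\<close> vanishes at \<open>p\<close>, so the second-order term of a Taylor expansion sees \<open>\<gamma>\<close> only
  through its velocity; the curve has to be differentiable at the single point \<open>0\<close>, which is
  exactly what the definition of tangent vectors provides.
\<close>

lemma second_order_necessary:
  fixes F :: "'a::euclidean_space \<Rightarrow> real"
  assumes "open U" "p \<in> U"
    and F: "\<And>x. x \<in> U \<Longrightarrow> (F has_derivative (\<lambda>v. inner (G x) v)) (at x)"
    and G: "(G has_derivative L) (at p)" and crit: "G p = 0"
    and \<gamma>: "\<gamma> 0 = p" "(\<gamma> has_vector_derivative v) (at 0)"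
    and le: "eventually (\<lambda>t. F (\<gamma> t) \<le> F p) (at 0)"
  shows "inner (L v) v \<le> 0"
proof (rule field_le_epsilon)
  fix e :: real assume e: "e > 0"
  have bl: "bounded_linear L" using G has_derivative_bounded_linear by blast
  have quot: "((\<lambda>t. (1/t) *\<^sub>R (\<gamma> t - p)) \<longlongrightarrow> v) (at 0)"
  proof (rule Lim_transform2[OF tendsto_const], rule tendsto_norm_zero_cancel)
    have "((\<lambda>y. norm ((1 / norm (y - 0)) *\<^sub>R (\<gamma> y - (\<gamma> 0 + (y - 0) *\<^sub>R v)))) \<longlongrightarrow> 0) (at 0)"
      using \<gamma>(2) unfolding has_vector_derivative_def has_derivative_at2 by (metis tendsto_norm_zero)
    moreover have "eventually (\<lambda>y. norm ((1 / norm (y - 0)) *\<^sub>R (\<gamma> y - (\<gamma> 0 + (y - 0) *\<^sub>R v)))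
       = norm (v - (1/y) *\<^sub>R (\<gamma> y - p))) (at 0)"
      unfolding eventually_at_filter
    proof (intro always_eventually allI impI)
      fix y :: real assume "y \<noteq> 0"
      then have "v - (1/y) *\<^sub>R (\<gamma> y - p) = (-1/y) *\<^sub>R (\<gamma> y - (\<gamma> 0 + (y - 0) *\<^sub>R v))"
        using \<gamma>(1) by (simp add: algebra_simps)
      then show "norm ((1 / norm (y - 0)) *\<^sub>R (\<gamma> y - (\<gamma> 0 + (y - 0) *\<^sub>R v))) = norm (v - (1/y) *\<^sub>R (\<gamma> y - p))"
        by simp
    qed
    ultimately show "((\<lambda>y. norm (v - (1/y) *\<^sub>R (\<gamma> y - p))) \<longlongrightarrow> 0) (at 0)"
      using tendsto_cong by fast
  qed
  define Q where "Q t = (1/t) *\<^sub>R (\<gamma> t - p)" for t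
  define e' where "e' = e / (2 * ((norm v)\<^sup>2 + 1))"
  have e': "e' > 0" using e by (simp add: e'_def add_nonneg_pos)
  have N1: "2 * ((norm v)\<^sup>2 + 1) \<noteq> 0" using add_nonneg_pos[of "(norm v)\<^sup>2" 1] by simp
  obtain d where d: "d > 0" "\<And>q. norm (q - p) < d \<Longrightarrow> \<bar>F q - F p - inner (L (q - p)) (q - p) / 2\<bar> \<le> e' * (norm (q - p))\<^sup>2"
    using taylor_at_critical_point[OF assms(1,2) F G crit e'] by blast
  have cont: "(\<gamma> \<longlongrightarrow> p) (at 0)"
    using \<gamma> has_vector_derivative_continuous[OF \<gamma>(2)] by (simp add: continuous_at)
  have "eventually (\<lambda>t. norm (\<gamma> t - p) < d) (at 0)"
    using tendstoD[OF cont d(1)] by (simp add: dist_norm)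
  then have "eventually (\<lambda>t. inner (L (Q t)) (Q t) - 2 * e' * (norm (Q t))\<^sup>2 \<le> 0) (at 0)"
    using le eventually_neq_at_within[of "0::real" 0 UNIV]
  proof eventually_elim
    case (elim t)
    have a: "inner (L (\<gamma> t - p)) (\<gamma> t - p) \<le> 2 * e' * (norm (\<gamma> t - p))\<^sup>2"
      using d(2)[OF elim(1)] elim(2) by linarith
    have b: "\<gamma> t - p = t *\<^sub>R Q t" using elim(3) by (simp add: Q_def)
    have "t\<^sup>2 * inner (L (Q t)) (Q t) \<le> t\<^sup>2 * (2 * e' * (norm (Q t))\<^sup>2)"
      using a unfolding b using linear_cmul[OF bounded_linear.linear[OF bl]]
      by (simp add: power_mult_distrib power2_eq_square algebra_simps)
    then show ?case using elim(3) by simp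
  qed
  moreover have "((\<lambda>t. inner (L (Q t)) (Q t) - 2 * e' * (norm (Q t))\<^sup>2) \<longlongrightarrow> inner (L v) v - 2 * e' * (norm v)\<^sup>2) (at 0)"
    using quot unfolding Q_def[symmetric]
    by (intro tendsto_intros bounded_linear.tendsto[OF bl])
  ultimately have "inner (L v) v - 2 * e' * (norm v)\<^sup>2 \<le> 0"
    using tendsto_upperbound at_neq_bot by blast
  moreover have "2 * e' * (norm v)\<^sup>2 \<le> 2 * e' * ((norm v)\<^sup>2 + 1)" using e' by simp
  moreover have "2 * e' * ((norm v)\<^sup>2 + 1) = e"
    using nonzero_eq_divide_eq[OF N1, of e' e] e'_def by (metis mult.commute mult.left_commute) 
  ultimately show "inner (L v) v \<le> 0 + e" by linarith
qed


section \<open>Tangent spaces and oriented charts\<close>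

lemma tangent_space_subset_kernel:
  fixes f :: "'n::finite pt \<Rightarrow> real"
  assumes "open U" "p \<in> U" and S: "S \<inter> U = {x \<in> U. f x = 0}" and "v \<in> tangent_space S p"
    and f: "(f has_derivative (\<lambda>v. inner g v)) (at p)"
  shows "inner g v = 0"
proof -
  obtain \<gamma> \<epsilon> where \<gamma>: "\<epsilon> > 0" "\<gamma> ` {-\<epsilon><..<\<epsilon>} \<subseteq> S" "\<gamma> 0 = p" "(\<gamma> has_vector_derivative v) (at 0)"
    using assms(4) by (auto simp: tangent_space_def)
  have cont: "(\<gamma> \<longlongrightarrow> p) (at 0)"
    using \<gamma>(3) has_vector_derivative_continuous[OF \<gamma>(4)] by (simp add: continuous_at)
  have "eventually (\<lambda>t. \<gamma> t \<in> U) (nhds 0)"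
    using topological_tendstoD[OF cont assms(1,2)] \<gamma>(3) assms(2) by (simp add: eventually_nhds_conv_at)
  moreover have "eventually (\<lambda>t. t \<in> {-\<epsilon><..<\<epsilon>}) (nhds 0)"
    using \<gamma>(1) by (intro eventually_nhds_in_open) auto
  ultimately have ev: "eventually (\<lambda>t. f (\<gamma> t) = 0) (nhds 0)"
  proof eventually_elim
    case (elim t)
    then have "\<gamma> t \<in> S \<inter> U" using \<gamma>(2) by blast
    then show ?case using S by blast
  qed
  have f0: "(f has_derivative (\<lambda>v. inner g v)) (at (\<gamma> 0))" using f \<gamma>(3) by simp
  have 1: "((\<lambda>t. f (\<gamma> t)) has_derivative (\<lambda>t. inner g (t *\<^sub>R v))) (at 0)"
    by (rule has_derivative_compose[OF \<gamma>(4)[unfolded has_vector_derivative_def] f0])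
  have ev': "eventually (\<lambda>t. (\<lambda>_. 0) t = f (\<gamma> t)) (at 0)"
    using ev unfolding eventually_at_filter by (rule eventually_mono) simp
  have 2: "((\<lambda>t. f (\<gamma> t)) has_derivative (\<lambda>t. 0)) (at 0)"
    by (rule has_derivative_transform_eventually[OF has_derivative_const ev'])
      (use eventually_nhds_x_imp_x[OF ev] in simp_all)
  have "inner g ((1::real) *\<^sub>R v) = 0"
    by (rule fun_cong[OF has_derivative_unique[OF 1 2]])
  then show ?thesis by simp
qed

text \<open>
  The map \<open>\<Phi> x = x + (f x - g \<bullet> (x - p)) N\<close> with \<open>g \<bullet> N = 1\<close> has the identity as its derivative at \<open>p\<close> and satisfies
  \<open>g \<bullet> (\<Phi> x - p) = f x\<close>.  Its local inverse therefore maps lines orthogonal to \<open>g\<close> into the level set.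
\<close>

lemma kernel_subset_tangent_space:
  fixes f :: "'n::finite pt \<Rightarrow> real"
  assumes "open U" "p \<in> U" "p \<in> S" and S: "S \<inter> U = {x \<in> U. f x = 0}"
    and f: "\<And>x. x \<in> U \<Longrightarrow> (f has_derivative (\<lambda>v. inner (G x) v)) (at x)"
    and G: "continuous_on U G" and g: "G p \<noteq> 0" and v: "inner (G p) v = 0"
  shows "v \<in> tangent_space S p"
proof -
  define g where "g = G p"
  (* scaled so that the inner product of g and N is 1 *)
  define N where "N = g /\<^sub>R inner g g"
  have gN: "inner g N = 1" using g by (simp add: N_def g_def)
  define \<Phi> where "\<Phi> x = x + (f x - inner g (x - p)) *\<^sub>R N" for x
  define \<Phi>' where "\<Phi>' x = id_blinfun + (blinfun_scaleR_left N o\<^sub>L blinfun_inner_right (G x - g))" for x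
  have fp: "f p = 0" using assms by blast
  have ap: "blinfun_apply (\<Phi>' x) = (\<lambda>h. h + (inner (G x) h - inner g h) *\<^sub>R N)" for x
    by (auto simp: \<Phi>'_def blinfun.add_left inner_diff_left blinfun_inner_right.rep_eq blinfun_scaleR_left.rep_eq)
  have 1: "(\<Phi> has_derivative blinfun_apply (\<Phi>' x)) (at x)" if "x \<in> U" for x
    unfolding \<Phi>_def ap using f[OF that]
    by (auto intro!: derivative_eq_intros simp: inner_diff_right)
  have 2: "continuous_on U \<Phi>'"
    unfolding \<Phi>'_def
    by (intro continuous_intros bounded_linear.continuous_on[OF bounded_linear_blinfun_inner_right] G)
  have 3: "id_blinfun o\<^sub>L \<Phi>' p = id_blinfun"
    by (rule blinfun_eqI) (simp add: ap g_def)
  obtain U' V \<Psi> \<Psi>' where UV: "open U'" "U' \<subseteq> U" "p \<in> U'" "open V" "\<Phi> p \<in> V" "homeomorphism U' V \<Phi> \<Psi>"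
    and \<Psi>: "\<And>y. y \<in> V \<Longrightarrow> (\<Psi> has_derivative (\<Psi>' y)) (at y)"
    and \<Psi>': "\<And>y. y \<in> V \<Longrightarrow> \<Psi>' y = inv (blinfun_apply (\<Phi>' (\<Psi> y)))"
    using inverse_function_theorem[OF assms(1) 1 2 assms(2) 3] by metis
  have \<Phi>p: "\<Phi> p = p" by (simp add: \<Phi>_def fp)
  have \<Psi>p: "\<Psi> p = p" using UV \<Phi>p homeomorphism_apply1 by metis
  have "blinfun_apply (\<Phi>' p) = id" by (auto simp: ap g_def)
  then have \<Psi>'p: "\<Psi>' p = id" using \<Psi>'[of p] UV \<Phi>p \<Psi>p by (simp add: inv_id)
  define \<gamma> where "\<gamma> t = \<Psi> (p + t *\<^sub>R v)" for t
  have "open ((\<lambda>t. p + t *\<^sub>R v) -` V)" by (intro open_vimage UV continuous_intros)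
  moreover have "(0::real) \<in> (\<lambda>t. p + t *\<^sub>R v) -` V" using UV \<Phi>p by simp
  ultimately obtain \<epsilon> where \<epsilon>: "\<epsilon> > 0" "ball 0 \<epsilon> \<subseteq> (\<lambda>t::real. p + t *\<^sub>R v) -` V"
    using open_contains_ball by blast
  have "\<gamma> t \<in> S" if "t \<in> {-\<epsilon><..<\<epsilon>}" for t
  proof -
    have V: "p + t *\<^sub>R v \<in> V" using \<epsilon> that by (auto simp: subset_iff dist_norm abs_less_iff)
    then have "\<Phi> (\<gamma> t) = p + t *\<^sub>R v" "\<gamma> t \<in> U'"
      using UV(6) by (auto simp: \<gamma>_def homeomorphism_def)
    then have "inner g (\<Phi> (\<gamma> t) - p) = 0" using v by (simp add: g_def)
    moreover have "inner g (\<Phi> (\<gamma> t) - p) = f (\<gamma> t)"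
      using gN by (simp add: \<Phi>_def inner_add_right inner_diff_right)
    ultimately have "\<gamma> t \<in> {x \<in> U. f x = 0}" using \<open>\<gamma> t \<in> U'\<close> UV by auto
    then show ?thesis using S by blast
  qed
  moreover have "(\<gamma> has_vector_derivative v) (at 0)"
  proof -
    have "((\<lambda>t. p + t *\<^sub>R v) has_derivative (\<lambda>t. t *\<^sub>R v)) (at 0)"
      by (auto intro!: derivative_eq_intros)
    from has_derivative_compose[OF this, of \<Psi> id] show ?thesis
      using \<Psi>[of p] UV \<Phi>p \<Psi>'p unfolding \<gamma>_def has_vector_derivative_def by simp
  qed
  ultimately show ?thesis using \<epsilon>(1) \<Psi>p unfolding tangent_space_def
    by (intro CollectI exI[of _ \<gamma>] exI[of _ \<epsilon>]) (auto simp: \<gamma>_def)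
qed

lemma tangent_space_level_set:
  fixes f :: "'n::finite pt \<Rightarrow> real"
  assumes "open U" "p \<in> U" "p \<in> S" and S: "S \<inter> U = {x \<in> U. f x = 0}"
    and f: "\<And>x. x \<in> U \<Longrightarrow> (f has_derivative (\<lambda>v. inner (G x) v)) (at x)"
    and G: "continuous_on U G" and g: "G p \<noteq> 0"
  shows "tangent_space S p = {v. inner (G p) v = 0}"
  using tangent_space_subset_kernel[OF assms(1,2,4) _ f[OF assms(2)]] kernel_subset_tangent_space[OF assms]
  by blast

lemma orthogonal_to_kernel:
  fixes g w :: "'a::real_inner"
  assumes "\<And>v. inner g v = 0 \<Longrightarrow> inner w v = 0" "g \<noteq> 0"
  shows "w = (inner w g / inner g g) *\<^sub>R g"
proof -
  define v where "v = w - (inner w g / inner g g) *\<^sub>R g"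
  have gv: "inner g v = 0" using assms(2) by (simp add: v_def inner_diff_right inner_commute)
  have "inner w v = 0" using assms(1)[OF gv] .
  then have "inner v v = 0" using gv by (subst (1) v_def) (simp add: inner_diff_left)
  then show ?thesis by (simp add: v_def)
qed

definition covector_gradient :: "('a::euclidean_space \<Rightarrow>\<^sub>L real) \<Rightarrow> 'a"
  where "covector_gradient A = (\<Sum>b\<in>Basis. blinfun_apply A b *\<^sub>R b)"

lemma inner_covector_gradient: "inner (covector_gradient A) v = blinfun_apply A v"
proof -
  have "blinfun_apply A v = blinfun_apply A (\<Sum>b\<in>Basis. inner v b *\<^sub>R b)"
    by (simp add: euclidean_representation)
  also have "\<dots> = (\<Sum>b\<in>Basis. inner v b * blinfun_apply A b)"
    by (simp add: blinfun.sum_right blinfun.scaleR_right)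
  finally show ?thesis
    by (simp add: covector_gradient_def inner_sum_left inner_commute[of v] mult.commute)
qed

lemma bounded_linear_covector_gradient: "bounded_linear covector_gradient"
  unfolding covector_gradient_def
  by (intro bounded_linear_sum bounded_linear_compose[OF bounded_linear_scaleR_left]
        blinfun.bounded_linear_left)

text \<open>
  A neighbourhood in which the hypersurface is a regular level set of \<open>f\<close>; the gradient \<open>G\<close> and the Hessian \<open>G'\<close>
  replace the derivatives, so that all first-order and second-order data are vectors and operators of the ambient
  Euclidean space.
\<close>

definition chart :: "('n::finite pt) set \<Rightarrow> ('n pt) set \<Rightarrow> ('n pt \<Rightarrow> real) \<Rightarrow>
    ('n pt \<Rightarrow> 'n pt) \<Rightarrow> ('n pt \<Rightarrow> 'n pt \<Rightarrow>\<^sub>L 'n pt) \<Rightarrow> bool"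
  where "chart S U f G G' \<longleftrightarrow> open U \<and> U \<subseteq> halfspace \<and>
    (\<forall>x\<in>U. (f has_derivative (\<lambda>v. inner (G x) v)) (at x)) \<and>
    (\<forall>x\<in>U. (G has_derivative blinfun_apply (G' x)) (at x)) \<and>
    continuous_on U G' \<and> (\<forall>x\<in>U. G x \<noteq> 0) \<and> S \<inter> U = {x \<in> U. f x = 0}"

text \<open>
  The unit normal for the hyperbolic metric is \<open>snd x\<close> times the Euclidean one.
\<close>

definition oriented_chart :: "('n::finite pt) set \<Rightarrow> ('n pt \<Rightarrow> 'n pt) \<Rightarrow> ('n pt) set \<Rightarrow> ('n pt \<Rightarrow> real) \<Rightarrow>
    ('n pt \<Rightarrow> 'n pt) \<Rightarrow> ('n pt \<Rightarrow> 'n pt \<Rightarrow>\<^sub>L 'n pt) \<Rightarrow> bool"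
  where "oriented_chart S \<nu> U f G G' \<longleftrightarrow> chart S U f G G' \<and>
    (\<forall>x\<in>S \<inter> U. \<nu> x = (snd x / norm (G x)) *\<^sub>R G x)"

lemma chart_exists:
  assumes "C2_hypersurface S" "p \<in> S"
  shows "\<exists>U f G G'. p \<in> U \<and> chart S U f G G'"
proof -
  have "\<exists>U (f :: 'a pt \<Rightarrow> real). open U \<and> p \<in> U \<and> U \<subseteq> halfspace \<and> C2_on U f \<and>
       (\<forall>x\<in>U. frechet_derivative f (at x) \<noteq> (\<lambda>_. 0)) \<and> S \<inter> U = {x \<in> U. f x = 0}"
    using assms unfolding C2_hypersurface_def by (elim conjE) (rule bspec)
  then obtain U and f :: "'a pt \<Rightarrow> real" where U: "open U" "p \<in> U" "U \<subseteq> halfspace" "C2_on U f"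
    and nz: "\<And>x. x \<in> U \<Longrightarrow> frechet_derivative f (at x) \<noteq> (\<lambda>_. 0)" and S: "S \<inter> U = {x \<in> U. f x = 0}"
    by (elim exE conjE) (rule that, assumption+, erule (1) bspec, assumption)
  obtain f' f'' where f': "\<And>x. x \<in> U \<Longrightarrow> (f has_derivative blinfun_apply (f' x)) (at x)"
    and f'': "\<And>x. x \<in> U \<Longrightarrow> (f' has_derivative blinfun_apply (f'' x)) (at x)"
    and cont: "continuous_on U f''"
    using U(4) unfolding C2_on_def by blast
  let ?R = "Blinfun covector_gradient"
  note R = bounded_linear_Blinfun_apply[OF bounded_linear_covector_gradient]
  define G where "G x = covector_gradient (f' x)" for x
  define G' where "G' x = ?R o\<^sub>L f'' x" for x
  have "(f has_derivative (\<lambda>v. inner (G x) v)) (at x)" if "x \<in> U" for x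
    using f'[OF that] by (simp add: G_def inner_covector_gradient)
  moreover have "(G has_derivative blinfun_apply (G' x)) (at x)" if "x \<in> U" for x
    using bounded_linear.has_derivative[OF bounded_linear_covector_gradient f''[OF that]]
    unfolding G_def G'_def by (simp add: blinfun_compose.rep_eq comp_def R)
  moreover have "continuous_on U G'"
    unfolding G'_def
    by (rule bounded_linear.continuous_on[OF bounded_bilinear.bounded_linear_right[OF bounded_bilinear_blinfun_compose] cont])
  moreover have "G x \<noteq> 0" if "x \<in> U" for x
  proof
    assume "G x = 0"
    then have "blinfun_apply (f' x) = (\<lambda>_. 0)"
      using inner_covector_gradient[of "f' x"] by (auto simp: G_def)
    then show False using nz[OF that] frechet_derivative_at[OF f'[OF that]] by simp
  qed
  ultimately have "chart S U f G G'" using U S unfolding chart_def by blast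
  then show ?thesis using U by blast
qed

lemma chart_continuous_gradient: "chart S U f G G' \<Longrightarrow> continuous_on U G"
  unfolding chart_def by (meson continuous_at_imp_continuous_on has_derivative_continuous)

lemma chart_tangent_space:
  assumes "chart S U f G G'" "p \<in> S" "p \<in> U"
  shows "tangent_space S p = {v. inner (G p) v = 0}"
  using assms chart_continuous_gradient[OF assms(1)] unfolding chart_def
  by (intro tangent_space_level_set) auto

text \<open>
  This symmetry is what makes the shape operator self-adjoint.
\<close>

lemma chart_symmetric:
  assumes "chart S U f G G'" "p \<in> U"
  shows "inner (G' p u) v = inner (G' p v) u"
proof -
  have bl: "bounded_linear (blinfun_inner_right :: 'a pt \<Rightarrow> _)" by (rule bounded_linear_blinfun_inner_right)
  have 1: "(f has_derivative blinfun_apply (blinfun_inner_right (G x))) (at x)" if "x \<in> U" for x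
    using assms that unfolding chart_def by (simp add: blinfun_inner_right.rep_eq)
  have 2: "((\<lambda>x. blinfun_inner_right (G x)) has_derivative
     blinfun_apply (Blinfun blinfun_inner_right o\<^sub>L G' p)) (at p)"
    using bounded_linear.has_derivative[OF bl, of G "blinfun_apply (G' p)"] assms unfolding chart_def
    by (simp add: blinfun_compose.rep_eq comp_def bounded_linear_Blinfun_apply[OF bl])
  have "open U" using assms chart_def by blast
  from second_derivative_symmetric[OF this assms(2) 1 2, of u v] show ?thesis
    by (simp add: bounded_linear_Blinfun_apply[OF bl] blinfun_inner_right.rep_eq)
qed

lemma chart_subset:
  assumes "chart S U f G G'" "open V" "V \<subseteq> U"
  shows "chart S V f G G'"
  using assms unfolding chart_def by (auto intro: continuous_on_subset)

lemma chart_uminus: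
  assumes "chart S U f G G'"
  shows "chart S U (\<lambda>x. - f x) (\<lambda>x. - G x) (\<lambda>x. - G' x)"
  using assms unfolding chart_def
  by (auto intro!: continuous_intros derivative_eq_intros simp: blinfun.minus_left)

lemma chart_normal:
  assumes "chart S U f G G'" "p \<in> S" "p \<in> U" "unit_normal_field S \<nu>"
  shows "\<nu> p = (snd p / norm (G p)) *\<^sub>R G p \<or> \<nu> p = - ((snd p / norm (G p)) *\<^sub>R G p)"
proof -
  have y: "snd p > 0" using assms unfolding chart_def halfspace_def by blast
  have g: "G p \<noteq> 0" using assms unfolding chart_def by blast
  have n1: "hyp_metric p (\<nu> p) (\<nu> p) = 1" and n2: "\<And>X. X\<in>tangent_space S p \<Longrightarrow> hyp_metric p (\<nu> p) X = 0"
    using assms unfolding unit_normal_field_def by auto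
  define c where "c = inner (\<nu> p) (G p) / inner (G p) (G p)"
  have c: "\<nu> p = c *\<^sub>R G p"
    unfolding c_def
    by (rule orthogonal_to_kernel[OF _ g])
      (use n2 y chart_tangent_space[OF assms(1-3)] in \<open>auto simp: hyp_metric_def\<close>)
  have "inner (\<nu> p) (\<nu> p) = (snd p)\<^sup>2" using n1 y by (simp add: hyp_metric_def)
  then have "(c * norm (G p))\<^sup>2 = (snd p)\<^sup>2"
    by (simp add: c power_mult_distrib power2_norm_eq_inner) (simp add: power2_eq_square)
  then have "c * norm (G p) = snd p \<or> c * norm (G p) = - snd p" by (simp add: power2_eq_iff)
  then have "c = snd p / norm (G p) \<or> c = - (snd p / norm (G p))"
    using g by (auto simp: field_simps)
  then show ?thesis using c by auto
qed

text \<open>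
  The sign of \<open>f\<close> is chosen so that its gradient points in the direction of \<open>\<nu>\<close> at \<open>p\<close>; by continuity it does so nearby.
\<close>

lemma oriented_chart_exists:
  assumes "C2_hypersurface S" "p \<in> S" "unit_normal_field S \<nu>"
  shows "\<exists>U f G G'. p \<in> U \<and> oriented_chart S \<nu> U f G G'"
proof -
  obtain U f G G' where U: "p \<in> U" "chart S U f G G'" "\<nu> p = (snd p / norm (G p)) *\<^sub>R G p"
  proof -
    obtain U f G G' where U: "p \<in> U" "chart S U f G G'" using chart_exists[OF assms(1,2)] by blast
    from chart_normal[OF U(2) assms(2) U(1) assms(3)] show thesis
    proof
      assume "\<nu> p = - ((snd p / norm (G p)) *\<^sub>R G p)"
      then show thesis using that[OF U(1) chart_uminus[OF U(2)]] by simp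
    qed (use that U in auto)
  qed
  have y: "snd x > 0" "G x \<noteq> 0" if "x \<in> U" for x using that U unfolding chart_def halfspace_def by blast+
  have pos: "inner (\<nu> p) (G p) > 0" using U(3) y[OF U(1)] by simp
  have "continuous_on (S \<inter> U) (\<lambda>x. inner (\<nu> x) (G x))"
    using assms(3) chart_continuous_gradient[OF U(2)] unfolding unit_normal_field_def
    by (auto intro!: continuous_intros intro: continuous_on_subset)
  then have "openin (top_of_set (S \<inter> U)) ((S \<inter> U) \<inter> (\<lambda>x. inner (\<nu> x) (G x)) -` {0<..})"
    by (rule continuous_openin_preimage_gen) simp
  then obtain W where W: "open W" "(S \<inter> U) \<inter> (\<lambda>x. inner (\<nu> x) (G x)) -` {0<..} = (S \<inter> U) \<inter> W"
    by (auto simp: openin_open)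
  have "p \<in> U \<inter> W" using W(2) pos U(1) assms(2) by auto
  moreover have "chart S (U \<inter> W) f G G'"
    using chart_subset[OF U(2), of "U \<inter> W"] W(1) U(2) by (simp add: chart_def open_Int)
  moreover have "\<nu> x = (snd x / norm (G x)) *\<^sub>R G x" if x: "x \<in> S \<inter> (U \<inter> W)" for x
  proof -
    have "inner (\<nu> x) (G x) > 0" using x W(2) by auto
    moreover have "inner (- ((snd x / norm (G x)) *\<^sub>R G x)) (G x) < 0" using y[of x] x by simp
    ultimately show ?thesis using chart_normal[OF U(2) _ _ assms(3), of x] x by fastforce
  qed
  ultimately show ?thesis unfolding oriented_chart_def by blast
qed


section \<open>Self-adjoint operators\<close>

lemma quadratic_nonneg_linear_coeff:
  fixes a b :: real
  assumes "\<And>t. 0 \<le> 2 * t * a + t\<^sup>2 * b"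
  shows "a = 0"
proof (rule ccontr)
  assume a: "a \<noteq> 0"
  (* for this t the linear term dominates the quadratic one *)
  define t where "t = - a / (\<bar>b\<bar> + 1)"
  have pos: "\<bar>b\<bar> + 1 > 0" by simp
  have "t * (\<bar>b\<bar> + 1) = - a" using pos by (simp add: t_def)
  moreover have "t\<^sup>2 * b \<le> t * (t * (\<bar>b\<bar> + 1))"
    by (simp add: power2_eq_square mult.assoc[symmetric] mult_left_mono)
  moreover have "t * a < 0"
  proof -
    have "t * a = - (a\<^sup>2 / (\<bar>b\<bar> + 1))" by (simp add: t_def power2_eq_square)
    moreover have "a\<^sup>2 / (\<bar>b\<bar> + 1) > 0" using a pos by (intro divide_pos_pos) auto
    ultimately show ?thesis by linarith
  qed
  ultimately show False using assms[of t] by (simp add: mult.assoc)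
qed

text \<open>
  A maximum \<open>b\<close> of the Rayleigh quotient on the unit sphere of \<open>T\<close>, with value \<open>k\<close>: the quadratic form \<open>k |x|\<^sup>2 - L x \<bullet> x\<close>
  is nonnegative and vanishes at \<open>b\<close>, so its first variation at \<open>b\<close> vanishes.
\<close>

lemma self_adjoint_eigenvector:
  fixes L :: "'a::euclidean_space \<Rightarrow> 'a"
  assumes T: "subspace T" "T \<noteq> {0}" and L: "linear L" "\<And>x. x \<in> T \<Longrightarrow> L x \<in> T"
    and sym: "\<And>x y. x \<in> T \<Longrightarrow> y \<in> T \<Longrightarrow> inner (L x) y = inner x (L y)"
  shows "\<exists>b k. b \<in> T \<and> norm b = 1 \<and> L b = k *\<^sub>R b"
proof -
  let ?S = "sphere 0 1 \<inter> T"
  obtain x where x: "x \<in> T" "x \<noteq> 0" using T subspace_0 by blast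
  have "x /\<^sub>R norm x \<in> ?S" using x T subspace_scale by (auto simp: dist_norm)
  moreover have "compact ?S" using closed_subspace[OF T(1)] by (simp add: compact_Int_closed)
  moreover have "continuous_on ?S (\<lambda>x. inner (L x) x)"
    by (intro continuous_intros linear_continuous_on linear_conv_bounded_linear[THEN iffD1] L)
  ultimately obtain b where b: "b \<in> ?S" and max: "\<And>y. y \<in> ?S \<Longrightarrow> inner (L y) y \<le> inner (L b) b"
    using continuous_attains_sup[of ?S "\<lambda>x. inner (L x) x"] by blast
  define k where "k = inner (L b) b"
  have bT: "b \<in> T" and nb: "norm b = 1" using b by auto
  have q: "0 \<le> k * inner y y - inner (L y) y" if "y \<in> T" for y
  proof (cases "y = 0")
    case False
    have "y /\<^sub>R norm y \<in> ?S" using that T False subspace_scale by (auto simp: dist_norm)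
    from max[OF this] have "inner (L y) y / (norm y * norm y) \<le> k"
      using linear_cmul[OF L(1)] False by (simp add: k_def divide_simps)
    then show ?thesis using False
      by (simp add: field_simps dot_square_norm power2_eq_square)
  qed (simp add: linear_0[OF L(1)])
  have "inner (k *\<^sub>R b - L b) v = 0" if v: "v \<in> T" for v
  proof (rule quadratic_nonneg_linear_coeff)
    fix t :: real
    have "b + t *\<^sub>R v \<in> T" using T bT v by (simp add: subspace_add subspace_scale)
    note q[OF this]
    also have "k * inner (b + t *\<^sub>R v) (b + t *\<^sub>R v) - inner (L (b + t *\<^sub>R v)) (b + t *\<^sub>R v)
      = 2 * t * inner (k *\<^sub>R b - L b) v + t\<^sup>2 * (k * inner v v - inner (L v) v)"
    proof -
      have "inner (L v) b = inner (L b) v" using sym[OF v bT] by (simp add: inner_commute)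
      moreover have "k * inner b b = inner (L b) b" using nb by (simp add: k_def dot_square_norm)
      ultimately show ?thesis
        by (simp add: linear_add[OF L(1)] linear_cmul[OF L(1)] inner_add_left inner_add_right
            inner_diff_left inner_commute[of v b] algebra_simps power2_eq_square)
    qed
    finally show "0 \<le> 2 * t * inner (k *\<^sub>R b - L b) v + t\<^sup>2 * (k * inner v v - inner (L v) v)" .
  qed
  moreover have "k *\<^sub>R b - L b \<in> T" using T bT L(2) by (simp add: subspace_diff subspace_scale)
  ultimately have "inner (k *\<^sub>R b - L b) (k *\<^sub>R b - L b) = 0" by blast
  then have "L b = k *\<^sub>R b" by simp
  then show ?thesis using bT nb by blast
qed

text \<open>
  Induction on the dimension: the orthogonal complement of an eigenvector is invariant.
\<close>

lemma self_adjoint_eigenbasis: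
  fixes L :: "'a::euclidean_space \<Rightarrow> 'a"
  assumes T: "subspace T" and L: "linear L" "\<And>x. x \<in> T \<Longrightarrow> L x \<in> T"
    and sym: "\<And>x y. x \<in> T \<Longrightarrow> y \<in> T \<Longrightarrow> inner (L x) y = inner x (L y)"
  shows "\<exists>B. B \<subseteq> T \<and> pairwise orthogonal B \<and> (\<forall>b\<in>B. norm b = 1) \<and> finite B \<and> card B = dim T \<and>
    (\<forall>b\<in>B. \<exists>k. L b = k *\<^sub>R b)"
  using assms
proof (induction "dim T" arbitrary: T)
  case 0
  then show ?case by (intro exI[of _ "{}"]) auto
next
  case (Suc n)
  have "T \<noteq> {0}" using Suc(2) by auto
  then obtain b k where b: "b \<in> T" "norm b = 1" "L b = k *\<^sub>R b"
    using self_adjoint_eigenvector[OF Suc.prems(1) _ Suc.prems(2-4)] by blast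
  have bb: "inner b b = 1" using b by (simp add: dot_square_norm)
  define T' where "T' = T \<inter> {x. inner b x = 0}"
  have T': "subspace T'" unfolding T'_def
    using Suc.prems(1) subspace_hyperplane subspace_inter by blast
  have "b \<notin> span T'"
    using bb unfolding span_eq_iff[THEN iffD2, OF T'] by (simp add: T'_def)
  moreover have "T = span (insert b T')"
  proof
    show "span (insert b T') \<subseteq> T"
      using Suc.prems(1) b by (intro span_minimal) (auto simp: T'_def)
    show "T \<subseteq> span (insert b T')"
    proof
      fix x assume x: "x \<in> T"
      have "x - inner b x *\<^sub>R b \<in> T'"
        using x b bb Suc.prems(1) by (auto simp: T'_def subspace_diff subspace_scale inner_diff_right)
      then have "x - inner b x *\<^sub>R b \<in> span (insert b T')" by (simp add: span_base)
      moreover have "inner b x *\<^sub>R b \<in> span (insert b T')" by (simp add: span_base span_scale)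
      ultimately show "x \<in> span (insert b T')" by (metis diff_add_cancel span_add)
    qed
  qed
  ultimately have dim: "dim T = dim T' + 1" by (metis dim_insert dim_span Suc_eq_plus1)
  have "L x \<in> T'" if "x \<in> T'" for x
  proof -
    have "inner b (L x) = inner (L b) x" using that b Suc.prems(4)[of b x] by (simp add: T'_def)
    then show ?thesis using that b Suc.prems(3) by (simp add: T'_def)
  qed
  moreover have "n = dim T'" using dim Suc(2) by simp
  ultimately obtain B where B: "B \<subseteq> T'" "pairwise orthogonal B" "\<forall>b\<in>B. norm b = 1" "finite B"
    "card B = dim T'" "\<forall>b\<in>B. \<exists>k. L b = k *\<^sub>R b"
    using Suc(1)[of T'] T' Suc.prems(2,4) unfolding T'_def by (metis (no_types, lifting) IntD1)
  have "b \<notin> B" using B bb by (auto simp: T'_def)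
  then show ?case
    using B b dim
    by (intro exI[of _ "insert b B"])
      (auto simp: pairwise_insert T'_def orthogonal_def inner_commute)
qed

definition orthonormal_frame :: "('i \<Rightarrow> 'a::real_inner) \<Rightarrow> bool"
  where "orthonormal_frame e \<longleftrightarrow> (\<forall>i j. inner (e i) (e j) = (if i = j then 1 else 0))"

lemma orthonormal_frame_inj: "orthonormal_frame e \<Longrightarrow> inj e"
  unfolding orthonormal_frame_def inj_def by (metis zero_neq_one)

lemma orthonormal_frame_independent:
  fixes e :: "'i \<Rightarrow> 'a::euclidean_space"
  assumes "orthonormal_frame e"
  shows "independent (e ` A)" "pairwise orthogonal (e ` A)" "b \<in> e ` A \<Longrightarrow> norm b = 1"
proof -
  have a: "inner (e i) (e j) = (if i = j then 1 else 0)" for i j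
    using assms by (simp add: orthonormal_frame_def)
  show 1: "pairwise orthogonal (e ` A)" by (auto simp: pairwise_def orthogonal_def a)
  show "b \<in> e ` A \<Longrightarrow> norm b = 1" using a by (auto simp: norm_eq_1)
  have "0 \<notin> e ` A" using a by (metis (no_types, opaque_lifting) image_iff inner_zero_left zero_neq_one)
  then show "independent (e ` A)" using 1 pairwise_orthogonal_independent by blast
qed

lemma orthonormal_frame_expand:
  fixes e :: "'i::finite \<Rightarrow> 'a::euclidean_space"
  assumes e: "orthonormal_frame e" "\<And>i. e i \<in> T" and T: "subspace T" "dim T = CARD('i)" and x: "x \<in> T"
  shows "x = (\<Sum>i\<in>UNIV. inner x (e i) *\<^sub>R e i)"
proof -
  have "card (range e) = dim T" using orthonormal_frame_inj[OF e(1)] T by (simp add: card_image)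
  then have "T \<subseteq> span (range e)"
    using orthonormal_frame_independent(1)[OF e(1), of UNIV] e(2)
    by (intro card_ge_dim_independent) auto
  then have "x = (\<Sum>b\<in>range e. inner x b *\<^sub>R b)"
    using x orthonormal_frame_independent(3)[OF e(1), of _ UNIV] orthonormal_frame_independent(2)[OF e(1), of UNIV]
    by (intro orthonormal_basis_expand[symmetric]) auto
  also have "\<dots> = (\<Sum>i\<in>UNIV. inner x (e i) *\<^sub>R e i)"
    using orthonormal_frame_inj[OF e(1)] by (simp add: sum.reindex)
  finally show ?thesis .
qed

text \<open>
  The multiplicity of an eigenvalue in an orthonormal eigenbasis is the dimension of the eigenspace, hence
  independent of the basis.  Together with \<open>elem_sym_cong_multiplicity\<close> this makes the symmetric functions of the
  eigenvalues independent of the choice of an eigenbasis.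
\<close>

lemma eigenvalue_multiplicity:
  fixes e :: "'i::finite \<Rightarrow> 'a::euclidean_space"
  assumes e: "orthonormal_frame e" "\<And>i. e i \<in> T" and T: "subspace T" "dim T = CARD('i)" and L: "linear L"
    and ev: "\<And>i. L (e i) = \<kappa> i *\<^sub>R e i"
  shows "card {i. \<kappa> i = l} = dim {x \<in> T. L x = l *\<^sub>R x}"
proof -
  let ?B = "e ` {i. \<kappa> i = l}"
  have "{x \<in> T. L x = l *\<^sub>R x} \<subseteq> span ?B"
  proof
    fix x assume x: "x \<in> {x \<in> T. L x = l *\<^sub>R x}"
    have exp: "x = (\<Sum>i\<in>UNIV. inner x (e i) *\<^sub>R e i)"
      using orthonormal_frame_expand[OF e T] x by blast
    have Lx: "L x = (\<Sum>i\<in>UNIV. (inner x (e i) * \<kappa> i) *\<^sub>R e i)"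
      by (subst exp) (simp add: linear_sum[OF L] linear_cmul[OF L] ev)
    have "inner x (e j) *\<^sub>R e j \<in> span ?B" for j
    proof (cases "\<kappa> j = l")
      case False
      have "inner (L x) (e j) = inner x (e j) * \<kappa> j"
      proof -
        have "inner (L x) (e j) = (\<Sum>i\<in>UNIV. inner x (e i) * \<kappa> i * (if i = j then 1 else 0))"
          using e(1) unfolding Lx inner_sum_left inner_scaleR_left orthonormal_frame_def by presburger
        then show ?thesis by (simp add: if_distrib[of "(*) _"] cong: if_cong)
      qed
      then have "inner x (e j) * \<kappa> j = l * inner x (e j)" using x by auto
      then show ?thesis using False by (auto simp: span_zero)
    qed (simp add: span_base span_scale)
    then show "x \<in> span ?B" by (subst exp) (rule span_sum)
  qed
  moreover have "?B \<subseteq> {x \<in> T. L x = l *\<^sub>R x}" using e(2) ev by auto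
  moreover have "card ?B = card {i. \<kappa> i = l}"
    using orthonormal_frame_inj[OF e(1)] by (simp add: card_image inj_on_subset)
  ultimately show ?thesis
    using orthonormal_frame_independent(1)[OF e(1)] by (metis dim_unique)
qed

section \<open>Elementary symmetric functions\<close>

lemma prod_monom_const: "finite I \<Longrightarrow> (\<Prod>i\<in>I. monom (c i) 0) = monom (\<Prod>i\<in>I. c i) 0"
  for c :: "'i \<Rightarrow> 'a::comm_ring_1"
  by (induction I rule: finite_induct) (auto simp: mult_monom monom_0 one_pCons)

lemma prod_linear_eq_sum_subsets:
  fixes \<kappa> :: "'n::finite \<Rightarrow> real"
  shows "(\<Prod>i\<in>UNIV. [:\<kappa> i, 1:]) = (\<Sum>I\<in>UNIV. monom (\<Prod>i\<in>I. \<kappa> i) (CARD('n) - card I))"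
proof -
  have "(\<Prod>i\<in>UNIV. [:\<kappa> i, 1:]) = (\<Prod>i\<in>UNIV. monom (\<kappa> i) 0 + monom 1 1)"
    by (simp add: monom_0 monom_Suc flip: One_nat_def) (simp add: monom_Suc monom_0)
  also have "\<dots> = (\<Sum>I\<in>Pow UNIV. (\<Prod>i\<in>I. monom (\<kappa> i) 0) * (\<Prod>i\<in>UNIV - I. monom 1 1))"
    by (rule prod_add) simp
  also have "\<dots> = (\<Sum>I\<in>UNIV. monom (\<Prod>i\<in>I. \<kappa> i) (CARD('n) - card I))"
    by (rule sum.cong) (auto simp: prod_monom_const monom_power mult_monom card_Diff_subset)
  finally show ?thesis .
qed

lemma coeff_prod_linear:
  fixes \<kappa> :: "'n::finite \<Rightarrow> real"
  assumes "j \<le> CARD('n)"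
  shows "coeff (\<Prod>i\<in>UNIV. [:\<kappa> i, 1:]) (CARD('n) - j) = elem_sym j \<kappa>"
proof -
  have "(CARD('n) - card I = CARD('n) - j) = (card I = j)" for I :: "'n set"
    using assms card_mono[of UNIV I] by auto
  then show ?thesis
    unfolding prod_linear_eq_sum_subsets elem_sym_def
    by (simp add: coeff_sum sum.If_cases)
qed

text \<open>
  Up to order, the elementary symmetric functions are the coefficients of \<open>\<Prod>i. (X + \<kappa> i)\<close>, a product that
  depends only on the multiset of the values.
\<close>

lemma elem_sym_cong_multiplicity:
  fixes \<kappa> \<kappa>' :: "'n::finite \<Rightarrow> real"
  assumes "\<And>l. card {i. \<kappa> i = l} = card {i. \<kappa>' i = l}"
  shows "elem_sym r \<kappa> = elem_sym r \<kappa>'"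
proof (cases "r \<le> CARD('n)")
  case True
  have "image_mset \<kappa> (mset_set UNIV) = image_mset \<kappa>' (mset_set UNIV)"
    by (rule multiset_eqI) (use assms in \<open>simp add: count_image_mset vimage_def Collect_conj_eq[symmetric] Int_def\<close>)
  then have "(\<Prod>i\<in>UNIV. [:\<kappa> i, 1:]) = (\<Prod>i\<in>UNIV. [:\<kappa>' i, 1:])"
  proof -
    assume eq: "image_mset \<kappa> (mset_set UNIV) = image_mset \<kappa>' (mset_set UNIV)"
    have "(\<Prod>i\<in>UNIV. [:c i, 1:]) = prod_mset (image_mset (\<lambda>k. [:k, 1:]) (image_mset c (mset_set UNIV)))"
      for c :: "'n \<Rightarrow> real"
      by (simp add: prod_unfold_prod_mset multiset.map_comp comp_def)
    then show ?thesis using eq by simp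
  qed
  then show ?thesis using coeff_prod_linear[OF True] by metis
next
  case False
  have "card I \<le> CARD('n)" for I :: "'n set" by (rule card_mono) auto
  then have "{I::'n set. card I = r} = {}" using False by fastforce
  then show ?thesis by (simp add: elem_sym_def)
qed


section \<open>The shape operator in a chart\<close>

lemma derivative_along_tangent_curve:
  fixes V :: "'n::finite pt \<Rightarrow> 'n pt"
  assumes D: "(V has_derivative D) (at p within S)"
    and \<gamma>: "\<epsilon> > 0" "\<gamma> ` {-\<epsilon><..<\<epsilon>} \<subseteq> S" "\<gamma> 0 = p" "(\<gamma> has_vector_derivative X) (at 0)"
  shows "((\<lambda>t. V (\<gamma> t)) has_vector_derivative D X) (at 0)"
proof -
  have "(V has_derivative D) (at (\<gamma> 0) within \<gamma> ` {-\<epsilon><..<\<epsilon>})"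
    using has_derivative_subset[OF D \<gamma>(2)] \<gamma>(3) by simp
  moreover have "(\<gamma> has_derivative (\<lambda>t. t *\<^sub>R X)) (at 0 within {-\<epsilon><..<\<epsilon>})"
    using \<gamma>(4) has_derivative_at_withinI unfolding has_vector_derivative_def by blast
  ultimately have "((\<lambda>t. V (\<gamma> t)) has_derivative (\<lambda>t. D (t *\<^sub>R X))) (at 0 within {-\<epsilon><..<\<epsilon>})"
    by (rule has_derivative_in_compose[rotated])
  moreover have "at 0 within {-\<epsilon><..<\<epsilon>} = at (0::real)"
    using \<gamma>(1) by (intro at_within_open) auto
  ultimately show ?thesis
    using linear_cmul[OF has_derivative_linear[OF D]] by (simp add: has_vector_derivative_def)
qed

text \<open>
  A derivative within a hypersurface is not unique, but its values on tangent vectors are: they are the derivatives along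
  curves in the hypersurface.
\<close>

lemma derivative_within_on_tangent_space:
  fixes V :: "'n::finite pt \<Rightarrow> 'n pt"
  assumes D: "(V has_derivative D) (at p within S)" and D': "(V has_derivative D') (at p within S)"
    and "X \<in> tangent_space S p"
  shows "D X = D' X"
proof -
  obtain \<gamma> \<epsilon> where \<gamma>: "\<epsilon> > 0" "\<gamma> ` {-\<epsilon><..<\<epsilon>} \<subseteq> S" "\<gamma> 0 = p" "(\<gamma> has_vector_derivative X) (at 0)"
    using assms(3) by (auto simp: tangent_space_def)
  show ?thesis
    using derivative_along_tangent_curve[OF D \<gamma>] derivative_along_tangent_curve[OF D' \<gamma>]
    by (rule vector_derivative_unique_at)
qed

text \<open>
  The formula for the shape operator in a chart.  In terms of the Euclidean unit normal \<open>n = G / |G|\<close> it reads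
  \<open>X \<mapsto> snd n X - y Dn X\<close> with \<open>y = snd p\<close>, the usual relation between the hyperbolic and the Euclidean shape
  operator.  It is defined for all ambient vectors \<open>X\<close>, which is convenient for limits at varying points.
\<close>

definition weingarten :: "('n::finite pt \<Rightarrow> 'n pt) \<Rightarrow> ('n pt \<Rightarrow> 'n pt \<Rightarrow>\<^sub>L 'n pt) \<Rightarrow> 'n pt \<Rightarrow> 'n pt \<Rightarrow> 'n pt"
  where "weingarten G G' p X = (snd (G p) / norm (G p)) *\<^sub>R X - (snd p / norm (G p)) *\<^sub>R
     (blinfun_apply (G' p) X - (inner (G p) (blinfun_apply (G' p) X) / inner (G p) (G p)) *\<^sub>R G p)"

lemma oriented_chart_normal_derivative:
  assumes "oriented_chart S \<nu> U f G G'" "p \<in> S" "p \<in> U"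
  shows "(\<nu> has_derivative (\<lambda>X. (snd X / norm (G p)) *\<^sub>R G p + (snd p / norm (G p)) *\<^sub>R
     (blinfun_apply (G' p) X - (inner (G p) (blinfun_apply (G' p) X) / inner (G p) (G p)) *\<^sub>R G p))) (at p within S)"
proof -
  have ch: "chart S U f G G'" and nu: "\<And>x. x \<in> S \<inter> U \<Longrightarrow> \<nu> x = (snd x / norm (G x)) *\<^sub>R G x"
    using assms(1) unfolding oriented_chart_def by auto
  have U: "open U" and g: "G p \<noteq> 0" and dG: "(G has_derivative blinfun_apply (G' p)) (at p)"
    using ch assms(3) unfolding chart_def by auto
  have dn: "((\<lambda>x. norm (G x)) has_derivative (\<lambda>X. inner (blinfun_apply (G' p) X) (sgn (G p)))) (at p)"
    by (rule has_derivative_compose[OF dG has_derivative_norm[OF g]])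
  have nz: "norm (G p) \<noteq> 0" using g by simp
  have "((\<lambda>x. (snd x / norm (G x)) *\<^sub>R G x) has_derivative
     (\<lambda>X. (snd p / norm (G p)) *\<^sub>R blinfun_apply (G' p) X +
        ((snd X * norm (G p) - snd p * inner (blinfun_apply (G' p) X) (sgn (G p))) / (norm (G p) * norm (G p))) *\<^sub>R G p)) (at p)"
    by (rule has_derivative_scaleR[OF has_derivative_divide'[OF has_derivative_snd[OF has_derivative_ident] dn nz] dG])
  moreover have "(snd p / norm (G p)) *\<^sub>R blinfun_apply (G' p) X +
        ((snd X * norm (G p) - snd p * inner (blinfun_apply (G' p) X) (sgn (G p))) / (norm (G p) * norm (G p))) *\<^sub>R G p
     = (snd X / norm (G p)) *\<^sub>R G p + (snd p / norm (G p)) *\<^sub>R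
     (blinfun_apply (G' p) X - (inner (G p) (blinfun_apply (G' p) X) / inner (G p) (G p)) *\<^sub>R G p)" for X
  proof -
    have "(snd X * norm (G p) - snd p * inner (blinfun_apply (G' p) X) (sgn (G p))) / (norm (G p) * norm (G p))
      = snd X / norm (G p) - snd p / norm (G p) * (inner (G p) (blinfun_apply (G' p) X) / inner (G p) (G p))"
      using nz by (simp add: sgn_div_norm inner_commute dot_square_norm power2_eq_square field_simps)
    then show ?thesis by (simp only:) (simp add: algebra_simps)
  qed
  ultimately have "((\<lambda>x. (snd x / norm (G x)) *\<^sub>R G x) has_derivative (\<lambda>X. (snd X / norm (G p)) *\<^sub>R G p + (snd p / norm (G p)) *\<^sub>R
     (blinfun_apply (G' p) X - (inner (G p) (blinfun_apply (G' p) X) / inner (G p) (G p)) *\<^sub>R G p))) (at p)"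
    by simp
  then have 1: "((\<lambda>x. (snd x / norm (G x)) *\<^sub>R G x) has_derivative (\<lambda>X. (snd X / norm (G p)) *\<^sub>R G p + (snd p / norm (G p)) *\<^sub>R
     (blinfun_apply (G' p) X - (inner (G p) (blinfun_apply (G' p) X) / inner (G p) (G p)) *\<^sub>R G p))) (at p within S)"
    by (rule has_derivative_at_withinI)
  have "eventually (\<lambda>x. x \<in> U) (nhds p)" using U assms(3) by (rule eventually_nhds_in_open)
  then have "eventually (\<lambda>x. (snd x / norm (G x)) *\<^sub>R G x = \<nu> x) (at p within S)"
    unfolding eventually_at_filter by eventually_elim (use nu in auto)
  then show ?thesis
    by (rule has_derivative_transform_eventually[OF 1]) (use nu assms in auto)
qed

text \<open>
  The terms with \<open>snd X\<close> coming from the factor \<open>snd x\<close> of the normal and from the Christoffel symbol cancel.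
\<close>

lemma shape_operator_chart:
  assumes "oriented_chart S \<nu> U f G G'" "p \<in> S" "p \<in> U" "inner (G p) X = 0"
  shows "shape_operator S \<nu> p X = weingarten G G' p X"
proof -
  have ch: "chart S U f G G'" and nu: "\<nu> p = (snd p / norm (G p)) *\<^sub>R G p"
    using assms unfolding oriented_chart_def by auto
  have X: "X \<in> tangent_space S p" using chart_tangent_space[OF ch assms(2,3)] assms(4) by simp
  have ph: "p \<in> halfspace" using ch assms(3) unfolding chart_def by blast
  then have y: "snd p \<noteq> 0" by (simp add: halfspace_def)
  note D = oriented_chart_normal_derivative[OF assms(1-3)]
  then have "(\<nu> has_derivative frechet_derivative \<nu> (at p within S)) (at p within S)"
    using differentiableI frechet_derivative_works by blast
  from derivative_within_on_tangent_space[OF this D X]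
  have 1: "frechet_derivative \<nu> (at p within S) X = (snd X / norm (G p)) *\<^sub>R G p + (snd p / norm (G p)) *\<^sub>R
     (blinfun_apply (G' p) X - (inner (G p) (blinfun_apply (G' p) X) / inner (G p) (G p)) *\<^sub>R G p)" .
  have 2: "christoffel p X (\<nu> p) = - (snd X / norm (G p)) *\<^sub>R G p - (snd (G p) / norm (G p)) *\<^sub>R X"
    unfolding christoffel_eq[OF ph] nu using y assms(4) by (simp add: inner_commute zero_prod_def)
  show ?thesis
    unfolding shape_operator_def levi_civita_def 1 2 weingarten_def by simp
qed

definition eigenframe ::
    "('n::finite pt) set \<Rightarrow> ('n pt \<Rightarrow> 'n pt) \<Rightarrow> 'n pt \<Rightarrow> ('n \<Rightarrow> real) \<Rightarrow> ('n \<Rightarrow> 'n pt) \<Rightarrow> bool"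
  where "eigenframe S \<nu> p \<kappa> e \<longleftrightarrow>
    (\<forall>i. e i \<in> tangent_space S p) \<and>
    (\<forall>i j. hyp_metric p (e i) (e j) = (if i = j then 1 else 0)) \<and>
    (\<forall>i. shape_operator S \<nu> p (e i) = \<kappa> i *\<^sub>R e i)"

lemma principal_curvatures_eq: "principal_curvatures S \<nu> p = (SOME \<kappa>. \<exists>e. eigenframe S \<nu> p \<kappa> e)"
  unfolding principal_curvatures_def eigenframe_def ..

lemma linear_weingarten: "linear (weingarten G G' p)"
  unfolding weingarten_def
  by (rule linearI) (simp_all add: blinfun.add_right blinfun.scaleR_right inner_add_right add_divide_distrib
      scaleR_add_left scaleR_add_right scaleR_diff_right algebra_simps)

lemma weingarten_tangent:
  assumes "G p \<noteq> 0" "inner (G p) X = 0"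
  shows "inner (G p) (weingarten G G' p X) = 0"
  using assms by (simp add: weingarten_def inner_diff_right)

lemma inner_weingarten:
  assumes "inner (G p) Y = 0"
  shows "inner (weingarten G G' p X) Y =
    (snd (G p) / norm (G p)) * inner X Y - (snd p / norm (G p)) * inner (blinfun_apply (G' p) X) Y"
  using assms by (simp add: weingarten_def inner_diff_left)

lemma orthonormal_frame_scaleR:
  assumes "snd p > 0"
  shows "orthonormal_frame (\<lambda>i. e i /\<^sub>R snd p) \<longleftrightarrow> (\<forall>i j. hyp_metric p (e i) (e j) = (if i = j then 1 else 0))"
  using assms unfolding orthonormal_frame_def hyp_metric_def
  by (simp add: divide_simps power2_eq_square)

lemma eigenframe_chart:
  assumes "oriented_chart S \<nu> U f G G'" "p \<in> S" "p \<in> U"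
  shows "eigenframe S \<nu> p \<kappa> e \<longleftrightarrow> orthonormal_frame (\<lambda>i. e i /\<^sub>R snd p) \<and> (\<forall>i. inner (G p) (e i) = 0) \<and>
     (\<forall>i. weingarten G G' p (e i) = \<kappa> i *\<^sub>R e i)"
proof -
  have ch: "chart S U f G G'" using assms unfolding oriented_chart_def by auto
  then have y: "snd p > 0" using assms(3) unfolding chart_def halfspace_def by blast
  have *: "(\<forall>i. shape_operator S \<nu> p (e i) = \<kappa> i *\<^sub>R e i) \<longleftrightarrow> (\<forall>i. weingarten G G' p (e i) = \<kappa> i *\<^sub>R e i)"
    if "\<forall>i. inner (G p) (e i) = 0"
    using shape_operator_chart[OF assms] that by metis
  show ?thesis
    unfolding eigenframe_def orthonormal_frame_scaleR[OF y] chart_tangent_space[OF ch assms(2,3)] mem_Collect_eq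
    by (cases "\<forall>i. inner (G p) (e i) = 0") (simp_all only: * simp_thms)
qed

text \<open>
  Scaling by \<open>snd p\<close> turns frames that are orthonormal for the Euclidean inner product into frames that are
  orthonormal for the hyperbolic metric.
\<close>

lemma eigenframe_chart':
  assumes "oriented_chart S \<nu> U f G G'" "p \<in> S" "p \<in> U"
  shows "eigenframe S \<nu> p \<kappa> (\<lambda>i. snd p *\<^sub>R u i) \<longleftrightarrow> orthonormal_frame u \<and> (\<forall>i. inner (G p) (u i) = 0) \<and>
     (\<forall>i. weingarten G G' p (u i) = \<kappa> i *\<^sub>R u i)"
proof -
  have ch: "chart S U f G G'" using assms unfolding oriented_chart_def by auto
  then have y: "snd p > 0" using assms(3) unfolding chart_def halfspace_def by blast
  have "weingarten G G' p (snd p *\<^sub>R u i) = \<kappa> i *\<^sub>R snd p *\<^sub>R u i \<longleftrightarrow> weingarten G G' p (u i) = \<kappa> i *\<^sub>R u i" for i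
  proof -
    have "weingarten G G' p (snd p *\<^sub>R u i) = snd p *\<^sub>R weingarten G G' p (u i)" by (rule linear_cmul[OF linear_weingarten])
    moreover have "\<kappa> i *\<^sub>R snd p *\<^sub>R u i = snd p *\<^sub>R (\<kappa> i *\<^sub>R u i)" by (rule scaleR_left_commute)
    ultimately show ?thesis using y by (simp only: scaleR_cancel_left) simp
  qed
  moreover have "inner (G p) (snd p *\<^sub>R u i) = 0 \<longleftrightarrow> inner (G p) (u i) = 0" for i using y by simp
  moreover have "(\<lambda>i. snd p *\<^sub>R u i /\<^sub>R snd p) = u" using y by simp
  ultimately show ?thesis unfolding eigenframe_chart[OF assms] by (simp only:)
qed

lemma dim_tangent:
  fixes g :: "'n::finite pt"
  assumes "g \<noteq> 0"
  shows "dim {v. inner g v = 0} = CARD('n)"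
  using dim_hyperplane[OF assms] by simp

lemma eigenframe_exists:
  fixes S :: "('n::finite pt) set"
  assumes "oriented_chart S \<nu> U f G G'" "p \<in> S" "p \<in> U"
  shows "\<exists>\<kappa> u. eigenframe S \<nu> p \<kappa> (\<lambda>i. snd p *\<^sub>R u i)"
proof -
  let ?T = "{v. inner (G p) v = 0}"
  have ch: "chart S U f G G'" using assms unfolding oriented_chart_def by auto
  then have g: "G p \<noteq> 0" using assms(3) unfolding chart_def by blast
  have sym: "inner (weingarten G G' p x) y = inner x (weingarten G G' p y)" if "x \<in> ?T" "y \<in> ?T" for x y
    using that inner_weingarten[of G p y G' x] inner_weingarten[of G p x G' y] chart_symmetric[OF ch assms(3), of x y]
    by (simp add: inner_commute)
  have "\<exists>B. B \<subseteq> ?T \<and> pairwise orthogonal B \<and> (\<forall>b\<in>B. norm b = 1) \<and> finite B \<and> card B = dim ?T \<and>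
    (\<forall>b\<in>B. \<exists>k. weingarten G G' p b = k *\<^sub>R b)"
    by (rule self_adjoint_eigenbasis[OF subspace_hyperplane linear_weingarten _ sym])
      (use weingarten_tangent[of G p, OF g] in auto)
  then obtain B where B: "B \<subseteq> ?T" "pairwise orthogonal B" "\<forall>b\<in>B. norm b = 1" "finite B" "card B = dim ?T"
    "\<forall>b\<in>B. \<exists>k. weingarten G G' p b = k *\<^sub>R b"
    by (elim exE conjE) (rule that)
  obtain u :: "'n \<Rightarrow> 'n pt" where u: "bij_betw u UNIV B"
    using finite_same_card_bij[of "UNIV :: 'n set" B] B dim_tangent[OF g] by auto
  then have uB: "u i \<in> B" for i by (auto simp: bij_betw_def)
  have "\<forall>i. \<exists>k. weingarten G G' p (u i) = k *\<^sub>R u i" using B(6) uB by blast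
  from choice[OF this] obtain \<kappa> where \<kappa>: "\<forall>i. weingarten G G' p (u i) = \<kappa> i *\<^sub>R u i" by blast
  have "inner (u i) (u j) = (if i = j then 1 else 0)" for i j
  proof (cases "i = j")
    case True
    then show ?thesis using B(3) uB[of i] by (simp add: norm_eq_1)
  next
    case False
    then have "u i \<noteq> u j" using u by (auto simp: bij_betw_def inj_def)
    then show ?thesis using False pairwiseD[OF B(2) uB uB] by (simp add: orthogonal_def)
  qed
  then have "orthonormal_frame u" by (simp add: orthonormal_frame_def)
  moreover have "\<forall>i. inner (G p) (u i) = 0" using uB B(1) by blast
  ultimately have "eigenframe S \<nu> p \<kappa> (\<lambda>i. snd p *\<^sub>R u i)"
    using \<kappa> eigenframe_chart'[OF assms, of \<kappa> u] by (simp only: simp_thms)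
  then have "\<exists>u. eigenframe S \<nu> p \<kappa> (\<lambda>i. snd p *\<^sub>R u i)"
    by (rule exI[of "\<lambda>u. eigenframe S \<nu> p \<kappa> (\<lambda>i. snd p *\<^sub>R u i)" u])
  then show ?thesis by (rule exI[of "\<lambda>\<kappa>. \<exists>u. eigenframe S \<nu> p \<kappa> (\<lambda>i. snd p *\<^sub>R u i)" \<kappa>])
qed

lemma eigenframe_elem_sym_unique:
  fixes S :: "('n::finite pt) set"
  assumes "oriented_chart S \<nu> U f G G'" "p \<in> S" "p \<in> U" "eigenframe S \<nu> p \<kappa> e" "eigenframe S \<nu> p \<kappa>' e'"
  shows "elem_sym r \<kappa> = elem_sym r \<kappa>'"
proof -
  let ?T = "{v. inner (G p) v = 0}"
  have ch: "chart S U f G G'" using assms unfolding oriented_chart_def by auto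
  then have g: "G p \<noteq> 0" using assms(3) unfolding chart_def by blast
  have mult: "card {i. \<kappa> i = l} = dim {x \<in> ?T. weingarten G G' p x = l *\<^sub>R x}" if "eigenframe S \<nu> p \<kappa> e" for \<kappa> e l
  proof (rule eigenvalue_multiplicity[where e = "\<lambda>i. e i /\<^sub>R snd p", OF _ _ subspace_hyperplane dim_tangent[OF g] linear_weingarten])
    have fr: "orthonormal_frame (\<lambda>i. e i /\<^sub>R snd p)" "\<And>i. inner (G p) (e i) = 0"
      "\<And>i. weingarten G G' p (e i) = \<kappa> i *\<^sub>R e i"
      using that unfolding eigenframe_chart[OF assms(1-3)] by blast+
    show "orthonormal_frame (\<lambda>i. e i /\<^sub>R snd p)" by (rule fr)
    show "e i /\<^sub>R snd p \<in> ?T" for i using fr(2) by simp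
    show "weingarten G G' p (e i /\<^sub>R snd p) = \<kappa> i *\<^sub>R (e i /\<^sub>R snd p)" for i
      by (simp add: linear_cmul[OF linear_weingarten] fr(3))
  qed
  show ?thesis
    by (rule elem_sym_cong_multiplicity) (simp only: mult[OF assms(4)] mult[OF assms(5)])
qed

lemma principal_curvatures_eigenframe:
  assumes "C2_hypersurface S" "unit_normal_field S \<nu>" "p \<in> S"
  shows "\<exists>e. eigenframe S \<nu> p (principal_curvatures S \<nu> p) e"
proof -
  obtain U f G G' where U: "p \<in> U" "oriented_chart S \<nu> U f G G'"
    using oriented_chart_exists[OF assms(1,3,2)] by (elim exE conjE) (rule that)
  have ex: "\<exists>\<kappa> e. eigenframe S \<nu> p \<kappa> e"
  proof -
    obtain \<kappa> u where "eigenframe S \<nu> p \<kappa> (\<lambda>i. snd p *\<^sub>R u i)"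
      using eigenframe_exists[OF U(2) assms(3) U(1)] by (elim exE) (rule that)
    then have "\<exists>e. eigenframe S \<nu> p \<kappa> e"
      by (rule exI[of "\<lambda>e. eigenframe S \<nu> p \<kappa> e" "\<lambda>i. snd p *\<^sub>R u i"])
    then show ?thesis by (rule exI[of "\<lambda>\<kappa>. \<exists>e. eigenframe S \<nu> p \<kappa> e" \<kappa>])
  qed
  from someI_ex[OF ex] show ?thesis by (simp only: principal_curvatures_eq)
qed

text \<open>
  The principal curvatures come from an arbitrary choice; this lemma allows any eigenframe to be used in their place.
\<close>

lemma elem_sym_principal_curvatures:
  assumes "C2_hypersurface S" "unit_normal_field S \<nu>" "p \<in> S" "eigenframe S \<nu> p \<kappa> e"
  shows "elem_sym r (principal_curvatures S \<nu> p) = elem_sym r \<kappa>"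
proof -
  obtain U f G G' where U: "p \<in> U" "oriented_chart S \<nu> U f G G'"
    using oriented_chart_exists[OF assms(1,3,2)] by (elim exE conjE) (rule that)
  obtain e' where e': "eigenframe S \<nu> p (principal_curvatures S \<nu> p) e'"
    using principal_curvatures_eigenframe[OF assms(1-3)] by (elim exE) (rule that)
  show ?thesis by (rule eigenframe_elem_sym_unique[OF U(2) assms(3) U(1) e' assms(4)])
qed


section \<open>Continuity of the symmetric functions of the principal curvatures\<close>

lemma bounded_orthonormal_frames:
  fixes E :: "nat \<Rightarrow> ('a::euclidean_space) ^ 'n::finite"
  assumes "\<And>k. orthonormal_frame (\<lambda>i. E k $ i)"
  shows "\<exists>l r. strict_mono r \<and> (E \<circ> r) \<longlonglongrightarrow> l"
proof -
  have "E k \<in> cball 0 (real CARD('n))" for k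
  proof -
    have "norm (E k $ i) = 1" for i using assms[of k] by (simp add: orthonormal_frame_def norm_eq_1)
    then have "norm (E k) \<le> (\<Sum>i\<in>(UNIV::'n set). 1)"
      unfolding norm_vec_def by (metis (no_types, lifting) L2_set_le_sum sum.cong zero_le_one)
    then show ?thesis by simp
  qed
  then show ?thesis
    using compact_imp_seq_compact[OF compact_cball, of "0 :: 'a ^ 'n" "real CARD('n)"] unfolding seq_compact_def by blast
qed

text \<open>
  Orthonormal frames form a compact set, so along a convergent sequence of points the eigenframes subconverge.
  The limit is an eigenframe at the limit point, and its eigenvalues determine the value of the symmetric function there.
\<close>

lemma continuous_on_elem_sym_principal_curvatures:
  fixes S :: "('n::finite pt) set"
  assumes S: "C2_hypersurface S" "unit_normal_field S \<nu>"
  shows "continuous_on S (\<lambda>p. elem_sym r (principal_curvatures S \<nu> p))"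
  unfolding continuous_on_sequentially
proof (intro allI ballI impI)
  let ?f = "\<lambda>p. elem_sym r (principal_curvatures S \<nu> p)"
  fix x a assume a: "a \<in> S" and "(\<forall>n. x n \<in> S) \<and> x \<longlonglongrightarrow> a"
  then have x: "\<And>n. x n \<in> S" "x \<longlonglongrightarrow> a" by auto
  obtain U f G G' where U: "a \<in> U" "oriented_chart S \<nu> U f G G'"
    using oriented_chart_exists[OF S(1) a S(2)] by (elim exE conjE) (rule that)
  have ch: "chart S U f G G'" using U(2) unfolding oriented_chart_def by blast
  have open_U: "open U" and G0: "G a \<noteq> 0" and ya: "snd a > 0" and cG': "continuous_on U G'"
    using ch U(1) unfolding chart_def halfspace_def by auto
  show "(?f \<circ> x) \<longlonglongrightarrow> ?f a"
  proof (rule ccontr)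
    assume "\<not> (?f \<circ> x) \<longlonglongrightarrow> ?f a"
    then obtain \<epsilon> where \<epsilon>: "\<epsilon> > 0" "\<not> eventually (\<lambda>n. dist (?f (x n)) (?f a) < \<epsilon>) sequentially"
      unfolding tendsto_iff by auto
    define Q where "Q n \<longleftrightarrow> dist (?f (x n)) (?f a) < \<epsilon> \<or> x n \<notin> U" for n
    have "\<not> eventually Q sequentially"
    proof
      assume "eventually Q sequentially"
      moreover have "eventually (\<lambda>n. x n \<in> U) sequentially"
        using topological_tendstoD[OF x(2) open_U U(1)] .
      ultimately have "eventually (\<lambda>n. dist (?f (x n)) (?f a) < \<epsilon>) sequentially"
        unfolding Q_def by eventually_elim auto
      then show False using \<epsilon>(2) by blast
    qed
    from not_eventually_sequentiallyD[OF this]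
    obtain s :: "nat \<Rightarrow> nat" where "strict_mono s \<and> (\<forall>n. \<not> Q (s n))" ..
    then have s: "strict_mono s" "\<forall>n. \<not> Q (s n)" by auto
    define y where "y n = x (s n)" for n
    have y: "y n \<in> S" "y n \<in> U" "dist (?f (y n)) (?f a) \<ge> \<epsilon>" for n using spec[OF s(2), of n] x(1) by (auto simp: y_def Q_def)
    have ylim: "y \<longlonglongrightarrow> a" using LIMSEQ_subseq_LIMSEQ[OF x(2) s(1)] unfolding y_def comp_def .
    have "\<forall>n. \<exists>\<kappa>u. eigenframe S \<nu> (y n) (fst \<kappa>u) (\<lambda>i. snd (y n) *\<^sub>R snd \<kappa>u i)"
    proof
      fix n
      obtain \<kappa> u where "eigenframe S \<nu> (y n) \<kappa> (\<lambda>i. snd (y n) *\<^sub>R u i)"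
        using eigenframe_exists[OF U(2) y(1,2)[of n]] by (elim exE) (rule that)
      then show "\<exists>\<kappa>u. eigenframe S \<nu> (y n) (fst \<kappa>u) (\<lambda>i. snd (y n) *\<^sub>R snd \<kappa>u i)"
        by (intro exI[of _ "(\<kappa>, u)"]) (simp only: fst_conv snd_conv)
    qed
    from choice[OF this] obtain \<kappa>u where ku: "\<And>n. eigenframe S \<nu> (y n) (fst (\<kappa>u n)) (\<lambda>i. snd (y n) *\<^sub>R snd (\<kappa>u n) i)"
      by (elim exE) (rule that, erule spec)
    define \<kappa> where "\<kappa> n = fst (\<kappa>u n)" for n
    define E :: "nat \<Rightarrow> 'n pt ^ 'n" where "E n = (\<chi> i. snd (\<kappa>u n) i)" for n
    have fr: "eigenframe S \<nu> (y n) (\<kappa> n) (\<lambda>i. snd (y n) *\<^sub>R E n $ i)" for n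
      using ku[of n] by (simp add: \<kappa>_def E_def)
    note fr' = fr[unfolded eigenframe_chart'[OF U(2) y(1,2)]]
    have orth: "inner (E n $ i) (E n $ j) = (if i = j then 1 else 0)" for n i j
      using fr'[of n] by (simp add: orthonormal_frame_def)
    have tan: "inner (G (y n)) (E n $ i) = 0" for n i using fr'[of n] by blast
    have eig: "weingarten G G' (y n) (E n $ i) = \<kappa> n i *\<^sub>R E n $ i" for n i using fr'[of n] by blast
    obtain l t where t: "strict_mono t" "(E \<circ> t) \<longlonglongrightarrow> l"
      using bounded_orthonormal_frames[of E] fr' by blast
    have El: "(\<lambda>n. E (t n) $ i) \<longlonglongrightarrow> l $ i" for i
      using tendsto_vec_nth[OF t(2), of i] by (simp add: comp_def)
    have yl: "(\<lambda>n. y (t n)) \<longlonglongrightarrow> a" using LIMSEQ_subseq_LIMSEQ[OF ylim t(1)] by (simp add: comp_def)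
    have "continuous (at a) G" "continuous (at a) G'"
      using chart_continuous_gradient[OF ch] cG' open_U U(1) continuous_on_eq_continuous_at by blast+
    then have Gl: "(\<lambda>n. G (y (t n))) \<longlonglongrightarrow> G a" and G'l: "(\<lambda>n. G' (y (t n))) \<longlonglongrightarrow> G' a"
      using yl by (auto intro: isCont_tendsto_compose)
    have W: "(\<lambda>n. weingarten G G' (y (t n)) (E (t n) $ i)) \<longlonglongrightarrow> weingarten G G' a (l $ i)" for i
      unfolding weingarten_def using G0
      by (intro tendsto_intros Gl El yl bounded_bilinear.tendsto[OF bounded_bilinear_blinfun_apply] G'l) auto
    define \<mu> where "\<mu> i = inner (weingarten G G' a (l $ i)) (l $ i)" for i
    have \<mu>: "(\<lambda>n. \<kappa> (t n) i) \<longlonglongrightarrow> \<mu> i" for i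
    proof -
      have "(\<lambda>n. inner (weingarten G G' (y (t n)) (E (t n) $ i)) (E (t n) $ i)) \<longlonglongrightarrow> \<mu> i"
        unfolding \<mu>_def by (intro tendsto_intros W El)
      then show ?thesis by (simp add: eig orth)
    qed
    have "orthonormal_frame (\<lambda>i. l $ i)"
      unfolding orthonormal_frame_def
    proof (intro allI)
      fix i j
      have "(\<lambda>n. inner (E (t n) $ i) (E (t n) $ j)) \<longlonglongrightarrow> inner (l $ i) (l $ j)" by (intro tendsto_intros El)
      then show "inner (l $ i) (l $ j) = (if i = j then 1 else 0)" unfolding orth using LIMSEQ_unique tendsto_const by blast
    qed
    moreover have "\<forall>i. inner (G a) (l $ i) = 0"
    proof
      fix i
      have "(\<lambda>n. inner (G (y (t n))) (E (t n) $ i)) \<longlonglongrightarrow> inner (G a) (l $ i)" by (intro tendsto_intros El Gl)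
      then show "inner (G a) (l $ i) = 0" unfolding tan using LIMSEQ_unique tendsto_const by blast
    qed
    moreover have "\<forall>i. weingarten G G' a (l $ i) = \<mu> i *\<^sub>R l $ i"
    proof
      fix i
      have "(\<lambda>n. \<kappa> (t n) i *\<^sub>R E (t n) $ i) \<longlonglongrightarrow> \<mu> i *\<^sub>R l $ i" by (intro tendsto_intros El \<mu>)
      then show "weingarten G G' a (l $ i) = \<mu> i *\<^sub>R l $ i" using W[of i] unfolding eig using LIMSEQ_unique by blast
    qed
    ultimately have "eigenframe S \<nu> a \<mu> (\<lambda>i. snd a *\<^sub>R l $ i)"
      using eigenframe_chart'[OF U(2) a U(1), of \<mu> "\<lambda>i. l $ i"] by (simp only: simp_thms)
    then have fa: "?f a = elem_sym r \<mu>" by (rule elem_sym_principal_curvatures[OF S a])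
    have "(\<lambda>n. elem_sym r (\<kappa> (t n))) \<longlonglongrightarrow> elem_sym r \<mu>"
      unfolding elem_sym_def by (intro tendsto_intros \<mu>)
    then have "(\<lambda>n. ?f (y (t n))) \<longlonglongrightarrow> ?f a"
      unfolding fa elem_sym_principal_curvatures[OF S y(1) fr] .
    then have "eventually (\<lambda>n. dist (?f (y (t n))) (?f a) < \<epsilon>) sequentially" using \<epsilon>(1) by (rule tendstoD)
    then obtain n where "dist (?f (y (t n))) (?f a) < \<epsilon>" by (auto simp: eventually_sequentially)
    then show False using y(3)[of "t n"] by simp
  qed
qed


section \<open>Garding's inequality for elementary symmetric functions\<close>

definition real_rooted :: "complex poly \<Rightarrow> bool"
  where "real_rooted p \<longleftrightarrow> (\<forall>z. poly p z = 0 \<longrightarrow> z \<in> \<real>)"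

text \<open>
  For a real number \<open>a\<close> and \<open>z\<close> in the upper half-plane, \<open>1 / (z - a)\<close> lies in the lower half-plane, hence so does
  the logarithmic derivative \<open>\<Sum>a. 1 / (z - a)\<close>.
\<close>

lemma logarithmic_derivative_real_roots:
  fixes z :: complex
  assumes "Im z > 0" and "\<forall>a\<in>set as. a \<in> \<real>"
  defines "P \<equiv> \<Prod>a\<leftarrow>as. [:-a, 1:]"
  shows "poly P z \<noteq> 0 \<and> Im (poly (pderiv P) z / poly P z) \<le> 0 \<and>
    (as \<noteq> [] \<longrightarrow> Im (poly (pderiv P) z / poly P z) < 0)"
  using assms(2) unfolding P_def
proof (induction as)
  case Nil
  then show ?case by (simp add: one_pCons)
next
  case (Cons a as)
  let ?Q = "\<Prod>a\<leftarrow>as. [:-a, 1:]"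
  have a: "Im a = 0" using Cons by (simp add: complex_is_Real_iff)
  then have za: "z - a \<noteq> 0" using assms(1) by auto
  have Q: "poly ?Q z \<noteq> 0" "Im (poly (pderiv ?Q) z / poly ?Q z) \<le> 0" using Cons by auto
  have "poly (pderiv ([:-a, 1:] * ?Q)) z / poly ([:-a, 1:] * ?Q) z = 1 / (z - a) + poly (pderiv ?Q) z / poly ?Q z"
    using za Q(1) unfolding pderiv_mult by (simp add: pderiv_pCons field_simps)
  moreover have "Im (1 / (z - a)) < 0"
  proof -
    have "(Re z - Re a)\<^sup>2 + (Im z)\<^sup>2 > 0" using assms(1) by (simp add: add_nonneg_pos)
    then show ?thesis using a assms(1) by (simp add: Im_divide)
  qed
  ultimately show ?case using Q za by simp
qed

lemma complex_poly_factor_list: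
  fixes p :: "complex poly"
  shows "\<exists>c as. p = smult c (\<Prod>a\<leftarrow>as. [:-a, 1:])"
proof (induction "degree p" arbitrary: p)
  case 0
  then obtain c where "p = [:c:]" using degree_eq_zeroE[of p] by metis
  then show ?case by (intro exI[of _ c] exI[of _ "[]"]) simp
next
  case (Suc n)
  then have "\<not> constant (poly p)" by (simp add: constant_degree)
  then obtain z where "poly p z = 0" using fundamental_theorem_of_algebra by blast
  then obtain q where q: "p = [:-z, 1:] * q" by (metis poly_eq_0_iff_dvd dvd_def)
  have "p \<noteq> 0" using Suc(2) by auto
  then have "q \<noteq> 0" using q by auto
  then have "degree q = n" using Suc(2) q by (simp add: degree_mult_eq del: mult_pCons_left)
  then obtain c as where as: "q = smult c (\<Prod>a\<leftarrow>as. [:-a, 1:])" using Suc(1) by blast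
  have "p = smult c (\<Prod>a\<leftarrow>(z # as). [:-a, 1:])"
    by (simp only: q as list.simps(9) mult_smult_right prod_list.Cons)
  then show ?case by blast
qed

lemma complex_poly_roots_factor_list:
  fixes p :: "complex poly"
  assumes "p = smult c (\<Prod>a\<leftarrow>as. [:-a, 1:])" "a \<in> set as"
  shows "poly p a = 0"
  unfolding assms(1) using assms(2) by (induction as) auto

text \<open>
  The theorem of Gauss and Lucas for the upper and, by complex conjugation, for the lower half-plane.
\<close>

lemma real_rooted_pderiv:
  assumes "real_rooted p" "pderiv p \<noteq> 0"
  shows "real_rooted (pderiv p)"
  unfolding real_rooted_def
proof (intro allI impI)
  obtain c as where as: "p = smult c (\<Prod>a\<leftarrow>as. [:-a, 1:])" using complex_poly_factor_list by blast
  let ?P = "\<Prod>a\<leftarrow>as. [:-a, 1:]"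
  have real: "\<forall>a\<in>set as. a \<in> \<real>" using assms(1) complex_poly_roots_factor_list[OF as] unfolding real_rooted_def by blast
  have dp: "pderiv p = smult c (pderiv ?P)" unfolding as by (rule pderiv_smult)
  have c: "c \<noteq> 0" using assms(2) unfolding dp by auto
  have ne: "as \<noteq> []"
  proof
    assume "as = []"
    then have "pderiv ?P = 0" by simp
    then show False using assms(2) unfolding dp by simp
  qed
  fix z assume "poly (pderiv p) z = 0"
  then have z: "poly (pderiv ?P) z = 0" using c unfolding dp by simp
  have cnjP: "poly (pderiv ?P) (cnj z) = 0"
  proof -
    have "map_poly cnj ?P = ?P"
      using real
    proof (induction as)
      case (Cons a as)
      have "cnj a = a" using Cons(2) by (simp add: Reals_cnj_iff)
      moreover have "map_poly cnj ([:-a,1:] * (\<Prod>a\<leftarrow>as. [:-a, 1:])) = map_poly cnj [:-a,1:] * map_poly cnj (\<Prod>a\<leftarrow>as. [:-a, 1:])"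
        by (rule poly_eqI) (simp add: coeff_map_poly coeff_mult cnj_sum del: mult_pCons_left)
      moreover have "map_poly cnj [:-a,1:] = [:- cnj a, 1:]"
        by (rule poly_eqI) (simp add: coeff_map_poly coeff_pCons split: nat.split)
      ultimately show ?case using Cons by simp
    qed (simp add: map_poly_1)
    then have "poly (pderiv ?P) (cnj z) = poly (pderiv (map_poly cnj ?P)) (cnj z)" by simp
    also have "pderiv (map_poly cnj ?P) = map_poly cnj (pderiv ?P)"
      by (rule poly_eqI) (simp add: coeff_map_poly coeff_pderiv)
    also have "poly (map_poly cnj (pderiv ?P)) (cnj z) = cnj (poly (pderiv ?P) z)"
      by (rule poly_cnj[symmetric])
    finally show ?thesis using z by simp
  qed
  show "z \<in> \<real>"
  proof (rule ccontr)
    assume "z \<notin> \<real>"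
    then consider "Im z > 0" | "Im (cnj z) > 0" 
      using linorder_neq_iff[of "Im z" 0] by (auto simp: complex_is_Real_iff)
    then show False
    proof cases
      case 1
      have "Im (poly (pderiv ?P) z / poly ?P z) < 0"
        using logarithmic_derivative_real_roots[OF 1 real] ne by blast
      then show False unfolding z by simp
    next
      case 2
      have "Im (poly (pderiv ?P) (cnj z) / poly ?P (cnj z)) < 0"
        using logarithmic_derivative_real_roots[OF 2 real] ne by blast
      then show False unfolding cnjP by simp
    qed
  qed
qed

lemma real_rooted_splits:
  fixes p :: "real poly"
  assumes "real_rooted (map_poly of_real p)"
  shows "\<exists>c xs. p = smult c (\<Prod>x\<leftarrow>xs. [:x, 1:])"
  using assms
proof (induction "degree p" arbitrary: p)
  case 0
  then obtain c where "p = [:c:]" using degree_eq_zeroE[of p] by metis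
  then show ?case by (intro exI[of _ c] exI[of _ "[]"]) simp
next
  case (Suc n)
  let ?c = "map_poly complex_of_real"
  have "degree (?c p) = Suc n" using Suc(2) by (simp add: degree_map_poly)
  then have "\<not> constant (poly (?c p))" by (simp add: constant_degree)
  then obtain z where z: "poly (?c p) z = 0" using fundamental_theorem_of_algebra by blast
  then obtain x where x: "z = of_real x" using Suc(3) unfolding real_rooted_def by (metis Reals_cases)
  have "poly p x = 0"
  proof -
    have "poly (?c p) (of_real x) = of_real (poly p x)" by (induction p) (simp_all add: map_poly_pCons)
    then show ?thesis using z x by simp
  qed
  then obtain q where q: "p = [:-x, 1:] * q" by (metis poly_eq_0_iff_dvd dvd_def)
  have "p \<noteq> 0" using Suc(2) by auto
  then have "q \<noteq> 0" using q by auto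
  then have "degree q = n" using Suc(2) q by (simp add: degree_mult_eq del: mult_pCons_left)
  moreover have "real_rooted (?c q)"
  proof -
    have "?c p = ?c [:-x, 1:] * ?c q"
      unfolding q by (rule poly_eqI) (simp add: coeff_map_poly coeff_mult del: mult_pCons_left)
    then show ?thesis using Suc(3) unfolding real_rooted_def by simp
  qed
  ultimately obtain c xs where xs: "q = smult c (\<Prod>x\<leftarrow>xs. [:x, 1:])" using Suc(1) by blast
  have "p = smult c (\<Prod>x\<leftarrow>((-x) # xs). [:x, 1:])"
    by (simp only: q xs list.simps(9) mult_smult_right prod_list.Cons)
  then show ?case by blast
qed

lemma degree_prod_list_linear:
  "degree (\<Prod>x\<leftarrow>xs. [:x, 1::real:]) = length xs \<and> lead_coeff (\<Prod>x\<leftarrow>xs. [:x, 1:]) = 1"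
proof (induction xs)
  case (Cons x xs)
  define Q where "Q = (\<Prod>x\<leftarrow>xs. [:x, 1::real:])"
  have Q: "degree Q = length xs" "lead_coeff Q = 1"
    unfolding Q_def by (rule conjunct1[OF Cons.IH], rule conjunct2[OF Cons.IH])
  have "Q \<noteq> 0"
  proof
    assume "Q = 0"
    then show False using Q(2) by simp
  qed
  then have "degree ([:x, 1:] * Q) = degree [:x, 1:] + degree Q" by (intro degree_mult_eq) auto
  moreover have "lead_coeff ([:x, 1:] * Q) = lead_coeff [:x, 1:] * lead_coeff Q" by (rule lead_coeff_mult)
  ultimately show ?case unfolding list.simps(9) prod_list.Cons Q_def[symmetric] using Q
    by (simp del: mult_pCons_left)
qed simp

lemma coeff_prod_list_linear_pos:
  assumes "\<forall>x\<in>set xs. x > (0::real)" "k \<le> length xs"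
  shows "coeff (\<Prod>x\<leftarrow>xs. [:x, 1:]) k > 0"
  using assms
proof (induction xs arbitrary: k)
  case (Cons x xs)
  let ?Q = "\<Prod>x\<leftarrow>xs. [:x, 1:]"
  have x: "x > 0" using Cons by simp
  have nn: "coeff ?Q j \<ge> 0" for j
    using Cons degree_prod_list_linear[of xs] by (cases "j \<le> length xs") (auto simp: less_imp_le coeff_eq_0)
  have e: "coeff ([:x, 1:] * ?Q) k = x * coeff ?Q k + (case k of 0 \<Rightarrow> 0 | Suc j \<Rightarrow> coeff ?Q j)"
    by (simp add: coeff_pCons split: nat.split)
  show ?case
  proof (cases "k \<le> length xs")
    case True
    then have "coeff ?Q k > 0" using Cons by simp
    then show ?thesis using e x nn by (auto split: nat.split intro: add_pos_nonneg)
  next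
    case False
    then have "k = Suc (length xs)" using Cons by simp
    then show ?thesis using e x nn[of k] Cons by (auto intro: add_nonneg_pos)
  qed
qed simp

lemma coeff_prod_list_linear_subleading:
  "coeff (\<Prod>x\<leftarrow>xs. [:x, 1::real:]) (length xs - 1) = (if xs = [] then 1 else sum_list xs)"
proof (induction xs)
  case (Cons x xs)
  let ?Q = "\<Prod>x\<leftarrow>xs. [:x, 1:]"
  have l: "coeff ?Q (length xs) = 1" using degree_prod_list_linear[of xs] by metis
  have e: "coeff ([:x, 1:] * ?Q) k = x * coeff ?Q k + (case k of 0 \<Rightarrow> 0 | Suc j \<Rightarrow> coeff ?Q j)" for k
    by (simp add: coeff_pCons split: nat.split)
  show ?case using Cons e[of "length xs"] l by (cases xs) (auto split: nat.splits)
qed simp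

lemma arith_geom_mean_list:
  fixes xs :: "real list"
  assumes "\<forall>x\<in>set xs. x > 0" "xs \<noteq> []"
  shows "prod_list xs \<le> (sum_list xs / length xs) ^ length xs"
proof -
  let ?n = "length xs"
  have n: "?n > 0" using assms by simp
  have s: "sum_list xs = (\<Sum>i<?n. xs ! i)" by (simp add: sum_list_sum_nth atLeast0LessThan)
  have p: "prod_list xs = (\<Prod>i<?n. xs ! i)" by (simp add: prod.list_conv_set_nth atLeast0LessThan)
  have pos: "xs ! i > 0" if "i < ?n" for i using assms that by simp
  have pp: "prod_list xs > 0" unfolding p using pos by (intro prod_pos) auto
  have "(\<Prod>i<?n. xs ! i) powr (1 / card {..<?n}) \<le> (\<Sum>i<?n. xs ! i / card {..<?n})"
    by (rule arith_geom_mean) (use n pos in \<open>auto intro: less_imp_le\<close>)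
  then have "prod_list xs powr (1 / ?n) \<le> sum_list xs / ?n" by (simp add: s p sum_divide_distrib)
  then have "(prod_list xs powr (1 / ?n)) ^ ?n \<le> (sum_list xs / ?n) ^ ?n" by (intro power_mono) auto
  moreover have "(prod_list xs powr (1 / ?n)) ^ ?n = prod_list xs"
  proof -
    have "prod_list xs powr (1 / ?n) > 0" using pp by simp
    then have "(prod_list xs powr (1 / ?n)) ^ ?n = (prod_list xs powr (1 / ?n)) powr real ?n"
      by (rule powr_realpow[symmetric])
    also have "\<dots> = prod_list xs" using pp n by (simp add: powr_powr)
    finally show ?thesis .
  qed
  ultimately show ?thesis by simp
qed

lemma real_rooted_higher_pderiv:
  assumes "real_rooted p" "(pderiv ^^ m) p \<noteq> 0"
  shows "real_rooted ((pderiv ^^ m) p)"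
  using assms(2)
proof (induction m)
  case (Suc m)
  have "(pderiv ^^ m) p \<noteq> 0" using Suc(2) by auto
  then show ?case using Suc by (auto intro: real_rooted_pderiv)
qed (use assms in simp)

lemma pochhammer_fact_quotient: "pochhammer (real (Suc k)) m = fact (k + m) / fact k"
proof -
  have "fact (k + m) = (fact k :: real) * pochhammer (1 + of_nat k) m"
    unfolding pochhammer_fact by (rule pochhammer_product')
  then show ?thesis by (simp add: field_simps)
qed

text \<open>
  The polynomial \<open>\<Prod>i. (X + \<kappa> i)\<close> of degree \<open>n\<close> has real roots only, hence so has its derivative of order \<open>n - r\<close>, which
  has degree \<open>r\<close>.  The coefficients of that derivative are \<open>\<sigma>\<^sub>0, \<dots>, \<sigma>\<^sub>r\<close> up to positive factors; the theorem
  replaces \<open>\<kappa>\<close> by \<open>r\<close> real numbers with the same normalised symmetric functions \<open>H\<^sub>0, \<dots>, H\<^sub>r\<close>.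
\<close>

lemma elem_sym_derivative_splits:
  fixes \<kappa> :: "'n::finite \<Rightarrow> real"
  assumes r: "r \<le> CARD('n)"
  shows "\<exists>xs. length xs = r \<and> (\<forall>j\<le>r. coeff (\<Prod>x\<leftarrow>xs. [:x, 1:]) (r - j) =
     fact (CARD('n) - j) * fact r / (fact (r - j) * fact CARD('n)) * elem_sym j \<kappa>)"
proof -
  let ?n = "CARD('n)"
  define p where "p = (\<Prod>i\<in>UNIV. [:\<kappa> i, 1:])"
  (* q has degree r, and its coefficients are positive multiples of elem_sym 0, ..., elem_sym r *)
  define q where "q = (pderiv ^^ (?n - r)) p"
  have cq: "coeff q (r - j) = fact (?n - j) / fact (r - j) * elem_sym j \<kappa>" if "j \<le> r" for j
  proof -
    have "r - j + (?n - r) = ?n - j" using r that by simp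
    then show ?thesis using coeff_prod_linear[of j \<kappa>] r that
      unfolding q_def coeff_higher_pderiv p_def pochhammer_fact_quotient by simp
  qed
  have e0: "elem_sym 0 \<kappa> = 1"
  proof -
    have "{I::'n set. card I = 0} = {{}}" by auto
    then show ?thesis by (simp add: elem_sym_def)
  qed
  have top: "coeff q r = fact ?n / fact r" using cq[of 0] e0 by simp
  have "degree p \<le> ?n"
    unfolding p_def by (rule order_trans[OF degree_prod_sum_le]) auto
  have "degree q \<le> r"
  proof (rule degree_le, intro allI impI)
    fix i assume "i > r"
    then have "coeff p (i + (?n - r)) = 0" using \<open>degree p \<le> ?n\<close> r by (intro coeff_eq_0) linarith
    then show "coeff q i = 0" unfolding q_def coeff_higher_pderiv by simp
  qed
  moreover have "coeff q r \<noteq> 0" using top by simp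
  ultimately have dq: "degree q = r" using le_degree le_antisym by blast
  let ?c = "map_poly complex_of_real"
  have cp: "?c (pderiv f) = pderiv (?c f)" for f
    by (rule poly_eqI) (simp add: coeff_map_poly coeff_pderiv)
  have cpm: "?c ((pderiv ^^ m) f) = (pderiv ^^ m) (?c f)" for f m
    by (induction m) (simp_all add: cp)
  have "real_rooted (?c p)"
  proof -
    have "?c p = (\<Prod>i\<in>UNIV. [:of_real (\<kappa> i), 1:])"
    proof -
      have "?c (\<Prod>i\<in>I. [:\<kappa> i, 1:]) = (\<Prod>i\<in>I. [:of_real (\<kappa> i), 1:])" if "finite I" for I
        using that
      proof (induction I)
        case (insert i I)
        have "?c ([:\<kappa> i, 1:] * f) = ?c [:\<kappa> i, 1:] * ?c f" for f
          by (rule poly_eqI) (simp add: coeff_map_poly coeff_mult del: mult_pCons_left)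
        moreover have "?c [:\<kappa> i, 1:] = [:of_real (\<kappa> i), 1:]" by (simp add: map_poly_pCons)
        ultimately show ?case by (simp only: prod.insert[OF insert(1,2)] insert(3))
      qed simp
      then show ?thesis by (simp add: p_def)
    qed
    moreover have "z \<in> \<real>" if "complex_of_real (\<kappa> i) + z = 0" for i z
    proof -
      have "z = of_real (- \<kappa> i)" using that by (simp add: eq_neg_iff_add_eq_0 add.commute)
      then show ?thesis by (metis Reals_of_real)
    qed
    ultimately show ?thesis unfolding real_rooted_def by (auto simp: poly_prod)
  qed
  moreover have "(pderiv ^^ (?n - r)) (?c p) \<noteq> 0"
  proof
    assume "(pderiv ^^ (?n - r)) (?c p) = 0"
    then have "?c q = 0" by (simp add: q_def cpm)
    then have "coeff (?c q) r = 0" by simp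
    then show False using top by (simp add: coeff_map_poly)
  qed
  ultimately have "real_rooted (?c q)" unfolding q_def cpm by (rule real_rooted_higher_pderiv)
  then obtain c xs where q: "q = smult c (\<Prod>x\<leftarrow>xs. [:x, 1:])" using real_rooted_splits by blast
  have "c \<noteq> 0" using q top by auto
  then have len: "length xs = r" using dq degree_prod_list_linear[of xs] unfolding q by simp
  have "coeff q r = c * 1"
    unfolding q coeff_smult using degree_prod_list_linear[of xs] len by metis
  then have c: "c = fact ?n / fact r" using top by simp
  have "coeff (\<Prod>x\<leftarrow>xs. [:x, 1:]) (r - j) =
     fact (?n - j) * fact r / (fact (r - j) * fact ?n) * elem_sym j \<kappa>" if "j \<le> r" for j
  proof -
    have "c * coeff (\<Prod>x\<leftarrow>xs. [:x, 1:]) (r - j) = fact (?n - j) / fact (r - j) * elem_sym j \<kappa>"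
      using cq[OF that] unfolding q by simp
    then show ?thesis unfolding c by (simp add: field_simps)
  qed
  then show ?thesis using len by blast
qed

text \<open>
  For the numbers \<open>xs\<close> of the previous lemma the nonnegative coefficients with positive constant term exclude
  roots of \<open>\<Prod>x. (X + x)\<close> in the closed positive half-line, so all of them are positive.  Positivity of the coefficients is
  then clear, and the inequality is the arithmetic-geometric mean inequality for \<open>xs\<close>.  The first part
  says that in the region \<open>\<sigma>\<^sub>r > 0\<close> the positivity of \<open>\<sigma>\<^sub>1, \<dots>, \<sigma>\<^sub>r\<close> is a closed condition.
\<close>

theorem garding_maclaurin:
  fixes \<kappa> :: "'n::finite \<Rightarrow> real"
  assumes r: "1 \<le> r" "r \<le> CARD('n)" and nn: "\<And>j. j < r \<Longrightarrow> elem_sym j \<kappa> \<ge> 0" and pos: "elem_sym r \<kappa> > 0"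
  shows "\<And>j. j \<le> r \<Longrightarrow> elem_sym j \<kappa> > 0"
    and "elem_sym r \<kappa> / (CARD('n) choose r) \<le> (elem_sym 1 \<kappa> / CARD('n)) ^ r"
proof -
  let ?n = "CARD('n)"
  obtain xs where len: "length xs = r" and co: "\<And>j. j \<le> r \<Longrightarrow> coeff (\<Prod>x\<leftarrow>xs. [:x, 1:]) (r - j) =
     fact (?n - j) * fact r / (fact (r - j) * fact ?n) * elem_sym j \<kappa>"
    using elem_sym_derivative_splits[OF r(2), of \<kappa>] by blast
  define Q where "Q = (\<Prod>x\<leftarrow>xs. [:x, 1:])"
  have Qnn: "coeff Q i \<ge> 0" for i
  proof (cases "i \<le> r")
    case True
    have "elem_sym (r - i) \<kappa> \<ge> 0" using nn[of "r - i"] pos r by (cases "i = 0") auto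
    then show ?thesis using co[of "r - i"] True unfolding Q_def by simp
  next
    case False
    then show ?thesis using degree_prod_list_linear[of xs] len unfolding Q_def by (simp add: coeff_eq_0)
  qed
  have Q0: "coeff Q 0 > 0" using co[of r] pos unfolding Q_def by simp
  have xpos: "\<forall>x\<in>set xs. x > 0"
  proof (rule ballI, rule ccontr)
    fix x assume x: "x \<in> set xs" "\<not> x > 0"
    have "poly Q (-x) = 0" unfolding Q_def using x(1) by (induction xs) auto
    moreover have "poly Q (-x) \<ge> coeff Q 0"
    proof -
      have "poly Q (-x) = (\<Sum>i\<le>degree Q. coeff Q i * (-x) ^ i)" by (rule poly_altdef)
      also have "\<dots> \<ge> (\<Sum>i\<in>{0}. coeff Q i * (-x) ^ i)"
        using Qnn x(2) by (intro sum_mono2) auto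
      finally show ?thesis by simp
    qed
    ultimately show False using Q0 by simp
  qed
  show "elem_sym j \<kappa> > 0" if "j \<le> r" for j
  proof -
    have "0 < fact (?n - j) * fact r / (fact (r - j) * fact ?n) * elem_sym j \<kappa>"
      using coeff_prod_list_linear_pos[OF xpos, of "r - j"] co[OF that] len by simp
    moreover have "0 < (fact (?n - j) * fact r / (fact (r - j) * fact ?n) :: real)" by simp
    ultimately show ?thesis using zero_less_mult_pos by blast
  qed
  have ne: "xs \<noteq> []" using len r by auto
  have "prod_list xs = coeff Q 0"
  proof -
    have "poly Q 0 = prod_list xs" unfolding Q_def by (induction xs) auto
    then show ?thesis by (simp add: poly_0_coeff_0)
  qed
  also have "\<dots> = elem_sym r \<kappa> / (?n choose r)"
    using co[of r] r unfolding Q_def by (simp add: binomial_fact field_simps)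
  finally have P: "prod_list xs = elem_sym r \<kappa> / (?n choose r)" .
  have "sum_list xs = coeff Q (r - 1)"
    using coeff_prod_list_linear_subleading[of xs] len ne unfolding Q_def by simp
  also have "\<dots> = real r * (elem_sym 1 \<kappa> / ?n)"
  proof -
    obtain m k where m: "r = Suc m" "?n = Suc k" using r by (metis Suc_le_D le_trans One_nat_def)
    have "(fact k * fact (Suc m) / (fact m * fact (Suc k)) :: real) = real (Suc m) / real (Suc k)"
      unfolding fact_Suc by (simp del: of_nat_Suc add: divide_simps)
    then show ?thesis using co[of 1] unfolding Q_def m by (simp del: of_nat_Suc fact_Suc)
  qed
  finally have "sum_list xs / length xs = elem_sym 1 \<kappa> / ?n" using len r by simp
  then show "elem_sym r \<kappa> / (?n choose r) \<le> (elem_sym 1 \<kappa> / ?n) ^ r"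
    using arith_geom_mean_list[OF xpos ne] P len by simp
qed


section \<open>Comparison at a point of contact\<close>

lemma tangential_derivative_at_max:
  fixes \<psi> :: "'n::finite pt \<Rightarrow> real"
  assumes "open V" "p \<in> V" and D: "(\<psi> has_derivative (\<lambda>v. inner a v)) (at p)"
    and max: "\<And>x. x \<in> S \<inter> V \<Longrightarrow> \<psi> x \<le> \<psi> p" and v: "v \<in> tangent_space S p"
  shows "inner a v = 0"
proof -
  obtain \<gamma> \<epsilon> where \<gamma>: "\<epsilon> > 0" "\<gamma> ` {-\<epsilon><..<\<epsilon>} \<subseteq> S" "\<gamma> 0 = p" "(\<gamma> has_vector_derivative v) (at 0)"
    using v by (auto simp: tangent_space_def)
  have D0: "(\<psi> has_derivative (\<lambda>v. inner a v)) (at (\<gamma> 0))" using D \<gamma>(3) by simp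
  have "((\<lambda>t. \<psi> (\<gamma> t)) has_derivative (\<lambda>t. inner a (t *\<^sub>R v))) (at 0)"
    by (rule has_derivative_compose[OF \<gamma>(4)[unfolded has_vector_derivative_def] D0])
  then have der: "DERIV (\<lambda>t. \<psi> (\<gamma> t)) 0 :> inner a v"
    by (simp add: has_field_derivative_def mult_commute_abs)
  have "isCont \<gamma> 0" using has_vector_derivative_continuous[OF \<gamma>(4)] by simp
  then have "eventually (\<lambda>t. \<gamma> t \<in> V) (nhds 0)"
    using topological_tendstoD[of \<gamma> "\<gamma> 0" "at 0" V] assms(1,2) \<gamma>(3)
    by (simp add: isCont_def eventually_nhds_conv_at)
  then obtain d where d: "d > 0" "\<And>t. dist t 0 < d \<Longrightarrow> \<gamma> t \<in> V"
    unfolding eventually_nhds_metric by blast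
  show ?thesis
  proof (rule DERIV_local_max[OF der, of "min d \<epsilon>"])
    show "0 < min d \<epsilon>" using d \<gamma> by simp
    show "\<forall>t. \<bar>0 - t\<bar> < min d \<epsilon> \<longrightarrow> \<psi> (\<gamma> t) \<le> \<psi> (\<gamma> 0)"
    proof (intro allI impI)
      fix t assume t: "\<bar>0 - t\<bar> < min d \<epsilon>"
      then have "\<gamma> t \<in> V" using d(2)[of t] by (simp add: dist_norm)
      moreover have "\<gamma> t \<in> S" using t \<gamma>(2) by (auto simp: image_subset_iff abs_less_iff)
      ultimately show "\<psi> (\<gamma> t) \<le> \<psi> (\<gamma> 0)" using max \<gamma>(3) by simp
    qed
  qed
qed

lemma gradient_parallel_normal_at_max:
  fixes \<psi> :: "'n::finite pt \<Rightarrow> real"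
  assumes "C2_hypersurface S" "unit_normal_field S \<nu>" "p \<in> S"
    and "open V" "p \<in> V" and D: "(\<psi> has_derivative (\<lambda>v. inner a v)) (at p)"
    and max: "\<And>x. x \<in> S \<inter> V \<Longrightarrow> \<psi> x \<le> \<psi> p"
  shows "\<exists>k. a = k *\<^sub>R \<nu> p"
proof -
  obtain U f G G' where U: "p \<in> U" "oriented_chart S \<nu> U f G G'"
    using oriented_chart_exists[OF assms(1,3,2)] by (elim exE conjE) (rule that)
  have ch: "chart S U f G G'" and nu: "\<nu> p = (snd p / norm (G p)) *\<^sub>R G p"
    using U assms(3) unfolding oriented_chart_def by auto
  have g: "G p \<noteq> 0" and y: "snd p > 0" using ch U(1) unfolding chart_def halfspace_def by auto
  define l where "l = inner a (G p) / inner (G p) (G p)"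
  have "a = l *\<^sub>R G p"
    unfolding l_def
    by (rule orthogonal_to_kernel[OF _ g])
      (use tangential_derivative_at_max[OF assms(4,5) D max] chart_tangent_space[OF ch assms(3) U(1)] in blast)
  also have "G p = (norm (G p) / snd p) *\<^sub>R \<nu> p" using g y nu by simp
  finally have "a = (l * (norm (G p) / snd p)) *\<^sub>R \<nu> p" by simp
  then show ?thesis by (rule exI)
qed

text \<open>
  At a local maximum of \<open>\<psi>\<close> along \<open>S\<close> the gradient of \<open>\<psi>\<close> is \<open>l\<close> times that of the defining function \<open>f\<close>, and the Hessian of
  \<open>\<psi> - l f\<close> is nonpositive on tangent vectors.  In terms of shape operators: \<open>S\<close> lies on one side of the level set of \<open>\<psi>\<close>, and the
  right-hand side is the quadratic form of the shape operator of that level set, up to the factor \<open>|A p|\<close>.  The sign takes care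
  of the two possible directions of \<open>\<nu>\<close>.
\<close>

lemma curvature_comparison_at_max:
  fixes \<psi> :: "'n::finite pt \<Rightarrow> real"
  assumes U: "oriented_chart S \<nu> U f G G'" "p \<in> S" "p \<in> U"
    and V: "open V" "p \<in> V" and D: "\<And>x. x \<in> V \<Longrightarrow> (\<psi> has_derivative (\<lambda>v. inner (A x) v)) (at x)"
    and B: "(A has_derivative B) (at p)"
    and max: "\<And>x. x \<in> S \<inter> V \<Longrightarrow> \<psi> x \<le> \<psi> p"
    and fr: "eigenframe S \<nu> p \<kappa> (\<lambda>i. snd p *\<^sub>R u i)"
  shows "norm (A p) * (sgn (inner (A p) (\<nu> p)) * \<kappa> i) \<le> snd (A p) - snd p * inner (B (u i)) (u i)"
proof -
  have ch: "chart S U f G G'" and nu: "\<nu> p = (snd p / norm (G p)) *\<^sub>R G p"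
    using U unfolding oriented_chart_def by auto
  have g: "G p \<noteq> 0" and y: "snd p > 0" and "open U" using ch U(3) unfolding chart_def halfspace_def by auto
  have fr': "orthonormal_frame u" "\<And>i. inner (G p) (u i) = 0" "\<And>i. weingarten G G' p (u i) = \<kappa> i *\<^sub>R u i"
    using fr[unfolded eigenframe_chart'[OF U]] by auto
  have uu: "inner (u i) (u i) = 1" using fr'(1) by (simp add: orthonormal_frame_def)
  have T: "tangent_space S p = {v. inner (G p) v = 0}" by (rule chart_tangent_space[OF ch U(2,3)])
  define l where "l = inner (A p) (G p) / inner (G p) (G p)"
  have A: "A p = l *\<^sub>R G p"
    unfolding l_def
    by (rule orthogonal_to_kernel[OF _ g]) (use tangential_derivative_at_max[OF V D[OF V(2)] max] T in blast)
  have sl: "sgn (inner (A p) (\<nu> p)) = sgn l"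
    unfolding A nu using g y by (simp add: sgn_mult)
  define F where "F x = \<psi> x - l * f x" for x
  have ui: "u i \<in> tangent_space S p" using T fr'(2) by simp
  then obtain \<gamma> \<epsilon> where \<gamma>: "\<epsilon> > 0" "\<gamma> ` {-\<epsilon><..<\<epsilon>} \<subseteq> S" "\<gamma> 0 = p" "(\<gamma> has_vector_derivative u i) (at 0)"
    by (auto simp: tangent_space_def)
  have cont: "(\<gamma> \<longlongrightarrow> p) (at 0)"
    using \<gamma>(3) has_vector_derivative_continuous[OF \<gamma>(4)] by (simp add: continuous_at)
  have f0: "f x = 0" if "x \<in> S" "x \<in> U" for x using ch that unfolding chart_def by blast
  have ev1: "eventually (\<lambda>t. \<gamma> t \<in> U \<inter> V) (at 0)"
    using \<open>open U\<close> V U(3) by (intro topological_tendstoD[OF cont]) auto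
  have ev2: "eventually (\<lambda>t. t \<in> {-\<epsilon><..<\<epsilon>}) (at (0::real))"
    using \<gamma>(1) by (intro eventually_at_in_open') auto
  have le: "eventually (\<lambda>t. F (\<gamma> t) \<le> F p) (at 0)"
    using ev1 ev2
  proof eventually_elim
    case (elim t)
    then have "\<gamma> t \<in> S" using \<gamma>(2) by blast
    then show ?case using elim max[of "\<gamma> t"] f0[of "\<gamma> t"] f0[OF U(2,3)] by (simp add: F_def)
  qed
  have "inner (B (u i) - l *\<^sub>R G' p (u i)) (u i) \<le> 0"
  proof (rule second_order_necessary[of "U \<inter> V" p F "\<lambda>x. A x - l *\<^sub>R G x" "\<lambda>h. B h - l *\<^sub>R G' p h" \<gamma>])
    show "(F has_derivative inner (A x - l *\<^sub>R G x)) (at x)" if "x \<in> U \<inter> V" for x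
    proof -
      have "(f has_derivative (\<lambda>v. inner (G x) v)) (at x)" using ch that unfolding chart_def by blast
      then show ?thesis unfolding F_def using D[of x] that
        by (auto intro!: derivative_eq_intros simp: inner_diff_left)
    qed
    have "(G has_derivative blinfun_apply (G' p)) (at p)" using ch U(3) unfolding chart_def by blast
    then show "((\<lambda>x. A x - l *\<^sub>R G x) has_derivative (\<lambda>h. B h - l *\<^sub>R G' p h)) (at p)"
      by (intro derivative_intros B)
  qed (use \<open>open U\<close> V U \<gamma> le A in auto)
  then have 1: "inner (B (u i)) (u i) \<le> l * inner (G' p (u i)) (u i)" by (simp add: inner_diff_left)
  have "\<kappa> i = inner (weingarten G G' p (u i)) (u i)" using fr'(3) uu by simp
  also have "\<dots> = snd (G p) / norm (G p) - snd p / norm (G p) * inner (G' p (u i)) (u i)"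
    using inner_weingarten[of G p "u i" G' "u i", OF fr'(2)] uu by simp
  finally have \<kappa>: "norm (G p) * \<kappa> i = snd (G p) - snd p * inner (G' p (u i)) (u i)"
    using g by (simp add: field_simps)
  have "norm (A p) * (sgn l * \<kappa> i) = (\<bar>l\<bar> * sgn l) * (norm (G p) * \<kappa> i)"
    unfolding A by simp
  also have "\<dots> = l * (snd (G p) - snd p * inner (G' p (u i)) (u i))"
    unfolding \<kappa> by (simp add: abs_mult_sgn mult.commute[of "\<bar>l\<bar>"] sgn_mult_abs)
  also have "\<dots> = snd (A p) - snd p * (l * inner (G' p (u i)) (u i))" unfolding A by (simp add: algebra_simps)
  also have "\<dots> \<le> snd (A p) - snd p * inner (B (u i)) (u i)" using 1 y by (simp add: mult_left_mono)
  finally show ?thesis unfolding sl .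
qed

text \<open>
  Pythagoras: the frame together with the unit normal is an orthonormal basis of the ambient space.
\<close>

lemma frame_parseval:
  fixes v :: "'n::finite pt"
  assumes U: "oriented_chart S \<nu> U f G G'" "p \<in> S" "p \<in> U"
    and fr: "eigenframe S \<nu> p \<kappa> (\<lambda>i. snd p *\<^sub>R u i)"
  shows "(\<Sum>i\<in>UNIV. (inner v (u i))\<^sup>2) = (norm v)\<^sup>2 - (inner v (\<nu> p))\<^sup>2 / (snd p)\<^sup>2"
proof -
  have ch: "chart S U f G G'" and nu: "\<nu> p = (snd p / norm (G p)) *\<^sub>R G p"
    using U unfolding oriented_chart_def by auto
  have g: "G p \<noteq> 0" and y: "snd p > 0" using ch U(3) unfolding chart_def halfspace_def by auto
  have fr': "orthonormal_frame u" "\<And>i. inner (G p) (u i) = 0"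
    using fr[unfolded eigenframe_chart'[OF U]] by auto
  define n where "n = sgn (G p)"
  have nn: "inner n n = 1" using g by (simp add: n_def dot_square_norm norm_sgn)
  have nG: "G p = norm (G p) *\<^sub>R n" using g by (simp add: n_def sgn_div_norm)
  have nun: "\<nu> p = snd p *\<^sub>R n" unfolding nu n_def sgn_div_norm by (simp add: divide_inverse)
  have nu0: "inner n (u i) = 0" for i using fr'(2)[of i] by (simp add: n_def sgn_div_norm)
  define t where "t = v - inner v n *\<^sub>R n"
  have tn: "inner t n = 0" using nn by (simp add: t_def inner_diff_left)
  have "t = (\<Sum>i\<in>UNIV. inner t (u i) *\<^sub>R u i)"
  proof (rule orthonormal_frame_expand[OF fr'(1) _ subspace_hyperplane dim_tangent[OF g]])
    show "u i \<in> {v. inner (G p) v = 0}" for i using fr'(2) by simp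
    show "t \<in> {v. inner (G p) v = 0}" using tn by (subst nG) (simp add: inner_commute)
  qed
  then have "inner t t = inner t (\<Sum>i\<in>UNIV. inner t (u i) *\<^sub>R u i)" by simp
  then have tt: "inner t t = (\<Sum>i\<in>UNIV. (inner t (u i))\<^sup>2)" by (simp add: inner_sum_right power2_eq_square)
  have "inner t (u i) = inner v (u i)" for i using nu0 by (simp add: t_def inner_diff_left)
  moreover have "inner t t = inner v v - (inner v n)\<^sup>2"
    using nn by (simp add: t_def inner_diff_left inner_diff_right inner_commute[of n v] power2_eq_square)
  moreover have "(inner v (\<nu> p))\<^sup>2 / (snd p)\<^sup>2 = (inner v n)\<^sup>2" using y by (simp add: nun power_mult_distrib)
  ultimately show ?thesis using tt by (simp add: dot_square_norm)
qed

section \<open>Barriers at the boundary of the contact set\<close>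

text \<open>
  The existence part of Hopf's argument.  It is stated for all small \<open>\<epsilon>\<close> because the size of \<open>\<epsilon>\<close> has to be adjusted after
  \<open>\<rho>\<close> and \<open>\<alpha>\<close> have been chosen.
\<close>

definition barrier_touches :: "('n::finite pt) set \<Rightarrow> 'n pt \<Rightarrow> 'n pt \<Rightarrow> 'n pt \<Rightarrow> real \<Rightarrow> real \<Rightarrow> bool"
  where "barrier_touches S N x0 z \<rho> \<alpha> \<longleftrightarrow> (\<exists>\<epsilon>0>0. \<forall>\<epsilon>. 0 < \<epsilon> \<longrightarrow> \<epsilon> < \<epsilon>0 \<longrightarrow>
      (\<exists>p\<in>S \<inter> ball z \<rho>. \<forall>x\<in>S \<inter> ball z \<rho>. inner x N + \<epsilon> * exp (- \<alpha> * (norm (x - x0))\<^sup>2) \<le>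
         inner p N + \<epsilon> * exp (- \<alpha> * (norm (p - x0))\<^sup>2)))"

text \<open>
  A point \<open>x1\<close> of the leaf near \<open>q\<close> but outside the contact set has a nearest contact point \<open>z\<close>.  The ball around the midpoint \<open>x0\<close> of
  \<open>x1\<close> and \<open>z\<close> that passes through \<open>z\<close> meets the contact set in \<open>z\<close> only.  On the sphere of radius \<open>\<rho>\<close> around \<open>z\<close> the perturbed
  height is therefore smaller than at \<open>z\<close>: inside the ball because the height is smaller by a fixed amount, outside
  because the bump is smaller.  Hence the maximum over \<open>cball z \<rho>\<close> is attained in the interior.
\<close>

lemma barrier_contact_points:
  fixes S :: "('n::finite pt) set" and N :: "'n pt"
  assumes proper: "\<And>K. compact K \<Longrightarrow> K \<subseteq> halfspace \<Longrightarrow> compact (S \<inter> K)"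
    and q: "q \<in> S" "inner q N = \<tau>" "q \<in> halfspace"
    and le: "\<And>x. x \<in> S \<Longrightarrow> inner x N \<le> \<tau>"
    and near: "\<And>\<delta>. \<delta> > 0 \<Longrightarrow> \<exists>x1. x1 \<notin> S \<and> inner x1 N = \<tau> \<and> dist x1 q < \<delta>"
  shows "\<exists>z x0 R. R > 0 \<and> z \<in> S \<and> inner z N = \<tau> \<and> inner x0 N = \<tau> \<and> dist z x0 = R \<and> cball z R \<subseteq> halfspace \<and>
    (\<forall>\<rho> \<alpha>. 0 < \<rho> \<longrightarrow> \<rho> \<le> R \<longrightarrow> 0 < \<alpha> \<longrightarrow> barrier_touches S N x0 z \<rho> \<alpha>)"
proof -
  have "open (halfspace :: 'n pt set)" unfolding halfspace_def by (intro open_Collect_less continuous_intros)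
  then obtain \<delta>4 where \<delta>4: "\<delta>4 > 0" "cball q \<delta>4 \<subseteq> halfspace" using q(3) open_contains_cball by blast
  define \<delta> where "\<delta> = \<delta>4 / 3"
  have \<delta>: "\<delta> > 0" "cball q (3 * \<delta>) \<subseteq> halfspace" using \<delta>4 by (simp_all add: \<delta>_def)
  obtain x1 where x1: "x1 \<notin> S" "inner x1 N = \<tau>" "dist x1 q < \<delta>" using near[OF \<delta>(1)] by blast
  define K where "K = {x \<in> S. inner x N = \<tau>}"
  have cS: "compact (S \<inter> cball q (3 * \<delta>))" using proper[OF compact_cball \<delta>(2)] .
  have clP: "closed {x. inner x N = \<tau>}" by (intro closed_Collect_eq continuous_intros)
  have "compact (S \<inter> cball q (3 * \<delta>) \<inter> {x. inner x N = \<tau>})" by (rule compact_Int_closed[OF cS clP])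
  moreover have "q \<in> S \<inter> cball q (3 * \<delta>) \<inter> {x. inner x N = \<tau>}" using q \<delta> by simp
  ultimately have "\<exists>z\<in>S \<inter> cball q (3 * \<delta>) \<inter> {x. inner x N = \<tau>}.
      \<forall>k\<in>S \<inter> cball q (3 * \<delta>) \<inter> {x. inner x N = \<tau>}. dist x1 z \<le> dist x1 k"
    by (intro continuous_attains_inf continuous_intros) auto
  then obtain z where z: "z \<in> S" "z \<in> cball q (3 * \<delta>)" "inner z N = \<tau>"
    and zmin: "\<And>k. k \<in> S \<inter> cball q (3 * \<delta>) \<inter> {x. inner x N = \<tau>} \<Longrightarrow> dist x1 z \<le> dist x1 k"
    by blast
  define d where "d = dist x1 z"
  have d: "d > 0" "d < \<delta>" using zmin[of q] q x1 z \<delta> by (auto simp: d_def)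
  have Kfar: "d \<le> dist x1 k" if k: "k \<in> S" "inner k N = \<tau>" for k
  proof (rule ccontr)
    assume "\<not> d \<le> dist x1 k"
    then have "dist q k \<le> 3 * \<delta>" using x1(3) d dist_triangle[of q k x1] by (simp add: dist_commute)
    then have "d \<le> dist x1 k" using zmin[of k] k by (simp add: d_def)
    then show False using \<open>\<not> d \<le> dist x1 k\<close> by simp
  qed
  (* halving the ball keeps it inside the larger one, which it touches only at z;
     this excludes further contact points on its boundary *)
  define x0 where "x0 = (1/2) *\<^sub>R (x1 + z)"
  define R where "R = d / 2"
  have R: "R > 0" using d by (simp add: R_def)
  have x0N: "inner x0 N = \<tau>" using x1(2) z(3) by (simp add: x0_def inner_add_left)
  have zx: "z - x0 = (1/2) *\<^sub>R (z - x1)" "x0 - x1 = (1/2) *\<^sub>R (z - x1)"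
    by (simp_all add: x0_def algebra_simps flip: scaleR_add_left)
  have Rz: "dist z x0 = R" using zx(1) by (simp add: dist_norm R_def d_def norm_minus_commute)
  have only: "k = z" if k: "k \<in> S" "inner k N = \<tau>" "norm (k - x0) \<le> R" for k
  proof -
    define m where "m = x0 - x1"
    have m: "norm m = R" using zx(2) by (simp add: m_def R_def d_def dist_norm norm_minus_commute)
    have mz: "z - x0 = m" using zx by (simp add: m_def)
    have e: "(norm (k - x1))\<^sup>2 = (norm (k - x0))\<^sup>2 + 2 * inner (k - x0) m + R\<^sup>2"
    proof -
      have "(norm (a + m))\<^sup>2 = (norm a)\<^sup>2 + 2 * inner a m + (norm m)\<^sup>2" for a
        by (simp add: power2_norm_eq_inner inner_add_left inner_add_right inner_commute)
      from this[of "k - x0"] show ?thesis using m by (simp add: m_def)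
    qed
    have "2 * R \<le> norm (k - x1)" using Kfar[OF k(1,2)] by (simp add: R_def dist_norm norm_minus_commute)
    then have 1: "4 * R\<^sup>2 \<le> (norm (k - x1))\<^sup>2" using R power_mono[of "2 * R" "norm (k - x1)" 2] by (simp add: power_mult_distrib)
    have 2: "(norm (k - x0))\<^sup>2 \<le> R\<^sup>2" using k(3) by (intro power_mono) auto
    have "(norm ((k - x0) - m))\<^sup>2 = (norm (k - x0))\<^sup>2 - 2 * inner (k - x0) m + R\<^sup>2"
      by (simp add: m[symmetric] power2_norm_eq_inner inner_diff_left inner_diff_right inner_commute)
    then have "(norm ((k - x0) - m))\<^sup>2 \<le> 0" using e 1 2 by linarith
    then have "k - x0 = m" by simp
    then show "k = z" using mz by (metis diff_add_cancel)
  qed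
  have zball: "cball z R \<subseteq> cball q (3 * \<delta>)"
  proof
    fix x assume "x \<in> cball z R"
    then have "dist z x \<le> d / 2" by (simp add: R_def)
    moreover have "dist q z \<le> dist q x1 + d" unfolding d_def by (rule dist_triangle)
    moreover have "dist q x \<le> dist q z + dist z x" by (rule dist_triangle)
    moreover have "dist q x1 < \<delta>" using x1(3) by (simp add: dist_commute)
    ultimately have "dist q x \<le> 3 * \<delta>" using d by linarith
    then show "x \<in> cball q (3 * \<delta>)" by simp
  qed
  have main: "barrier_touches S N x0 z \<rho> \<alpha>" if \<rho>: "0 < \<rho>" "\<rho> \<le> R" and \<alpha>: "0 < \<alpha>" for \<rho> \<alpha>
  proof -
    define w where "w x = exp (- \<alpha> * (norm (x - x0))\<^sup>2)" for x
    have w1: "w x \<le> 1" "0 < w x" for x using \<alpha> by (simp_all add: w_def)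
    have cb: "cball z \<rho> \<subseteq> cball z R" using \<rho> by auto
    then have cbH: "cball z \<rho> \<subseteq> halfspace" using zball \<delta>(2) by blast
    have cz: "compact (S \<inter> cball z \<rho>)" using proper[OF compact_cball cbH] .
    define C where "C = S \<inter> cball z \<rho> \<inter> (sphere z \<rho> \<inter> cball x0 R)"
    have C: "compact C" unfolding C_def by (intro compact_Int_closed[OF cz] closed_Int closed_sphere closed_cball)
    have Cneg: "inner x N < \<tau>" if "x \<in> C" for x
    proof -
      have x: "x \<in> S" "dist z x = \<rho>" "norm (x - x0) \<le> R"
        using that by (auto simp: C_def dist_norm norm_minus_commute)
      then have "inner x N \<noteq> \<tau>" using only[of x] \<rho> by auto
      then show ?thesis using le[OF x(1)] by simp
    qed
    obtain \<epsilon>0 where \<epsilon>0: "\<epsilon>0 > 0" "\<And>x. x \<in> C \<Longrightarrow> inner x N \<le> \<tau> - \<epsilon>0"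
    proof (cases "C = {}")
      case False
      have "\<exists>c\<in>C. \<forall>x\<in>C. inner x N \<le> inner c N"
        by (intro continuous_attains_sup C False continuous_intros)
      then obtain c where c: "c \<in> C" "\<And>x. x \<in> C \<Longrightarrow> inner x N \<le> inner c N" by blast
      show ?thesis using that[of "\<tau> - inner c N"] c Cneg[OF c(1)] by auto
    qed (use that[of 1] in auto)
    show ?thesis
      unfolding barrier_touches_def
    proof (intro exI[of _ \<epsilon>0] conjI \<epsilon>0(1) allI impI)
      fix \<epsilon> assume \<epsilon>: "0 < \<epsilon>" "\<epsilon> < \<epsilon>0"
      define \<psi> where "\<psi> x = inner x N + \<epsilon> * w x" for x
      have "continuous_on (S \<inter> cball z \<rho>) \<psi>" unfolding \<psi>_def w_def by (intro continuous_intros)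
      moreover have "z \<in> S \<inter> cball z \<rho>" using z \<rho> by simp
      ultimately obtain p where p: "p \<in> S \<inter> cball z \<rho>" "\<And>x. x \<in> S \<inter> cball z \<rho> \<Longrightarrow> \<psi> x \<le> \<psi> p"
        using continuous_attains_sup[OF cz, of \<psi>] by blast
      have pz: "\<psi> z \<le> \<psi> p" using p(2)[of z] z \<rho> by simp
      have "dist z p \<noteq> \<rho>"
      proof
        assume b: "dist z p = \<rho>"
        show False
        proof (cases "norm (p - x0) \<le> R")
          case True
          then have "p \<in> C" using p b by (simp add: C_def dist_norm norm_minus_commute)
          then have "inner p N \<le> \<tau> - \<epsilon>0" by (rule \<epsilon>0(2))
          moreover have "\<epsilon> * w p \<le> \<epsilon>" using w1[of p] \<epsilon> by simp
          moreover have "\<epsilon> * w z > 0" using w1[of z] \<epsilon> by simp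
          ultimately show False using pz \<epsilon> z(3) unfolding \<psi>_def by linarith
        next
          case False
          then have "R\<^sup>2 < (norm (p - x0))\<^sup>2" using R by (intro power_strict_mono) auto
          then have "w p < w z" using \<alpha> Rz by (simp add: w_def dist_norm)
          then have "\<epsilon> * w p < \<epsilon> * w z" using \<epsilon> by simp
          moreover have "inner p N \<le> \<tau>" using le p by simp
          ultimately show False using pz z(3) unfolding \<psi>_def by linarith
        qed
      qed
      then have "p \<in> S \<inter> ball z \<rho>" using p by simp
      moreover have "\<forall>x\<in>S \<inter> ball z \<rho>. \<psi> x \<le> \<psi> p" using p by simp
      ultimately show "\<exists>p\<in>S \<inter> ball z \<rho>. \<forall>x\<in>S \<inter> ball z \<rho>. inner x N + \<epsilon> * exp (- \<alpha> * (norm (x - x0))\<^sup>2) \<le>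
         inner p N + \<epsilon> * exp (- \<alpha> * (norm (p - x0))\<^sup>2)"
        unfolding \<psi>_def w_def by blast
    qed
  qed
  have "cball z R \<subseteq> halfspace" using zball \<delta>(2) by blast
  then show ?thesis using R z x0N Rz main
    by (intro exI[of _ z] exI[of _ x0] exI[of _ R] conjI) auto
qed


section \<open>The strong maximum principle\<close>

text \<open>
  The comparison for \<open>\<psi> x = x \<bullet> N + \<epsilon> exp (- \<alpha> |x - x0|\<^sup>2)\<close>, whose gradient is \<open>a\<close>; \<open>v i\<close> is the component of \<open>p - x0\<close> along the \<open>i\<close>-th
  principal direction.  The gain is the term with \<open>\<alpha> (v i)\<^sup>2\<close>.  For \<open>\<epsilon> = 0\<close> this is the comparison with the leaf itself.
\<close>

lemma barrier_curvature:
  fixes S :: "('n::finite pt) set" and N x0 p :: "'n pt"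
  assumes S: "C2_hypersurface S" "unit_normal_field S \<nu>" "p \<in> S" and V: "open V" "p \<in> V"
    and max: "\<And>x. x \<in> S \<inter> V \<Longrightarrow> inner x N + \<epsilon> * exp (- \<alpha> * (norm (x - x0))\<^sup>2) \<le>
         inner p N + \<epsilon> * exp (- \<alpha> * (norm (p - x0))\<^sup>2)"
  defines "\<theta> \<equiv> 2 * \<epsilon> * \<alpha> * exp (- \<alpha> * (norm (p - x0))\<^sup>2)"
  defines "a \<equiv> N - \<theta> *\<^sub>R (p - x0)"
  shows "\<exists>k. a = k *\<^sub>R \<nu> p"
    and "\<exists>v. (\<Sum>i\<in>UNIV. (v i)\<^sup>2) = (norm (p - x0))\<^sup>2 - (inner (p - x0) (\<nu> p))\<^sup>2 / (snd p)\<^sup>2 \<and>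
      (\<forall>i. norm a * (sgn (inner a (\<nu> p)) * principal_curvatures S \<nu> p i) \<le>
        snd N - \<theta> * snd (p - x0) - snd p * (\<theta> * (2 * \<alpha> * (v i)\<^sup>2 - 1)))"
proof -
  define E where "E x = exp (- \<alpha> * (norm (x - x0))\<^sup>2)" for x
  define \<psi> where "\<psi> x = inner x N + \<epsilon> * E x" for x
  define A where "A x = N - (2 * \<epsilon> * \<alpha> * E x) *\<^sub>R (x - x0)" for x
  define B where "B h = (4 * \<epsilon> * \<alpha>\<^sup>2 * E p * inner (p - x0) h) *\<^sub>R (p - x0) - (2 * \<epsilon> * \<alpha> * E p) *\<^sub>R h" for h
  have DE: "(E has_derivative (\<lambda>h. - 2 * \<alpha> * E x * inner (x - x0) h)) (at x)" for x
    unfolding E_def power2_norm_eq_inner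
    by (auto intro!: derivative_eq_intros simp: inner_commute algebra_simps)
  have D\<psi>: "(\<psi> has_derivative (\<lambda>h. inner (A x) h)) (at x)" for x
    unfolding \<psi>_def A_def
    by (auto intro!: derivative_eq_intros DE simp: inner_diff_left inner_commute algebra_simps)
  have DA: "(A has_derivative B) (at p)"
    unfolding A_def B_def
    by (auto intro!: derivative_eq_intros DE simp: algebra_simps power2_eq_square)
  have max': "\<psi> x \<le> \<psi> p" if "x \<in> S \<inter> V" for x using max[OF that] by (simp add: \<psi>_def E_def)
  have Ap: "A p = a" by (simp add: A_def a_def \<theta>_def E_def)
  show "\<exists>k. a = k *\<^sub>R \<nu> p"
    using gradient_parallel_normal_at_max[OF S V D\<psi> max'] unfolding Ap .
  obtain U f G G' where U: "p \<in> U" "oriented_chart S \<nu> U f G G'"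
    using oriented_chart_exists[OF S(1,3,2)] by (elim exE conjE) (rule that)
  have y: "snd p > 0" using U unfolding oriented_chart_def chart_def halfspace_def by auto
  obtain e where e: "eigenframe S \<nu> p (principal_curvatures S \<nu> p) e"
    using principal_curvatures_eigenframe[OF S] by (elim exE) (rule that)
  define u where "u i = e i /\<^sub>R snd p" for i
  have "(\<lambda>i. snd p *\<^sub>R u i) = e" using y by (simp add: u_def)
  then have fr: "eigenframe S \<nu> p (principal_curvatures S \<nu> p) (\<lambda>i. snd p *\<^sub>R u i)" using e by simp
  have uu: "inner (u i) (u i) = 1" for i
    using fr[unfolded eigenframe_chart'[OF U(2) S(3) U(1)]] by (simp add: orthonormal_frame_def)
  have "norm a * (sgn (inner a (\<nu> p)) * principal_curvatures S \<nu> p i) \<le>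
        snd N - \<theta> * snd (p - x0) - snd p * (\<theta> * (2 * \<alpha> * (inner (p - x0) (u i))\<^sup>2 - 1))" for i
  proof -
    have "inner (B (u i)) (u i) = \<theta> * (2 * \<alpha> * (inner (p - x0) (u i))\<^sup>2 - 1)"
      using uu[of i] by (simp add: B_def \<theta>_def E_def inner_diff_left power2_eq_square algebra_simps)
    moreover have "snd a = snd N - \<theta> * snd (p - x0)" by (simp add: a_def)
    ultimately show ?thesis
      using curvature_comparison_at_max[OF U(2) S(3) U(1) V D\<psi> DA max' fr, of i] unfolding Ap by simp
  qed
  then show "\<exists>v. (\<Sum>i\<in>UNIV. (v i)\<^sup>2) = (norm (p - x0))\<^sup>2 - (inner (p - x0) (\<nu> p))\<^sup>2 / (snd p)\<^sup>2 \<and>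
      (\<forall>i. norm a * (sgn (inner a (\<nu> p)) * principal_curvatures S \<nu> p i) \<le>
        snd N - \<theta> * snd (p - x0) - snd p * (\<theta> * (2 * \<alpha> * (v i)\<^sup>2 - 1)))"
    by (intro exI[of _ "\<lambda>i. inner (p - x0) (u i)"] conjI allI frame_parseval[OF U(2) S(3) U(1) fr])
qed

lemma elem_sym_1: "elem_sym 1 \<kappa> = (\<Sum>i\<in>UNIV. \<kappa> i)"
proof -
  have "{I::'a set. card I = 1} = range (\<lambda>i. {i})" by (auto simp: card_1_singleton_iff)
  moreover have "inj (\<lambda>i::'a. {i})" by (simp add: inj_def)
  ultimately show ?thesis by (simp add: elem_sym_def sum.reindex)
qed

lemma elem_sym_scale: "elem_sym r (\<lambda>i. c * \<kappa> i) = c ^ r * elem_sym r \<kappa>"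
  by (simp add: elem_sym_def prod.distrib sum_distrib_left)

lemma elem_sym_mono:
  assumes "\<And>i. 0 \<le> \<kappa> i" "\<And>i. \<kappa> i \<le> \<mu> i"
  shows "elem_sym r \<kappa> \<le> elem_sym r \<mu>"
  unfolding elem_sym_def using assms by (intro sum_mono prod_mono) auto

lemma prod_add_lower_bound:
  fixes w :: "'i \<Rightarrow> real"
  assumes "finite I" "b \<ge> 0" "\<And>i. i \<in> I \<Longrightarrow> w i \<ge> 0"
  shows "b ^ card I + b ^ (card I - 1) * sum w I \<le> (\<Prod>i\<in>I. b + w i)"
  using assms(1,3)
proof (induction I)
  case (insert j I)
  have w: "w j \<ge> 0" "sum w I \<ge> 0" using insert by (auto intro: sum_nonneg)
  have IH: "b ^ card I + b ^ (card I - 1) * sum w I \<le> (\<Prod>i\<in>I. b + w i)" using insert by auto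
  have "b ^ Suc (card I) + b ^ card I * (w j + sum w I) \<le> (b + w j) * (b ^ card I + b ^ (card I - 1) * sum w I)"
  proof (cases "card I")
    case 0
    then have "I = {}" using insert by simp
    then show ?thesis by simp
  next
    case (Suc m)
    have "0 \<le> w j * (b ^ m * sum w I)" using w assms(2) by simp
    then show ?thesis using Suc by (simp add: algebra_simps)
  qed
  also have "\<dots> \<le> (b + w j) * (\<Prod>i\<in>I. b + w i)" using IH w assms(2) by (intro mult_left_mono) auto
  finally show ?case using insert by simp
qed simp

text \<open>
  Only the terms of order at most one in \<open>w\<close> are kept; each \<open>w i\<close> occurs in at least one of the products because \<open>1 \<le> r\<close>.
\<close>

lemma elem_sym_lower_bound:
  fixes \<mu> w :: "'n::finite \<Rightarrow> real" and b :: real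
  assumes r: "1 \<le> r" "r \<le> CARD('n)" and b: "b \<ge> 0" and w: "\<And>i. w i \<ge> 0" and \<mu>: "\<And>i. b + w i \<le> \<mu> i"
  shows "real (CARD('n) choose r) * b ^ r + b ^ (r - 1) * (\<Sum>i\<in>UNIV. w i) \<le> elem_sym r \<mu>"
proof -
  let ?A = "{I::'n set. card I = r}"
  have card: "card ?A = CARD('n) choose r" using n_subsets[of "UNIV::'n set" r] by simp
  have "(\<Sum>i\<in>UNIV. w i) \<le> (\<Sum>i\<in>UNIV. \<Sum>I\<in>?A. if i \<in> I then w i else 0)"
  proof (rule sum_mono)
    fix i :: 'n
    obtain I :: "'n set" where I: "{i} \<subseteq> I" "card I = r"
      using exists_subset_between[of "{i}" r UNIV] r by auto
    have "w i = (\<Sum>I\<in>{I}. if i \<in> I then w i else 0)" using I by simp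
    also have "\<dots> \<le> (\<Sum>I\<in>?A. if i \<in> I then w i else 0)" using I w by (intro sum_mono2) auto
    finally show "w i \<le> (\<Sum>I\<in>?A. if i \<in> I then w i else 0)" .
  qed
  also have "\<dots> = (\<Sum>I\<in>?A. \<Sum>i\<in>UNIV. if i \<in> I then w i else 0)" by (rule sum.swap)
  also have "\<dots> = (\<Sum>I\<in>?A. sum w I)" by (simp add: sum.If_cases)
  finally have "(\<Sum>i\<in>UNIV. w i) \<le> (\<Sum>I\<in>?A. sum w I)" .
  then have "b ^ (r - 1) * (\<Sum>i\<in>UNIV. w i) \<le> b ^ (r - 1) * (\<Sum>I\<in>?A. sum w I)" using b by (intro mult_left_mono) auto
  then have "real (CARD('n) choose r) * b ^ r + b ^ (r - 1) * (\<Sum>i\<in>UNIV. w i) \<le> (\<Sum>I\<in>?A. b ^ r + b ^ (r - 1) * sum w I)"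
    by (simp add: sum.distrib card sum_distrib_left)
  also have "\<dots> \<le> (\<Sum>I\<in>?A. \<Prod>i\<in>I. b + w i)"
  proof (rule sum_mono)
    fix I assume "I \<in> ?A"
    then show "b ^ r + b ^ (r - 1) * sum w I \<le> (\<Prod>i\<in>I. b + w i)"
      using prod_add_lower_bound[of I b w] b w by auto
  qed
  also have "\<dots> = elem_sym r (\<lambda>i. b + w i)" by (simp add: elem_sym_def)
  also have "\<dots> \<le> elem_sym r \<mu>" using \<mu> b w by (intro elem_sym_mono) auto
  finally show ?thesis .
qed

lemma power_add_upper_bound:
  fixes b t :: real
  assumes "b > 0" "t \<ge> 0" "2 * real r * t \<le> b"
  shows "(b + t) ^ r \<le> b ^ r + 2 * real r * t * b ^ (r - 1)"
  using assms(3)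
proof (induction r)
  case (Suc r)
  have le: "2 * real r * t \<le> b" using Suc(2) assms(2) by (simp add: algebra_simps)
  then have IH: "(b + t) ^ r \<le> b ^ r + 2 * real r * t * b ^ (r - 1)" by (rule Suc(1))
  have "(b + t) ^ Suc r \<le> (b + t) * (b ^ r + 2 * real r * t * b ^ (r - 1))"
    using IH assms by (simp add: mult_left_mono)
  also have "\<dots> \<le> b ^ Suc r + 2 * real (Suc r) * t * b ^ r"
  proof (cases r)
    case 0
    then show ?thesis using assms by simp
  next
    case (Suc m)
    have "(2 * real r * t) * (t * b ^ m) \<le> b * (t * b ^ m)" using le assms by (intro mult_right_mono) auto
    then show ?thesis using Suc by (simp add: algebra_simps)
  qed
  finally show ?case by simp
qed simp

lemma continuous_on_gt_ball:
  fixes f :: "'a::metric_space \<Rightarrow> real"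
  assumes "continuous_on S f" "z \<in> S" "f z > c"
  shows "\<exists>\<rho>>0. \<forall>x\<in>S \<inter> ball z \<rho>. f x > c"
proof -
  obtain d where d: "d > 0" "\<And>x. x \<in> S \<Longrightarrow> dist x z < d \<Longrightarrow> dist (f x) (f z) < f z - c"
    using assms unfolding continuous_on_iff by (metis diff_gt_0_iff_gt)
  have "f x > c" if "x \<in> S \<inter> ball z d" for x
    using d(2)[of x] that by (auto simp: dist_commute dist_real_def abs_less_iff)
  then show ?thesis using d(1) by blast
qed

lemma abs_snd_le_norm: "\<bar>snd v\<bar> \<le> norm v" for v :: "'a::real_normed_vector \<times> real"
  using norm_snd_le[of "snd v" "fst v"] by (simp only: prod.collapse real_norm_def)

text \<open>
  At the contact point \<open>z\<close> the normal is orthogonal to the leaf, so \<open>z - x0\<close> is tangent to \<open>S\<close>; by continuity the tangential part of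
  \<open>x - x0\<close> has length at least \<open>R / sqrt 2\<close> for all \<open>x\<close> in \<open>S\<close> near \<open>z\<close>.  This is the quantity that makes the barrier effective.
\<close>

lemma strong_maximum_setup:
  fixes S :: "('n::finite pt) set" and N :: "'n pt"
  assumes S: "C2_hypersurface S" "unit_normal_field S \<nu>"
    and proper: "\<And>K. compact K \<Longrightarrow> K \<subseteq> halfspace \<Longrightarrow> compact (S \<inter> K)"
    and N: "norm N = 1"
    and q: "q \<in> S" "inner q N = \<tau>"
    and le: "\<And>x. x \<in> S \<Longrightarrow> inner x N \<le> \<tau>"
    and near: "\<And>\<delta>. \<delta> > 0 \<Longrightarrow> \<exists>x1. x1 \<notin> S \<and> inner x1 N = \<tau> \<and> dist x1 q < \<delta>"
  shows "\<exists>z x0 R \<rho>. R > 0 \<and> 0 < \<rho> \<and> z \<in> S \<and> inner z N = \<tau> \<and> snd z > 0 \<and>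
    (\<forall>x\<in>S \<inter> ball z \<rho>. norm (x - x0) \<le> 2 * R \<and> snd z / 2 < snd x \<and> snd x \<le> snd z + R \<and>
       (norm (x - x0))\<^sup>2 - (inner (x - x0) (\<nu> x))\<^sup>2 / (snd x)\<^sup>2 > R\<^sup>2 / 2) \<and>
    (\<forall>\<rho>' \<alpha>. 0 < \<rho>' \<longrightarrow> \<rho>' \<le> \<rho> \<longrightarrow> 0 < \<alpha> \<longrightarrow> barrier_touches S N x0 z \<rho>' \<alpha>)"
proof -
  have SH: "S \<subseteq> halfspace" using S(1) unfolding C2_hypersurface_def by blast
  then have qH: "q \<in> halfspace" using q by blast
  have "\<exists>z x0 R. R > 0 \<and> z \<in> S \<and> inner z N = \<tau> \<and> inner x0 N = \<tau> \<and> dist z x0 = R \<and> cball z R \<subseteq> halfspace \<and>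
    (\<forall>\<rho> \<alpha>. 0 < \<rho> \<longrightarrow> \<rho> \<le> R \<longrightarrow> 0 < \<alpha> \<longrightarrow> barrier_touches S N x0 z \<rho> \<alpha>)"
    by (rule barrier_contact_points[OF _ q qH]) (fact proper le near)+
  then obtain z x0 R where R: "R > 0" and z: "z \<in> S" "inner z N = \<tau>" and x0: "inner x0 N = \<tau>" "dist z x0 = R"
    and main: "\<forall>\<rho> \<alpha>. 0 < \<rho> \<longrightarrow> \<rho> \<le> R \<longrightarrow> 0 < \<alpha> \<longrightarrow> barrier_touches S N x0 z \<rho> \<alpha>"
    by blast
  have zy: "snd z > 0" using z SH by (auto simp: halfspace_def)
  have ypos: "snd x > 0" if "x \<in> S" for x using that SH by (auto simp: halfspace_def)
  have "((\<lambda>x. inner x N) has_derivative (\<lambda>v. inner N v)) (at z)"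
    by (auto intro!: derivative_eq_intros simp: inner_commute)
  then obtain k where k: "N = k *\<^sub>R \<nu> z"
    using gradient_parallel_normal_at_max[OF S z(1) open_UNIV UNIV_I, of "\<lambda>x. inner x N" N] le z(2) by auto
  have k0: "k \<noteq> 0" using k N by auto
  have "inner (z - x0) N = 0" using z(2) x0(1) by (simp add: inner_diff_left)
  then have perp: "inner (z - x0) (\<nu> z) = 0" using k k0 by simp
  define g where "g x = (norm (x - x0))\<^sup>2 - (inner (x - x0) (\<nu> x))\<^sup>2 / (snd x)\<^sup>2" for x
  have cg: "continuous_on S g"
    unfolding g_def using S(2) ypos unfolding unit_normal_field_def
    by (intro continuous_intros) (auto, force)
  have gz: "g z = R\<^sup>2" using x0(2) by (simp add: g_def perp dist_norm)
  have "R\<^sup>2 / 2 < g z" using gz R by simp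
  then obtain \<rho>1 where \<rho>1: "\<rho>1 > 0" "\<forall>x\<in>S \<inter> ball z \<rho>1. g x > R\<^sup>2 / 2"
    using continuous_on_gt_ball[OF cg z(1)] by blast
  have "continuous_on S snd" by (intro continuous_intros)
  then obtain \<rho>2 where \<rho>2: "\<rho>2 > 0" "\<forall>x\<in>S \<inter> ball z \<rho>2. snd x > snd z / 2"
    using continuous_on_gt_ball[of S snd z "snd z / 2"] z(1) zy by auto
  define \<rho> where "\<rho> = min R (min \<rho>1 \<rho>2)"
  have \<rho>: "\<rho> > 0" "\<rho> \<le> R" using R \<rho>1 \<rho>2 by (auto simp: \<rho>_def)
  have "norm (x - x0) \<le> 2 * R \<and> snd z / 2 < snd x \<and> snd x \<le> snd z + R \<and> g x > R\<^sup>2 / 2" if x: "x \<in> S \<inter> ball z \<rho>" for x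
  proof -
    have d: "norm (x - z) < R" using x \<rho> by (simp add: dist_norm norm_minus_commute)
    have "norm (x - x0) \<le> norm (x - z) + norm (z - x0)" using norm_triangle_ineq[of "x - z" "z - x0"] by simp
    then have 1: "norm (x - x0) \<le> 2 * R" using d x0(2) by (simp add: dist_norm)
    have "\<bar>snd (x - z)\<bar> \<le> norm (x - z)" by (rule abs_snd_le_norm)
    then have "snd x \<le> snd z + R" using d by simp
    then show ?thesis using 1 x \<rho>1 \<rho>2 by (auto simp: \<rho>_def)
  qed
  then show ?thesis
    using R \<rho> z zy main unfolding g_def
    by (intro exI[of _ z] exI[of _ x0] exI[of _ R] exI[of _ \<rho>] conjI) auto
qed

text \<open>
  Summing the barrier comparison over the principal directions bounds \<open>|a| n H\<^sub>1\<close> from above, while the assumption and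
  \<open>|a| \<ge> a \<bullet> N\<close> bound it from below.  All terms are proportional to \<open>\<theta>\<close>, except for \<open>n snd N\<close>, which cancels; what remains is
  \<open>\<alpha>\<close> times a positive constant on one side and a bound independent of \<open>\<alpha>\<close> on the other.
\<close>

theorem contact_open_mean_curvature:
  fixes S :: "('n::finite pt) set" and N :: "'n pt"
  assumes S: "C2_hypersurface S" "unit_normal_field S \<nu>"
    and proper: "\<And>K. compact K \<Longrightarrow> K \<subseteq> halfspace \<Longrightarrow> compact (S \<inter> K)"
    and N: "norm N = 1" "snd N > 0"
    and q: "q \<in> S" "inner q N = \<tau>"
    and le: "\<And>x. x \<in> S \<Longrightarrow> inner x N \<le> \<tau>"
    and ori: "\<And>x. x \<in> S \<Longrightarrow> inner x N = \<tau> \<Longrightarrow> inner (\<nu> x) N > 0"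
    and mean: "\<And>x. x \<in> S \<Longrightarrow> real CARD('n) * snd N \<le> elem_sym 1 (principal_curvatures S \<nu> x)"
  shows "\<exists>\<delta>>0. \<forall>x. inner x N = \<tau> \<longrightarrow> dist x q < \<delta> \<longrightarrow> x \<in> S"
proof (rule ccontr)
  assume "\<not> (\<exists>\<delta>>0. \<forall>x. inner x N = \<tau> \<longrightarrow> dist x q < \<delta> \<longrightarrow> x \<in> S)"
  then have near: "\<exists>x1. x1 \<notin> S \<and> inner x1 N = \<tau> \<and> dist x1 q < \<delta>" if "\<delta> > 0" for \<delta> using that by blast
  let ?n = "real CARD('n)"
  have "\<exists>z x0 R \<rho>. R > 0 \<and> 0 < \<rho> \<and> z \<in> S \<and> inner z N = \<tau> \<and> snd z > 0 \<and>
    (\<forall>x\<in>S \<inter> ball z \<rho>. norm (x - x0) \<le> 2 * R \<and> snd z / 2 < snd x \<and> snd x \<le> snd z + R \<and>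
       (norm (x - x0))\<^sup>2 - (inner (x - x0) (\<nu> x))\<^sup>2 / (snd x)\<^sup>2 > R\<^sup>2 / 2) \<and>
    (\<forall>\<rho>' \<alpha>. 0 < \<rho>' \<longrightarrow> \<rho>' \<le> \<rho> \<longrightarrow> 0 < \<alpha> \<longrightarrow> barrier_touches S N x0 z \<rho>' \<alpha>)"
    by (rule strong_maximum_setup[OF S _ N(1) q]) (fact proper le near)+
  then obtain z x0 R \<rho>1 where R: "R > 0" and \<rho>1: "\<rho>1 > 0" and z: "z \<in> S" "inner z N = \<tau>" "snd z > 0"
    and loc: "\<forall>x\<in>S \<inter> ball z \<rho>1. norm (x - x0) \<le> 2 * R \<and> snd z / 2 < snd x \<and> snd x \<le> snd z + R \<and>
       (norm (x - x0))\<^sup>2 - (inner (x - x0) (\<nu> x))\<^sup>2 / (snd x)\<^sup>2 > R\<^sup>2 / 2"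
    and bt: "\<forall>\<rho>' \<alpha>. 0 < \<rho>' \<longrightarrow> \<rho>' \<le> \<rho>1 \<longrightarrow> 0 < \<alpha> \<longrightarrow> barrier_touches S N x0 z \<rho>' \<alpha>"
    by blast
  have "continuous_on S (\<lambda>x. inner (\<nu> x) N)"
    using S(2) unfolding unit_normal_field_def by (intro continuous_intros) auto
  then obtain \<rho>2 where \<rho>2: "\<rho>2 > 0" "\<forall>x\<in>S \<inter> ball z \<rho>2. inner (\<nu> x) N > 0"
    using continuous_on_gt_ball[of S "\<lambda>x. inner (\<nu> x) N" z 0] ori[OF z(1,2)] z(1) by blast
  define \<rho> where "\<rho> = min \<rho>1 \<rho>2"
  have \<rho>: "\<rho> > 0" "\<rho> \<le> \<rho>1" "\<rho> \<le> \<rho>2" using \<rho>1 \<rho>2 by (auto simp: \<rho>_def)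
  define y0 where "y0 = snd z / 2"
  define Y where "Y = snd z + R"
  have y0: "y0 > 0" and Y: "Y > 0" using z(3) R by (auto simp: y0_def Y_def)
  (* chosen so that the gain y0 \<alpha> R\<^sup>2 exceeds the error n (Y + 4 R) of the final estimate *)
  define \<alpha> where "\<alpha> = (?n * (Y + 4 * R) + 1) / (y0 * R\<^sup>2)"
  have den: "y0 * R\<^sup>2 > 0" using y0 R by simp
  have num: "?n * (Y + 4 * R) + 1 > 0" using Y R by (simp add: add_nonneg_pos)
  have \<alpha>: "\<alpha> > 0" using den num by (simp add: \<alpha>_def)
  have \<alpha>eq: "\<alpha> * (y0 * R\<^sup>2) = ?n * (Y + 4 * R) + 1" by (rule nonzero_eq_divide_eq[THEN iffD1, OF _ \<alpha>_def]) (use den in linarith)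
  obtain \<epsilon>0 where \<epsilon>0: "\<epsilon>0 > 0" and bar: "\<And>\<epsilon>. 0 < \<epsilon> \<Longrightarrow> \<epsilon> < \<epsilon>0 \<Longrightarrow>
      (\<exists>p\<in>S \<inter> ball z \<rho>. \<forall>x\<in>S \<inter> ball z \<rho>. inner x N + \<epsilon> * exp (- \<alpha> * (norm (x - x0))\<^sup>2) \<le>
         inner p N + \<epsilon> * exp (- \<alpha> * (norm (p - x0))\<^sup>2))"
    using bt[rule_format, OF \<rho>(1,2) \<alpha>] unfolding barrier_touches_def by blast
  (* the second bound keeps the gradient a of the perturbed height on the side of N *)
  define \<epsilon> where "\<epsilon> = min (\<epsilon>0 / 2) (1 / (8 * \<alpha> * R))"
  have pos8: "8 * \<alpha> * R > 0" using \<alpha> R by simp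
  have \<epsilon>: "0 < \<epsilon>" "\<epsilon> < \<epsilon>0" using \<epsilon>0 pos8 by (auto simp: \<epsilon>_def)
  have "\<epsilon> \<le> 1 / (8 * \<alpha> * R)" by (simp add: \<epsilon>_def)
  then have \<epsilon>8: "\<epsilon> * (8 * \<alpha> * R) \<le> 1" using pos8 by (simp add: pos_le_divide_eq)
  obtain p where p: "p \<in> S" "p \<in> ball z \<rho>" and pmax: "\<And>x. x \<in> S \<inter> ball z \<rho> \<Longrightarrow>
      inner x N + \<epsilon> * exp (- \<alpha> * (norm (x - x0))\<^sup>2) \<le> inner p N + \<epsilon> * exp (- \<alpha> * (norm (p - x0))\<^sup>2)"
    using bar[OF \<epsilon>] by blast
  have pl: "norm (p - x0) \<le> 2 * R" "y0 < snd p" "snd p \<le> Y"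
    "(norm (p - x0))\<^sup>2 - (inner (p - x0) (\<nu> p))\<^sup>2 / (snd p)\<^sup>2 > R\<^sup>2 / 2"
    using loc p \<rho> by (auto simp: y0_def Y_def)
  have nuN: "inner (\<nu> p) N > 0" using \<rho>2 p \<rho> by auto
  define \<theta> where "\<theta> = 2 * \<epsilon> * \<alpha> * exp (- \<alpha> * (norm (p - x0))\<^sup>2)"
  define a where "a = N - \<theta> *\<^sub>R (p - x0)"
  have \<theta>: "0 < \<theta>" using \<epsilon> \<alpha> by (simp add: \<theta>_def)
  have "exp (- \<alpha> * (norm (p - x0))\<^sup>2) \<le> 1" using \<alpha> by simp
  then have "\<theta> \<le> 2 * \<epsilon> * \<alpha>" using \<epsilon> \<alpha> mult_left_mono[of _ 1 "2 * \<epsilon> * \<alpha>"] by (simp add: \<theta>_def)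
  then have "\<theta> * (2 * R) \<le> 2 * \<epsilon> * \<alpha> * (2 * R)" using R by (intro mult_right_mono) auto
  then have \<theta>R: "\<theta> * (2 * R) \<le> 1 / 2" using \<epsilon>8 by (simp add: algebra_simps)
  note bc = barrier_curvature[OF S p(1) open_ball p(2) pmax, folded \<theta>_def, folded a_def]
  obtain k where k: "a = k *\<^sub>R \<nu> p" using bc(1) by blast
  obtain v where v: "(\<Sum>i\<in>UNIV. (v i)\<^sup>2) = (norm (p - x0))\<^sup>2 - (inner (p - x0) (\<nu> p))\<^sup>2 / (snd p)\<^sup>2"
    and vi: "\<And>i. norm a * (sgn (inner a (\<nu> p)) * principal_curvatures S \<nu> p i) \<le>
        snd N - \<theta> * snd (p - x0) - snd p * (\<theta> * (2 * \<alpha> * (v i)\<^sup>2 - 1))"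
    using bc(2) by blast
  have dN: "\<bar>inner (p - x0) N\<bar> \<le> 2 * R" using Cauchy_Schwarz_ineq2[of "p - x0" N] N pl(1) by simp
  have dy: "\<bar>snd (p - x0)\<bar> \<le> 2 * R"
    using abs_snd_le_norm[of "p - x0"] pl(1) by linarith
  have NN: "inner N N = 1" using N by (simp add: dot_square_norm)
  have aN: "inner a N = 1 - \<theta> * inner (p - x0) N" by (simp add: a_def inner_diff_left NN)
  have "\<theta> * inner (p - x0) N \<le> \<theta> * (2 * R)" using dN \<theta> by (intro mult_left_mono) auto
  then have aN0: "inner a N > 0" using aN \<theta>R by linarith
  then have "k * inner (\<nu> p) N > 0" by (simp add: k)
  then have k0: "k > 0" using nuN zero_less_mult_pos2 by blast
  have "\<nu> p \<noteq> 0" using nuN by auto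
  then have sg: "sgn (inner a (\<nu> p)) = 1" using k0 by (simp add: k sgn_mult)
  have "inner a N \<le> norm a" using Cauchy_Schwarz_ineq2[of a N] N by simp
  define \<Sigma>v where "\<Sigma>v = (\<Sum>i\<in>UNIV. (v i)\<^sup>2)"
  have \<Sigma>v: "\<Sigma>v > R\<^sup>2 / 2" using pl(4) v by (simp add: \<Sigma>v_def)
  have "norm a * (\<Sum>i\<in>UNIV. principal_curvatures S \<nu> p i) = (\<Sum>i\<in>UNIV. norm a * principal_curvatures S \<nu> p i)"
    by (rule sum_distrib_left)
  also have "\<dots> \<le> (\<Sum>i\<in>(UNIV::'n set). snd N - \<theta> * snd (p - x0) - snd p * (\<theta> * (2 * \<alpha> * (v i)\<^sup>2 - 1)))"
    using vi unfolding sg by (intro sum_mono) simp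
  also have "\<dots> = ?n * (snd N - \<theta> * snd (p - x0)) - snd p * (\<theta> * (2 * \<alpha> * \<Sigma>v - ?n))"
    by (simp add: sum_subtractf sum_distrib_left[symmetric] \<Sigma>v_def)
  finally have 1: "norm a * (\<Sum>i\<in>UNIV. principal_curvatures S \<nu> p i) \<le>
     ?n * (snd N - \<theta> * snd (p - x0)) - snd p * (\<theta> * (2 * \<alpha> * \<Sigma>v - ?n))" .
  have "(1 - \<theta> * inner (p - x0) N) * (?n * snd N) \<le> norm a * (?n * snd N)"
    using \<open>inner a N \<le> norm a\<close> N(2) unfolding aN by (intro mult_right_mono) auto
  also have "\<dots> \<le> norm a * (\<Sum>i\<in>UNIV. principal_curvatures S \<nu> p i)"
    using mean[OF p(1)] unfolding elem_sym_1 by (intro mult_left_mono) auto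
  finally have 2: "(1 - \<theta> * inner (p - x0) N) * (?n * snd N) \<le> norm a * (\<Sum>i\<in>UNIV. principal_curvatures S \<nu> p i)" .
  from order_trans[OF 2 1]
  have "\<theta> * (snd p * (2 * \<alpha> * \<Sigma>v)) \<le> \<theta> * (?n * snd p + ?n * (inner (p - x0) N * snd N - snd (p - x0)))"
    by (simp add: algebra_simps)
  then have 3: "snd p * (2 * \<alpha> * \<Sigma>v) \<le> ?n * snd p + ?n * (inner (p - x0) N * snd N - snd (p - x0))"
    using \<theta> by simp
  have "\<bar>snd N\<bar> \<le> 1" using abs_snd_le_norm[of N] N by simp
  then have "\<bar>inner (p - x0) N * snd N\<bar> \<le> (2 * R) * 1" unfolding abs_mult using dN by (intro mult_mono) auto
  then have "?n * snd p + ?n * (inner (p - x0) N * snd N - snd (p - x0)) \<le> ?n * (Y + 4 * R)"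
    using dy pl(3) unfolding distrib_left[symmetric] by (intro mult_left_mono) auto
  moreover have "y0 * (2 * \<alpha> * (R\<^sup>2 / 2)) \<le> snd p * (2 * \<alpha> * \<Sigma>v)"
    using pl(2) y0 \<alpha> \<Sigma>v by (intro mult_mono) auto
  moreover have "y0 * (2 * \<alpha> * (R\<^sup>2 / 2)) = ?n * (Y + 4 * R) + 1" using \<alpha>eq by (simp add: algebra_simps)
  ultimately show False using 3 by linarith
qed

text \<open>
  The same barrier turned upside down.  Up to a common sign and the factor \<open>|a|\<close> the principal curvatures are at least
  \<open>b + c (v i)\<^sup>2\<close>, where \<open>b\<close> is slightly less than \<open>snd N\<close>.  The loss in \<open>b\<close> and in \<open>|a|\<close> is of size \<open>\<theta>\<close>, the gain from \<open>c\<close> of size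
  \<open>\<alpha> \<theta>\<close>, so that for large \<open>\<alpha>\<close> the symmetric function exceeds the bound.
\<close>

theorem contact_open_symmetric_curvature:
  fixes S :: "('n::finite pt) set" and N :: "'n pt"
  assumes S: "C2_hypersurface S" "unit_normal_field S \<nu>"
    and proper: "\<And>K. compact K \<Longrightarrow> K \<subseteq> halfspace \<Longrightarrow> compact (S \<inter> K)"
    and N: "norm N = 1" "snd N > 0" and r: "1 \<le> r" "r \<le> CARD('n)"
    and q: "q \<in> S" "inner q N = \<tau>"
    and ge: "\<And>x. x \<in> S \<Longrightarrow> \<tau> \<le> inner x N"
    and bound: "\<And>x. x \<in> S \<Longrightarrow> \<bar>elem_sym r (principal_curvatures S \<nu> x)\<bar> \<le> real (CARD('n) choose r) * snd N ^ r"
  shows "\<exists>\<delta>>0. \<forall>x. inner x N = \<tau> \<longrightarrow> dist x q < \<delta> \<longrightarrow> x \<in> S"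
proof (rule ccontr)
  assume "\<not> (\<exists>\<delta>>0. \<forall>x. inner x N = \<tau> \<longrightarrow> dist x q < \<delta> \<longrightarrow> x \<in> S)"
  then have near: "\<exists>x1. x1 \<notin> S \<and> inner x1 (- N) = - \<tau> \<and> dist x1 q < \<delta>" if \<delta>: "\<delta> > 0" for \<delta>
  proof -
    obtain x where "inner x N = \<tau>" "dist x q < \<delta>" "x \<notin> S"
      using \<open>\<not> (\<exists>\<delta>>0. \<forall>x. inner x N = \<tau> \<longrightarrow> dist x q < \<delta> \<longrightarrow> x \<in> S)\<close> \<delta> by blast
    then show ?thesis by (intro exI[of _ x]) simp
  qed
  have le: "inner x (- N) \<le> - \<tau>" if "x \<in> S" for x using ge[OF that] by simp
  have N': "norm (- N) = 1" and q': "inner q (- N) = - \<tau>" using N q by auto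
  let ?c = "real (CARD('n) choose r)" and ?k = "principal_curvatures S \<nu>"
  have c1: "?c \<ge> 1" using r by (simp add: Suc_le_eq)
  have "\<exists>z x0 R \<rho>. R > 0 \<and> 0 < \<rho> \<and> z \<in> S \<and> inner z (- N) = - \<tau> \<and> snd z > 0 \<and>
    (\<forall>x\<in>S \<inter> ball z \<rho>. norm (x - x0) \<le> 2 * R \<and> snd z / 2 < snd x \<and> snd x \<le> snd z + R \<and>
       (norm (x - x0))\<^sup>2 - (inner (x - x0) (\<nu> x))\<^sup>2 / (snd x)\<^sup>2 > R\<^sup>2 / 2) \<and>
    (\<forall>\<rho>' \<alpha>. 0 < \<rho>' \<longrightarrow> \<rho>' \<le> \<rho> \<longrightarrow> 0 < \<alpha> \<longrightarrow> barrier_touches S (- N) x0 z \<rho>' \<alpha>)"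
    by (rule strong_maximum_setup[OF S _ N' q(1) q']) (fact proper le near)+
  then obtain z x0 R \<rho> where R: "R > 0" and \<rho>: "\<rho> > 0" and z: "z \<in> S" "snd z > 0"
    and loc: "\<forall>x\<in>S \<inter> ball z \<rho>. norm (x - x0) \<le> 2 * R \<and> snd z / 2 < snd x \<and> snd x \<le> snd z + R \<and>
       (norm (x - x0))\<^sup>2 - (inner (x - x0) (\<nu> x))\<^sup>2 / (snd x)\<^sup>2 > R\<^sup>2 / 2"
    and bt: "\<forall>\<rho>' \<alpha>. 0 < \<rho>' \<longrightarrow> \<rho>' \<le> \<rho> \<longrightarrow> 0 < \<alpha> \<longrightarrow> barrier_touches S (- N) x0 z \<rho>' \<alpha>"
    by blast
  define y0 where "y0 = snd z / 2"
  define C where "C = snd z + R + 2 * R"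
  have y0: "y0 > 0" and C: "C > 0" "2 * R \<le> C" using z(2) R by (auto simp: y0_def C_def)
  (* chosen so that the gain y0 \<alpha> R\<^sup>2 exceeds the error 4 r C (n choose r) of the final estimate *)
  define \<alpha> where "\<alpha> = (4 * real r * C * ?c + 1) / (y0 * R\<^sup>2)"
  have den: "y0 * R\<^sup>2 > 0" using y0 R by simp
  have num: "4 * real r * C * ?c + 1 > 0" using C c1 by (intro add_nonneg_pos mult_nonneg_nonneg) auto
  have \<alpha>: "\<alpha> > 0" using den num by (simp add: \<alpha>_def)
  have \<alpha>eq: "\<alpha> * (y0 * R\<^sup>2) = 4 * real r * C * ?c + 1" by (rule nonzero_eq_divide_eq[THEN iffD1, OF _ \<alpha>_def]) (use den in linarith)
  obtain \<epsilon>0 where \<epsilon>0: "\<epsilon>0 > 0" and bar: "\<And>\<epsilon>. 0 < \<epsilon> \<Longrightarrow> \<epsilon> < \<epsilon>0 \<Longrightarrow>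
      (\<exists>p\<in>S \<inter> ball z \<rho>. \<forall>x\<in>S \<inter> ball z \<rho>. inner x (- N) + \<epsilon> * exp (- \<alpha> * (norm (x - x0))\<^sup>2) \<le>
         inner p (- N) + \<epsilon> * exp (- \<alpha> * (norm (p - x0))\<^sup>2))"
    using bt[rule_format, OF \<rho> order_refl \<alpha>] unfolding barrier_touches_def by blast
  (* \<epsilon> D bounds \<theta> C (4 r + 1); keeping it below snd N makes b positive
     and allows the linear upper bound for powers *)
  define D where "D = 2 * \<alpha> * (C * (4 * real r + 1))"
  have D: "D > 0" using \<alpha> C by (simp add: D_def add_nonneg_pos)
  define \<epsilon> where "\<epsilon> = min (\<epsilon>0 / 2) (snd N / (2 * D))"
  have \<epsilon>: "0 < \<epsilon>" "\<epsilon> < \<epsilon>0" using \<epsilon>0 D N by (auto simp: \<epsilon>_def)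
  have "\<epsilon> \<le> snd N / (2 * D)" by (simp add: \<epsilon>_def)
  then have \<epsilon>D: "\<epsilon> * (2 * D) \<le> snd N" using D by (simp add: pos_le_divide_eq)
  obtain p where p: "p \<in> S" "p \<in> ball z \<rho>" and pmax: "\<And>x. x \<in> S \<inter> ball z \<rho> \<Longrightarrow>
      inner x (- N) + \<epsilon> * exp (- \<alpha> * (norm (x - x0))\<^sup>2) \<le> inner p (- N) + \<epsilon> * exp (- \<alpha> * (norm (p - x0))\<^sup>2)"
    using bar[OF \<epsilon>] by blast
  have pl: "norm (p - x0) \<le> 2 * R" "y0 < snd p" "snd p \<le> snd z + R"
    "(norm (p - x0))\<^sup>2 - (inner (p - x0) (\<nu> p))\<^sup>2 / (snd p)\<^sup>2 > R\<^sup>2 / 2"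
    using loc p by (auto simp: y0_def)
  define \<theta> where "\<theta> = 2 * \<epsilon> * \<alpha> * exp (- \<alpha> * (norm (p - x0))\<^sup>2)"
  define a where "a = - N - \<theta> *\<^sub>R (p - x0)"
  have \<theta>: "0 < \<theta>" using \<epsilon> \<alpha> by (simp add: \<theta>_def)
  have "exp (- \<alpha> * (norm (p - x0))\<^sup>2) \<le> 1" using \<alpha> by simp
  then have "\<theta> \<le> 2 * \<epsilon> * \<alpha>" using \<epsilon> \<alpha> mult_left_mono[of _ 1 "2 * \<epsilon> * \<alpha>"] by (simp add: \<theta>_def)
  then have "\<theta> * (C * (4 * real r + 1)) \<le> 2 * \<epsilon> * \<alpha> * (C * (4 * real r + 1))"
    using C by (intro mult_right_mono) auto
  also have "\<dots> = \<epsilon> * D" by (simp add: D_def)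
  also have "\<dots> < \<epsilon> * (2 * D)" using \<epsilon> D by simp
  finally have \<theta>C: "\<theta> * C * (4 * real r) + \<theta> * C < snd N" using \<epsilon>D by (simp add: algebra_simps)
  note bc = barrier_curvature[OF S p(1) open_ball p(2) pmax, folded \<theta>_def, folded a_def]
  obtain v where v: "(\<Sum>i\<in>UNIV. (v i)\<^sup>2) = (norm (p - x0))\<^sup>2 - (inner (p - x0) (\<nu> p))\<^sup>2 / (snd p)\<^sup>2"
    and vi: "\<And>i. norm a * (sgn (inner a (\<nu> p)) * ?k p i) \<le>
        snd (- N) - \<theta> * snd (p - x0) - snd p * (\<theta> * (2 * \<alpha> * (v i)\<^sup>2 - 1))"
    using bc(2) by blast
  define \<Sigma>v where "\<Sigma>v = (\<Sum>i\<in>UNIV. (v i)\<^sup>2)"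
  have \<Sigma>v: "\<Sigma>v > R\<^sup>2 / 2" using pl(4) v by (simp add: \<Sigma>v_def)
  have dy: "\<bar>snd (p - x0)\<bar> \<le> 2 * R"
    using abs_snd_le_norm[of "p - x0"] pl(1) by linarith
  define s where "s = sgn (inner a (\<nu> p))"
  define b where "b = snd N - \<theta> * C"
  define c where "c = 2 * \<alpha> * y0 * \<theta>"
  have c: "c > 0" using \<alpha> y0 \<theta> by (simp add: c_def)
  have b: "b > 0" "2 * real r * (2 * (\<theta> * C)) \<le> b"
  proof -
    have "0 \<le> \<theta> * C * (4 * real r)" using \<theta> C by simp
    then show "b > 0" unfolding b_def using \<theta>C by linarith
    show "2 * real r * (2 * (\<theta> * C)) \<le> b" using \<theta>C by (simp add: b_def algebra_simps)
  qed
  define \<mu> where "\<mu> i = (- (norm a * s)) * ?k p i" for i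
  have lower: "b + c * (v i)\<^sup>2 \<le> \<mu> i" for i
  proof -
    have "snd N + \<theta> * snd (p - x0) + snd p * (\<theta> * (2 * \<alpha> * (v i)\<^sup>2 - 1)) \<le> \<mu> i"
      using vi[of i] by (simp add: \<mu>_def s_def algebra_simps)
    moreover have "\<theta> * (snd p - snd (p - x0)) \<le> \<theta> * C"
      using \<theta> dy pl(3) by (intro mult_left_mono) (auto simp: C_def)
    moreover have "c * (v i)\<^sup>2 \<le> (2 * \<alpha> * snd p * \<theta>) * (v i)\<^sup>2"
      unfolding c_def using \<alpha> \<theta> pl(2) by (intro mult_right_mono mult_left_mono) auto
    ultimately show ?thesis by (simp add: b_def algebra_simps)
  qed
  have 1: "?c * b ^ r + b ^ (r - 1) * (c * \<Sigma>v) \<le> elem_sym r \<mu>"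
    using elem_sym_lower_bound[OF r, of b "\<lambda>i. c * (v i)\<^sup>2" \<mu>] b(1) c lower
    by (simp add: \<Sigma>v_def sum_distrib_left)
  have "elem_sym r \<mu> = (- (norm a * s)) ^ r * elem_sym r (?k p)"
    unfolding \<mu>_def by (rule elem_sym_scale)
  also have "\<dots> \<le> \<bar>(- (norm a * s)) ^ r * elem_sym r (?k p)\<bar>" by simp
  also have "\<dots> = (norm a * \<bar>s\<bar>) ^ r * \<bar>elem_sym r (?k p)\<bar>" by (simp add: abs_mult power_abs)
  also have "\<dots> \<le> (norm a) ^ r * (?c * snd N ^ r)"
  proof (rule mult_mono[OF power_mono bound[OF p(1)]])
    show "norm a * \<bar>s\<bar> \<le> norm a" unfolding s_def by (simp add: abs_sgn_eq)
  qed auto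
  also have "\<dots> = ?c * (norm a * snd N) ^ r" by (simp add: power_mult_distrib)
  also have "\<dots> \<le> ?c * (b + 2 * (\<theta> * C)) ^ r"
  proof -
    have "norm a \<le> 1 + \<theta> * norm (p - x0)"
      unfolding a_def using norm_triangle_ineq4[of "- N" "\<theta> *\<^sub>R (p - x0)"] N \<theta> by simp
    also have "\<dots> \<le> 1 + \<theta> * C" using pl(1) C \<theta> by simp
    finally have "norm a * snd N \<le> (1 + \<theta> * C) * snd N" using N by (intro mult_right_mono) auto
    also have "\<dots> \<le> snd N + \<theta> * C"
    proof -
      have "snd N \<le> 1" using abs_snd_le_norm[of N] N by simp
      then have "(\<theta> * C) * snd N \<le> (\<theta> * C) * 1" using \<theta> C by (intro mult_left_mono) auto
      then show ?thesis by (simp add: algebra_simps)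
    qed
    finally have "norm a * snd N \<le> b + 2 * (\<theta> * C)" unfolding b_def by linarith
    then show ?thesis using N by (intro mult_left_mono power_mono) auto
  qed
  also have "\<dots> \<le> ?c * (b ^ r + 2 * real r * (2 * (\<theta> * C)) * b ^ (r - 1))"
    using power_add_upper_bound[OF b(1) _ b(2)] \<theta> C by (intro mult_left_mono) auto
  finally have "?c * b ^ r + b ^ (r - 1) * (c * \<Sigma>v) \<le> ?c * (b ^ r + 2 * real r * (2 * (\<theta> * C)) * b ^ (r - 1))"
    using 1 by linarith
  then have "b ^ (r - 1) * (c * \<Sigma>v) \<le> b ^ (r - 1) * (?c * (4 * real r * (\<theta> * C)))"
    by (simp add: algebra_simps)
  then have "c * \<Sigma>v \<le> ?c * (4 * real r * (\<theta> * C))" using b(1) by simp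
  then have "\<theta> * (2 * \<alpha> * y0 * \<Sigma>v) \<le> \<theta> * (4 * real r * C * ?c)" by (simp add: c_def algebra_simps)
  then have "2 * \<alpha> * y0 * \<Sigma>v \<le> 4 * real r * C * ?c" using \<theta> by simp
  moreover have "2 * \<alpha> * y0 * (R\<^sup>2 / 2) \<le> 2 * \<alpha> * y0 * \<Sigma>v" using \<alpha> y0 \<Sigma>v by (intro mult_left_mono) auto
  moreover have "2 * \<alpha> * y0 * (R\<^sup>2 / 2) = 4 * real r * C * ?c + 1" using \<alpha>eq by (simp add: algebra_simps)
  ultimately show False by linarith
qed


section \<open>A connected two-sided hypersurface separates the half-space\<close>

definition nearest_point :: "'a::metric_space set \<Rightarrow> 'a \<Rightarrow> 'a \<Rightarrow> bool"
  where "nearest_point S x q \<longleftrightarrow> q \<in> S \<and> (\<forall>k\<in>S. dist x q \<le> dist x k)"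

text \<open>
  The side of \<open>S\<close> on which \<open>x\<close> lies, read off from a nearest point of \<open>S\<close>.  It is meaningful only near \<open>S\<close>.
\<close>

definition side :: "('n::finite pt) set \<Rightarrow> ('n pt \<Rightarrow> 'n pt) \<Rightarrow> 'n pt \<Rightarrow> real"
  where "side S \<nu> x = (if \<exists>q. nearest_point S x q \<and> inner (x - q) (\<nu> q) < 0 then -1 else 1)"

lemma nonzero_on_segment_sgn:
  fixes f :: "'a::real_normed_vector \<Rightarrow> real"
  assumes cont: "continuous_on (closed_segment q x) f" and D: "(f has_derivative f') (at q)" and fq: "f q = 0"
    and nz: "\<And>s. 0 < s \<Longrightarrow> s \<le> 1 \<Longrightarrow> f (q + s *\<^sub>R (x - q)) \<noteq> 0" and d: "f' (x - q) > 0"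
  shows "f x > 0"
proof (rule ccontr)
  assume "\<not> f x > 0"
  define g where "g s = f (q + s *\<^sub>R (x - q))" for s
  have "((\<lambda>s. q + s *\<^sub>R (x - q)) has_derivative (\<lambda>h. h *\<^sub>R (x - q))) (at 0)"
    by (auto intro!: derivative_eq_intros)
  moreover have "(f has_derivative f') (at (q + 0 *\<^sub>R (x - q)))" using D by simp
  ultimately have "(g has_derivative (\<lambda>h. f' (h *\<^sub>R (x - q)))) (at 0)"
    unfolding g_def by (rule has_derivative_compose)
  then have "DERIV g 0 :> f' (x - q)"
    using linear_cmul[OF has_derivative_linear[OF D]] by (simp add: has_field_derivative_def mult_commute_abs)
  from DERIV_pos_inc_right[OF this d] obtain e where e: "e > 0" "\<And>h. h > 0 \<Longrightarrow> h < e \<Longrightarrow> g 0 < g h" by auto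
  define s where "s = min 1 e / 2"
  have s: "0 < s" "s < e" "s \<le> 1" using e(1) by (auto simp: s_def)
  have gs: "g s > 0" using e(2)[OF s(1,2)] fq by (simp add: g_def)
  have "continuous_on {s..1} g"
    unfolding g_def
  proof (rule continuous_on_compose2[OF cont])
    show "(\<lambda>t. q + t *\<^sub>R (x - q)) ` {s..1} \<subseteq> closed_segment q x"
    proof
      fix y assume "y \<in> (\<lambda>t. q + t *\<^sub>R (x - q)) ` {s..1}"
      then obtain t where t: "t \<in> {s..1}" "y = q + t *\<^sub>R (x - q)" by blast
      then show "y \<in> closed_segment q x" using s
        unfolding closed_segment_def by (intro CollectI exI[of _ t]) (auto simp: algebra_simps)
    qed
  qed (intro continuous_intros)
  moreover have "g 1 \<le> 0" using \<open>\<not> f x > 0\<close> by (simp add: g_def)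
  ultimately obtain t where "s \<le> t" "t \<le> 1" "g t = 0"
    using IVT2'[of g 1 0 s] gs s by auto
  then show False using nz[of t] s by (simp add: g_def)
qed

text \<open>
  If \<open>q\<close> is a point of \<open>S\<close> nearest to \<open>x\<close>, then \<open>x - q\<close> is a multiple of \<open>\<nu> q\<close>, and the segment from \<open>q\<close> to \<open>x\<close> meets \<open>S\<close> only in \<open>q\<close>.
  So the defining function \<open>f\<close> of a chart has no zero on the rest of the segment, and its sign at \<open>x\<close> is the one with which it
  leaves \<open>q\<close>.  Thus near \<open>S\<close> the globally defined \<open>side\<close> agrees with the sign of the local \<open>f\<close>.
\<close>

lemma side_near_hypersurface:
  fixes S :: "('n::finite pt) set"
  assumes S: "C2_hypersurface S" "unit_normal_field S \<nu>"
    and proper: "\<And>K. compact K \<Longrightarrow> K \<subseteq> halfspace \<Longrightarrow> compact (S \<inter> K)" and q0: "q0 \<in> S"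
  shows "\<exists>\<delta> f. \<delta> > 0 \<and> ball q0 \<delta> \<subseteq> halfspace \<and> continuous_on (ball q0 \<delta>) f \<and>
    (\<forall>x\<in>ball q0 \<delta> - S. f x \<noteq> 0 \<and> side S \<nu> x = sgn (f x)) \<and> (\<forall>x\<in>ball q0 \<delta> \<inter> S. f x = 0) \<and>
    (\<exists>\<eta>>0. \<forall>\<tau>. 0 < \<tau> \<and> \<tau> < \<eta> \<longrightarrow> f (q0 + \<tau> *\<^sub>R \<nu> q0) > 0 \<and> f (q0 - \<tau> *\<^sub>R \<nu> q0) < 0)"
proof -
  obtain U f G G' where U: "q0 \<in> U" "oriented_chart S \<nu> U f G G'"
    using oriented_chart_exists[OF S(1) q0 S(2)] by (elim exE conjE) (rule that)
  have ch: "chart S U f G G'" and nu: "\<And>x. x \<in> S \<inter> U \<Longrightarrow> \<nu> x = (snd x / norm (G x)) *\<^sub>R G x"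
    using U(2) unfolding oriented_chart_def by auto
  have open_U: "open U" and UH: "U \<subseteq> halfspace" and Df: "\<And>x. x \<in> U \<Longrightarrow> (f has_derivative (\<lambda>v. inner (G x) v)) (at x)"
    and Gnz: "\<And>x. x \<in> U \<Longrightarrow> G x \<noteq> 0" and SU: "S \<inter> U = {x \<in> U. f x = 0}"
    using ch unfolding chart_def by auto
  have cf: "continuous_on U f"
    using Df by (meson continuous_at_imp_continuous_on has_derivative_continuous)
  have nuG: "inner (G x) (\<nu> x) > 0" if "x \<in> S" "x \<in> U" for x
  proof -
    have "snd x > 0" using that UH by (auto simp: halfspace_def)
    then show ?thesis using nu[of x] that Gnz[of x] by simp
  qed
  obtain d where d: "d > 0" "cball q0 d \<subseteq> U" using open_U U(1) open_contains_cball by blast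
  define \<delta> where "\<delta> = d / 3"
  have \<delta>: "\<delta> > 0" "cball q0 (2 * \<delta>) \<subseteq> U"
  proof -
    have "cball q0 (2 * \<delta>) \<subseteq> cball q0 d" using d(1) by (intro subset_cball) (simp add: \<delta>_def)
    then show "\<delta> > 0" "cball q0 (2 * \<delta>) \<subseteq> U" using d by (auto simp: \<delta>_def)
  qed
  have bU: "ball q0 \<delta> \<subseteq> U" using \<delta> by (auto simp: subset_iff)
  have sgn_side: "f x \<noteq> 0 \<and> side S \<nu> x = sgn (f x)" if x: "x \<in> ball q0 \<delta> - S" for x
  proof -
    have fx: "f x \<noteq> 0" using x bU SU by blast
    have near: "q \<in> cball q0 (2 * \<delta>)" if "nearest_point S x q" for q
    proof -
      have "dist x q \<le> dist x q0" using that q0 unfolding nearest_point_def by blast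
      moreover have "dist q0 x < \<delta>" using x by simp
      ultimately have "dist q0 q \<le> 2 * \<delta>" using dist_triangle[of q0 q x] by (simp add: dist_commute)
      then show ?thesis by simp
    qed
    have cmp: "compact (S \<inter> cball q0 (2 * \<delta>))" using \<delta>(2) UH by (intro proper) auto
    have "q0 \<in> S \<inter> cball q0 (2 * \<delta>)" using q0 \<delta>(1) by simp
    then have "\<exists>q\<in>S \<inter> cball q0 (2 * \<delta>). \<forall>k\<in>S \<inter> cball q0 (2 * \<delta>). dist x q \<le> dist x k"
      by (intro continuous_attains_inf[OF cmp] continuous_intros) auto
    then obtain q1 where q1: "q1 \<in> S \<inter> cball q0 (2 * \<delta>)" "\<And>k. k \<in> S \<inter> cball q0 (2 * \<delta>) \<Longrightarrow> dist x q1 \<le> dist x k"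
      by blast
    have ex: "nearest_point S x q1"
      unfolding nearest_point_def
    proof (intro conjI ballI)
      fix k assume k: "k \<in> S"
      show "dist x q1 \<le> dist x k"
      proof (cases "k \<in> cball q0 (2 * \<delta>)")
        case False
        then have "2 * \<delta> < dist q0 k" by simp
        moreover have "dist q0 k \<le> dist q0 x + dist x k" by (rule dist_triangle)
        moreover have "dist q0 x < \<delta>" using x by simp
        moreover have "dist x q1 \<le> dist x q0" using q1(2)[of q0] q0 \<delta>(1) by simp
        ultimately show ?thesis by (simp add: dist_commute)
      qed (use k q1(2) in blast)
    qed (use q1 in blast)
    have key: "inner (x - q) (\<nu> q) \<noteq> 0 \<and> sgn (f x) = sgn (inner (x - q) (\<nu> q))" if n: "nearest_point S x q" for q
    proof -
      have qS: "q \<in> S" and qmin: "\<And>k. k \<in> S \<Longrightarrow> dist x q \<le> dist x k" using n unfolding nearest_point_def by auto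
      have qc: "q \<in> cball q0 (2 * \<delta>)" by (rule near[OF n])
      have qU: "q \<in> U" using qc \<delta>(2) by blast
      have xc: "x \<in> cball q0 (2 * \<delta>)" using x \<delta>(1) by simp
      have "((\<lambda>k. - inner (k - x) (k - x)) has_derivative (\<lambda>v. inner (2 *\<^sub>R (x - q)) v)) (at q)"
        by (auto intro!: derivative_eq_intros simp: inner_commute algebra_simps inner_diff_left)
      moreover have "- inner (k - x) (k - x) \<le> - inner (q - x) (q - x)" if "k \<in> S \<inter> UNIV" for k
      proof -
        have "norm (q - x) \<le> norm (k - x)" using qmin[of k] that by (simp add: dist_norm norm_minus_commute)
        then have "(norm (q - x))\<^sup>2 \<le> (norm (k - x))\<^sup>2" by (intro power_mono) auto
        then show ?thesis by (simp add: power2_norm_eq_inner)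
      qed
      ultimately obtain c where c: "2 *\<^sub>R (x - q) = c *\<^sub>R \<nu> q"
        using gradient_parallel_normal_at_max[OF S qS open_UNIV UNIV_I, of "\<lambda>k. - inner (k - x) (k - x)"] by blast
      have xq: "x - q = (c / 2) *\<^sub>R \<nu> q"
      proof -
        have "x - q = (1/2) *\<^sub>R (2 *\<^sub>R (x - q))" by simp
        also have "\<dots> = (1/2) *\<^sub>R (c *\<^sub>R \<nu> q)" by (simp only: c)
        finally show ?thesis by simp
      qed
      have "x \<noteq> q" using x qS by blast
      then have c0: "c \<noteq> 0" and nz: "\<nu> q \<noteq> 0" using xq by auto
      have i1: "inner (x - q) (\<nu> q) = (c / 2) * inner (\<nu> q) (\<nu> q)" by (simp add: xq)
      have i2: "inner (G q) (x - q) = (c / 2) * inner (G q) (\<nu> q)" by (simp add: xq)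
      have seg: "f (q + s *\<^sub>R (x - q)) \<noteq> 0" if s: "0 < s" "s \<le> 1" for s
      proof
        assume f0: "f (q + s *\<^sub>R (x - q)) = 0"
        have "q + s *\<^sub>R (x - q) = (1 - s) *\<^sub>R q + s *\<^sub>R x" by (simp add: algebra_simps)
        also have "\<dots> \<in> cball q0 (2 * \<delta>)" using convexD_alt[OF convex_cball qc xc, of s] s by simp
        finally have "q + s *\<^sub>R (x - q) \<in> S" using f0 SU \<delta>(2) by blast
        from qmin[OF this] have "norm (x - q) \<le> norm (x - (q + s *\<^sub>R (x - q)))" by (simp add: dist_norm)
        also have "x - (q + s *\<^sub>R (x - q)) = (1 - s) *\<^sub>R (x - q)" by (simp add: algebra_simps)
        finally have "norm (x - q) \<le> (1 - s) * norm (x - q)" using s by simp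
        then show False using s \<open>x \<noteq> q\<close> by (simp add: algebra_simps mult_le_0_iff)
      qed
      have csub: "closed_segment q x \<subseteq> U"
        using closed_segment_subset[OF qc xc convex_cball] \<delta>(2) by blast
      have cfs: "continuous_on (closed_segment q x) f" using continuous_on_subset[OF cf csub] .
      have fq: "f q = 0" using SU qS qU by blast
      show ?thesis
      proof (cases "c > 0")
        case True
        have "0 < (c / 2) * inner (G q) (\<nu> q)" using nuG[OF qS qU] True by simp
        then have "inner (G q) (x - q) > 0" by (simp only: i2)
        then have "f x > 0"
          by (intro nonzero_on_segment_sgn[OF cfs Df[OF qU] fq seg])
        then show ?thesis unfolding i1 using nz True by (simp add: sgn_mult)
      next
        case False
        then have neg: "c < 0" using c0 by simp
        have "- f x > 0"
        proof (rule nonzero_on_segment_sgn[of q x "\<lambda>x. - f x" "\<lambda>v. - inner (G q) v"])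
          show "continuous_on (closed_segment q x) (\<lambda>x. - f x)" by (intro continuous_intros cfs)
          show "((\<lambda>x. - f x) has_derivative (\<lambda>v. - inner (G q) v)) (at q)" by (intro derivative_intros Df[OF qU])
          have "(c / 2) * inner (G q) (\<nu> q) < 0" by (intro mult_neg_pos) (use nuG[OF qS qU] neg in auto)
          then show "0 < - inner (G q) (x - q)" by (simp only: i2 neg_0_less_iff_less)
        qed (use fq seg in auto)
        then show ?thesis unfolding i1 using nz neg by (simp add: sgn_mult)
      qed
    qed
    have "side S \<nu> x = sgn (f x)"
    proof (cases "f x < 0")
      case True
      then have "inner (x - q1) (\<nu> q1) < 0" using key[OF ex] by (simp add: sgn_1_neg sgn_if split: if_splits)
      then have "\<exists>q. nearest_point S x q \<and> inner (x - q) (\<nu> q) < 0" using ex by blast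
      then have "side S \<nu> x = -1" unfolding side_def by (simp only: if_True)
      then show ?thesis using True by simp
    next
      case False
      then have pos: "f x > 0" using fx by simp
      have "\<not> (\<exists>q. nearest_point S x q \<and> inner (x - q) (\<nu> q) < 0)"
      proof
        assume "\<exists>q. nearest_point S x q \<and> inner (x - q) (\<nu> q) < 0"
        then obtain q where q: "nearest_point S x q" "inner (x - q) (\<nu> q) < 0" by blast
        then show False using key[OF q(1)] pos by simp
      qed
      then show ?thesis using pos unfolding side_def by simp
    qed
    then show ?thesis using fx by blast
  qed
  have cross: "\<exists>\<eta>>0. \<forall>\<tau>. 0 < \<tau> \<and> \<tau> < \<eta> \<longrightarrow> f (q0 + \<tau> *\<^sub>R \<nu> q0) > 0 \<and> f (q0 - \<tau> *\<^sub>R \<nu> q0) < 0"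
  proof -
    have f0: "f q0 = 0" using SU q0 U(1) by blast
    have "((\<lambda>s. q0 + s *\<^sub>R \<nu> q0) has_derivative (\<lambda>h. h *\<^sub>R \<nu> q0)) (at 0)"
      by (auto intro!: derivative_eq_intros)
    moreover have "(f has_derivative (\<lambda>v. inner (G q0) v)) (at (q0 + 0 *\<^sub>R \<nu> q0))" using Df[OF U(1)] by simp
    ultimately have "((\<lambda>s. f (q0 + s *\<^sub>R \<nu> q0)) has_derivative (\<lambda>h. inner (G q0) (h *\<^sub>R \<nu> q0))) (at 0)"
      by (rule has_derivative_compose)
    then have der: "DERIV (\<lambda>s. f (q0 + s *\<^sub>R \<nu> q0)) 0 :> inner (G q0) (\<nu> q0)"
      by (simp add: has_field_derivative_def mult_commute_abs)
    obtain e1 where e1: "e1 > 0" "\<And>h. h > 0 \<Longrightarrow> h < e1 \<Longrightarrow> f q0 < f (q0 + h *\<^sub>R \<nu> q0)"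
      using DERIV_pos_inc_right[OF der nuG[OF q0 U(1)]] by auto
    obtain e2 where e2: "e2 > 0" "\<And>h. h > 0 \<Longrightarrow> h < e2 \<Longrightarrow> f (q0 - h *\<^sub>R \<nu> q0) < f q0"
      using DERIV_pos_inc_left[OF der nuG[OF q0 U(1)]] by auto
    show ?thesis
      by (rule exI[of _ "min e1 e2"]) (use e1 e2 f0 in auto)
  qed
  have "\<forall>x\<in>ball q0 \<delta> \<inter> S. f x = 0" using SU bU by blast
  then show ?thesis
    by (intro exI[of _ \<delta>] exI[of _ f])
      (use \<delta>(1) bU UH continuous_on_subset[OF cf bU] sgn_side cross in auto)
qed

lemma open_halfspace: "open (halfspace :: ('n::finite pt) set)"
  unfolding halfspace_def by (intro open_Collect_less continuous_intros)

lemma convex_halfspace: "convex (halfspace :: ('n::finite pt) set)"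
proof -
  have "halfspace = {p :: 'n pt. inner (0, 1) p > 0}" by (auto simp: halfspace_def)
  then show ?thesis using convex_halfspace_gt by metis
qed

lemma infdist_pos_halfspace:
  fixes S :: "('n::finite pt) set"
  assumes proper: "\<And>K. compact K \<Longrightarrow> K \<subseteq> halfspace \<Longrightarrow> compact (S \<inter> K)" and "S \<noteq> {}"
    and x: "x \<in> halfspace" "x \<notin> S"
  shows "infdist x S > 0"
proof -
  obtain r where r: "r > 0" "cball x r \<subseteq> halfspace" using open_halfspace x(1) open_contains_cball by blast
  have "closed (S \<inter> cball x r)" using proper[OF compact_cball r(2)] compact_imp_closed by blast
  then have "open (- (S \<inter> cball x r) \<inter> ball x r)" by (intro open_Int open_Compl open_ball)
  moreover have "x \<in> - (S \<inter> cball x r) \<inter> ball x r" using x r by auto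
  ultimately obtain e where e: "e > 0" "ball x e \<subseteq> - (S \<inter> cball x r) \<inter> ball x r" using open_contains_ball by blast
  have "x \<notin> closure S"
  proof
    assume "x \<in> closure S"
    then obtain y where y: "y \<in> S" "dist y x < e" using e(1) closure_approachable by blast
    then have "y \<in> ball x e" by (simp add: dist_commute)
    then have "y \<in> - (S \<inter> cball x r) \<inter> ball x r" using e(2) by blast
    then show False using y(1) by auto
  qed
  then show ?thesis using \<open>S \<noteq> {}\<close> in_closure_iff_infdist_zero[of S x] infdist_nonneg[of x S] by auto
qed

text \<open>
  A Pontryagin--Thom construction: \<open>t\<close> grows from \<open>0\<close> on \<open>S\<close> to \<open>1\<close> outside a neighbourhood \<open>W\<close> of \<open>S\<close>, and
  \<open>\<phi> = exp (\<plusminus> i \<pi> t)\<close>, with the sign given by the side of \<open>S\<close>, is a continuous map into the unit circle, because both signs agree where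
  \<open>t = 0\<close> or \<open>t = 1\<close>.  The half-space is contractible, so \<open>\<phi>\<close> lifts to a real function, which is constant on the
  connected set \<open>S\<close>; after subtracting this constant it vanishes exactly on \<open>S\<close> and changes sign across \<open>S\<close>.
\<close>

theorem separating_function:
  fixes S :: "('n::finite pt) set"
  assumes S: "C2_hypersurface S" "unit_normal_field S \<nu>"
    and proper: "\<And>K. compact K \<Longrightarrow> K \<subseteq> halfspace \<Longrightarrow> compact (S \<inter> K)" and con: "connected S" "S \<noteq> {}"
  shows "\<exists>\<theta> :: 'n pt \<Rightarrow> real. continuous_on halfspace \<theta> \<and> (\<forall>x\<in>halfspace - S. \<theta> x \<noteq> 0) \<and>
    (\<forall>p\<in>S. \<exists>\<eta>>0. \<forall>\<tau>. 0 < \<tau> \<and> \<tau> < \<eta> \<longrightarrow> \<theta> (p + \<tau> *\<^sub>R \<nu> p) > 0 \<and> \<theta> (p - \<tau> *\<^sub>R \<nu> p) < 0)"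
proof -
  let ?H = "halfspace :: 'n pt set"
  have SH: "S \<subseteq> ?H" using S(1) unfolding C2_hypersurface_def by blast
  have "\<forall>q\<in>S. \<exists>\<delta>. \<exists>f. \<delta> > 0 \<and> ball q \<delta> \<subseteq> halfspace \<and> continuous_on (ball q \<delta>) f \<and>
    (\<forall>x\<in>ball q \<delta> - S. f x \<noteq> 0 \<and> side S \<nu> x = sgn (f x)) \<and> (\<forall>x\<in>ball q \<delta> \<inter> S. f x = 0) \<and>
    (\<exists>\<eta>>0. \<forall>\<tau>. 0 < \<tau> \<and> \<tau> < \<eta> \<longrightarrow> f (q + \<tau> *\<^sub>R \<nu> q) > 0 \<and> f (q - \<tau> *\<^sub>R \<nu> q) < 0)"
    using side_near_hypersurface[OF S _] proper by blast
  from bchoice[OF this] obtain \<delta> where "\<forall>q\<in>S. \<exists>f. \<delta> q > 0 \<and> ball q (\<delta> q) \<subseteq> halfspace \<and> continuous_on (ball q (\<delta> q)) f \<and>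
    (\<forall>x\<in>ball q (\<delta> q) - S. f x \<noteq> 0 \<and> side S \<nu> x = sgn (f x)) \<and> (\<forall>x\<in>ball q (\<delta> q) \<inter> S. f x = 0) \<and>
    (\<exists>\<eta>>0. \<forall>\<tau>. 0 < \<tau> \<and> \<tau> < \<eta> \<longrightarrow> f (q + \<tau> *\<^sub>R \<nu> q) > 0 \<and> f (q - \<tau> *\<^sub>R \<nu> q) < 0)" ..
  note this = bchoice[OF this]
  then obtain F where "\<forall>q\<in>S. \<delta> q > 0 \<and> ball q (\<delta> q) \<subseteq> halfspace \<and> continuous_on (ball q (\<delta> q)) (F q) \<and>
    (\<forall>x\<in>ball q (\<delta> q) - S. F q x \<noteq> 0 \<and> side S \<nu> x = sgn (F q x)) \<and> (\<forall>x\<in>ball q (\<delta> q) \<inter> S. F q x = 0) \<and>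
    (\<exists>\<eta>>0. \<forall>\<tau>. 0 < \<tau> \<and> \<tau> < \<eta> \<longrightarrow> F q (q + \<tau> *\<^sub>R \<nu> q) > 0 \<and> F q (q - \<tau> *\<^sub>R \<nu> q) < 0)" ..
  then have \<delta>: "\<And>q. q \<in> S \<Longrightarrow> \<delta> q > 0" "\<And>q. q \<in> S \<Longrightarrow> ball q (\<delta> q) \<subseteq> ?H"
    and F: "\<And>q. q \<in> S \<Longrightarrow> continuous_on (ball q (\<delta> q)) (F q)"
      "\<And>q x. q \<in> S \<Longrightarrow> x \<in> ball q (\<delta> q) - S \<Longrightarrow> F q x \<noteq> 0 \<and> side S \<nu> x = sgn (F q x)"
      "\<And>q x. q \<in> S \<Longrightarrow> x \<in> ball q (\<delta> q) \<inter> S \<Longrightarrow> F q x = 0"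
    and cross: "\<And>q. q \<in> S \<Longrightarrow> \<exists>\<eta>>0. \<forall>\<tau>. 0 < \<tau> \<and> \<tau> < \<eta> \<longrightarrow> F q (q + \<tau> *\<^sub>R \<nu> q) > 0 \<and> F q (q - \<tau> *\<^sub>R \<nu> q) < 0"
    by auto
  define W where "W = (\<Union>q\<in>S. ball q (\<delta> q))"
  have W: "open W" "W \<subseteq> ?H" "S \<subseteq> W"
  proof -
    show "open W" by (auto simp: W_def)
    show "W \<subseteq> ?H" unfolding W_def using \<delta>(2) by (rule UN_least)
    show "S \<subseteq> W" unfolding W_def using \<delta>(1) centre_in_ball by blast
  qed
  have "(0 :: 'n pt) \<notin> W" using W(2) by (auto simp: halfspace_def)
  then have cW: "closed (- W)" "- W \<noteq> {}" using W(1) by auto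
  define d1 where "d1 x = infdist x S" for x
  define d2 where "d2 x = infdist x (- W)" for x
  have d1: "d1 x \<ge> 0" "x \<in> S \<Longrightarrow> d1 x = 0" "x \<in> ?H \<Longrightarrow> x \<notin> S \<Longrightarrow> d1 x > 0" for x
    using infdist_pos_halfspace[OF proper con(2), of x] by (auto simp: d1_def infdist_nonneg)
  have d2: "d2 x \<ge> 0" "x \<notin> W \<Longrightarrow> d2 x = 0" "x \<in> W \<Longrightarrow> d2 x > 0" for x
    using in_closed_iff_infdist_zero[OF cW, of x] infdist_nonneg[of x "- W"] by (auto simp: d2_def less_le)
  have den: "d1 x + d2 x > 0" if "x \<in> ?H" for x
    using d1[of x] d2[of x] that W(3) by (cases "x \<in> S") (auto intro: add_pos_nonneg add_nonneg_pos)
  define t where "t x = d1 x / (d1 x + d2 x)" for x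
  have t01: "0 \<le> t x" "t x \<le> 1" if "x \<in> ?H" for x
    using den[OF that] d1(1)[of x] d2(1)[of x] by (auto simp: t_def)
  have tS: "t x = 0" if "x \<in> S" for x using d1(2)[OF that] by (simp add: t_def)
  have tpos: "t x > 0" if "x \<in> ?H" "x \<notin> S" for x using den[OF that(1)] d1(3)[OF that] by (simp add: t_def)
  have tW: "t x < 1" if "x \<in> W" for x
    using den[of x] d2(3)[OF that] that W(2) by (auto simp: t_def)
  have tout: "t x = 1" if "x \<in> ?H" "x \<notin> W" for x using den[OF that(1)] d2(2)[OF that(2)] by (simp add: t_def)
  have ct: "continuous_on ?H t"
  proof -
    have "continuous_on ?H d1" "continuous_on ?H d2" unfolding d1_def d2_def by (intro continuous_intros)+
    moreover have "d1 x + d2 x \<noteq> 0" if "x \<in> ?H" for x using den[OF that] by simp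
    ultimately show ?thesis unfolding t_def by (intro continuous_on_divide continuous_on_add ballI)
  qed
  define g where "g x = side S \<nu> x * sin (pi * t x)" for x
  have side1: "\<bar>side S \<nu> x\<bar> = 1" for x by (simp add: side_def)
  have csin: "continuous_on ?H (\<lambda>x. sin (pi * t x))" by (intro continuous_intros ct)
  have cg: "continuous_on ?H g"
  proof -
    have "isCont g x" if x: "x \<in> ?H" for x
    proof (cases "x \<in> W - S")
      case True
      then obtain q where q: "q \<in> S" "x \<in> ball q (\<delta> q)" by (auto simp: W_def)
      have "0 < infdist x S" using d1(3)[OF x] True by (simp add: d1_def)
      have openV: "open (ball q (\<delta> q) \<inter> - closure S)" by (intro open_Int open_ball) auto
      have xV: "x \<in> ball q (\<delta> q) \<inter> - closure S"
        using q \<open>0 < infdist x S\<close> in_closure_iff_infdist_zero[OF con(2), of x] by auto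
      have Fx: "F q x \<noteq> 0" using F(2)[OF q(1), of x] q True by blast
      have "isCont (F q) x" using F(1)[OF q(1)] q(2) by (simp add: continuous_on_eq_continuous_at)
      then have "((\<lambda>y. sgn (F q y)) \<longlongrightarrow> sgn (F q x)) (at x)" using Fx by (intro tendsto_sgn) (auto simp: isCont_def)
      then have c1: "isCont (\<lambda>y. sgn (F q y)) x" by (simp add: isCont_def)
      have c2: "isCont (\<lambda>y. sin (pi * t y)) x"
        using csin x unfolding continuous_on_eq_continuous_at[OF open_halfspace] by (rule bspec)
      have "isCont (\<lambda>y. sgn (F q y) * sin (pi * t y)) x" by (rule isCont_mult[OF c1 c2])
      moreover have "eventually (\<lambda>y. sgn (F q y) * sin (pi * t y) = g y) (nhds x)"
        using eventually_nhds_in_open[OF openV xV]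
      proof eventually_elim
        case (elim y)
        then have "y \<in> ball q (\<delta> q) - S" using closure_subset by blast
        then show ?case using F(2)[OF q(1), of y] by (simp add: g_def)
      qed
      ultimately show ?thesis by (subst (asm) isCont_cong)
    next
      case False
      then have s0: "sin (pi * t x) = 0" using tS[of x] tout[OF x] by (cases "x \<in> S") auto
      have "isCont (\<lambda>y. sin (pi * t y)) x"
        using csin x unfolding continuous_on_eq_continuous_at[OF open_halfspace] by (rule bspec)
      then have "((\<lambda>y. sin (pi * t y)) \<longlongrightarrow> 0) (at x)" using s0 by (simp add: isCont_def)
      then have "((\<lambda>y. \<bar>sin (pi * t y)\<bar>) \<longlongrightarrow> 0) (at x)" by (rule tendsto_rabs_zero)
      moreover have "\<bar>sin (pi * t y)\<bar> = \<bar>g y\<bar>" for y by (simp add: g_def abs_mult side1)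
      ultimately have "(g \<longlongrightarrow> 0) (at x)" by (simp add: tendsto_rabs_zero_iff)
      then show ?thesis using s0 by (simp add: isCont_def g_def)
    qed
    then show ?thesis by (intro continuous_at_imp_continuous_on) blast
  qed
  (* exp (i \<pi> t) on one side of S and its complex conjugate on the other *)
  define \<phi> where "\<phi> x = Complex (cos (pi * t x)) (g x)" for x
  have c\<phi>: "continuous_on ?H \<phi>"
    unfolding \<phi>_def complex_eq by (intro continuous_intros ct cg)
  have n\<phi>: "norm (\<phi> x) = 1" for x
  proof -
    have "(side S \<nu> x)\<^sup>2 = 1" using side1[of x] by (metis one_power2 power2_abs)
    then show ?thesis by (simp add: \<phi>_def cmod_def g_def power_mult_distrib)
  qed
  have "contractible ?H" using convex_halfspace convex_imp_contractible by blast
  moreover have "\<phi> x \<noteq> 0" for x using n\<phi>[of x] by auto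
  ultimately obtain L where L: "continuous_on ?H L" "\<And>x. x \<in> ?H \<Longrightarrow> \<phi> x = exp (L x)"
    using continuous_logarithm_on_contractible[OF c\<phi>] by metis
  define \<theta>0 where "\<theta>0 x = Im (L x)" for x
  have c\<theta>0: "continuous_on ?H \<theta>0" unfolding \<theta>0_def by (intro continuous_intros L)
  have cs: "cos (\<theta>0 x) = cos (pi * t x)" "sin (\<theta>0 x) = g x" if "x \<in> ?H" for x
  proof -
    have "exp (Re (L x)) = 1" using n\<phi>[of x] L(2)[OF that] by (metis norm_exp_eq_Re)
    then have "exp (L x) = Complex (cos (\<theta>0 x)) (sin (\<theta>0 x))"
      by (simp add: complex_eq_iff Re_exp Im_exp \<theta>0_def)
    then show "cos (\<theta>0 x) = cos (pi * t x)" "sin (\<theta>0 x) = g x"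
      using L(2)[OF that] by (auto simp: \<phi>_def)
  qed
  have "\<theta>0 constant_on S"
  proof (rule continuous_discrete_range_constant[OF con(1)])
    show "continuous_on S \<theta>0" using c\<theta>0 SH continuous_on_subset by blast
    have z: "\<exists>k::int. \<theta>0 x = k * (2 * pi)" if "x \<in> S" for x
    proof -
      have "cos (\<theta>0 x) = 1" using cs(1)[of x] that SH tS[OF that] by auto
      then show ?thesis using cos_one_2pi_int by (metis mult.commute mult.left_commute)
    qed
    fix x assume x: "x \<in> S"
    (* on S the lift takes values in the multiples of 2 \<pi> *)
    show "\<exists>e>0. \<forall>y. y \<in> S \<and> \<theta>0 y \<noteq> \<theta>0 x \<longrightarrow> e \<le> norm (\<theta>0 y - \<theta>0 x)"
    proof (intro exI[of _ "2 * pi"] conjI allI impI)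
      fix y assume y: "y \<in> S \<and> \<theta>0 y \<noteq> \<theta>0 x"
      obtain k l :: int where kl: "\<theta>0 x = k * (2 * pi)" "\<theta>0 y = l * (2 * pi)" using z x y by metis
      then have "l \<noteq> k" using y by auto
      then have "1 \<le> \<bar>real_of_int (l - k)\<bar>" by linarith
      then have "1 * (2 * pi) \<le> \<bar>real_of_int (l - k)\<bar> * (2 * pi)" by (intro mult_right_mono) auto
      also have "\<dots> = norm (\<theta>0 y - \<theta>0 x)" by (simp add: kl abs_mult flip: left_diff_distrib)
      finally show "2 * pi \<le> norm (\<theta>0 y - \<theta>0 x)" by simp
    qed simp
  qed
  then obtain c where c: "\<And>x. x \<in> S \<Longrightarrow> \<theta>0 x = c" unfolding constant_on_def by blast
  obtain s where s: "s \<in> S" using con(2) by blast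
  have cc: "cos c = 1" "sin c = 0"
    using cs[of s] c[OF s] s SH tS[OF s] by (auto simp: g_def)
  define \<theta> where "\<theta> x = \<theta>0 x - c" for x
  have c\<theta>: "continuous_on ?H \<theta>" unfolding \<theta>_def by (intro continuous_intros c\<theta>0)
  have cs': "cos (\<theta> x) = cos (pi * t x)" "sin (\<theta> x) = g x" if "x \<in> ?H" for x
    using cs[OF that] cc by (simp_all add: \<theta>_def cos_diff sin_diff)
  have nz: "\<theta> x \<noteq> 0" if "x \<in> ?H" "x \<notin> S" for x
  proof
    assume "\<theta> x = 0"
    then have "cos (pi * t x) = 1" using cs'(1)[OF that(1)] by simp
    moreover have "0 < pi * t x" "pi * t x \<le> pi" using tpos[OF that] t01[OF that(1)] by simp_all
    ultimately show False using cos_monotone_0_pi[of 0 "pi * t x"] by simp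
  qed
  have sign: "\<exists>\<eta>>0. \<forall>\<tau>. 0 < \<tau> \<and> \<tau> < \<eta> \<longrightarrow> \<theta> (p + \<tau> *\<^sub>R \<nu> p) > 0 \<and> \<theta> (p - \<tau> *\<^sub>R \<nu> p) < 0" if p: "p \<in> S" for p
  proof -
    have \<theta>p: "\<theta> p = 0" using c[OF p] by (simp add: \<theta>_def)
    have "isCont \<theta> p" using c\<theta> p SH open_halfspace continuous_on_eq_continuous_at by blast
    then obtain e where e: "e > 0" "\<And>y. dist y p < e \<Longrightarrow> dist (\<theta> y) (\<theta> p) < pi"
      unfolding continuous_at_eps_delta using pi_gt_zero by blast
    obtain \<eta>1 where \<eta>1: "\<eta>1 > 0" "\<And>\<tau>. 0 < \<tau> \<and> \<tau> < \<eta>1 \<Longrightarrow> F p (p + \<tau> *\<^sub>R \<nu> p) > 0 \<and> F p (p - \<tau> *\<^sub>R \<nu> p) < 0"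
      using cross[OF p] by blast
    define m where "m = min e (\<delta> p)"
    have m: "m > 0" using e \<delta>(1)[OF p] by (simp add: m_def)
    define \<eta> where "\<eta> = min \<eta>1 (m / (norm (\<nu> p) + 1))"
    have np: "norm (\<nu> p) + 1 > 0" by (simp add: add_nonneg_pos)
    have \<eta>: "\<eta> > 0" using \<eta>1 m np by (simp add: \<eta>_def)
    have sg: "sgn (\<theta> y) = sgn (F p y)" if y: "dist y p < m" "F p y \<noteq> 0" "y \<notin> S" for y
    proof -
      have yb: "y \<in> ball p (\<delta> p)" using y(1) by (simp add: m_def dist_commute)
      then have yW: "y \<in> W" using p by (auto simp: W_def)
      then have yH: "y \<in> ?H" using W by blast
      have "0 < pi * t y" "pi * t y < pi" using tpos[OF yH y(3)] tW[OF yW] by simp_all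
      then have sp: "sin (pi * t y) > 0" by (rule sin_gt_zero)
      have "\<bar>\<theta> y\<bar> < pi" using e(2)[of y] y(1) \<theta>p by (simp add: m_def dist_real_def)
      have "sin (\<theta> y) = sgn (F p y) * sin (pi * t y)"
        using cs'(2)[OF yH] F(2)[OF p, of y] yb y(3) by (simp add: g_def)
      show ?thesis
      proof (cases "F p y > 0")
        case True
        then have "sin (\<theta> y) > 0" using \<open>sin (\<theta> y) = _\<close> sp by simp
        then have "\<theta> y > 0" using \<open>\<bar>\<theta> y\<bar> < pi\<close> sin_ge_zero[of "- \<theta> y"] by (cases "\<theta> y > 0") auto
        then show ?thesis using True by simp
      next
        case False
        then have "sin (\<theta> y) < 0" using \<open>sin (\<theta> y) = _\<close> sp y(2) by simp
        then have "\<theta> y < 0" using \<open>\<bar>\<theta> y\<bar> < pi\<close> sin_ge_zero[of "\<theta> y"] by (cases "\<theta> y < 0") auto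
        then show ?thesis using False y(2) by simp
      qed
    qed
    have FS: "y \<notin> S" if "dist y p < m" "F p y \<noteq> 0" for y
      using F(3)[OF p, of y] that by (auto simp: m_def dist_commute)
    show ?thesis
    proof (intro exI[of _ \<eta>] conjI \<eta> allI impI)
      fix \<tau> assume \<tau>: "0 < \<tau> \<and> \<tau> < \<eta>"
      have "\<tau> < m / (norm (\<nu> p) + 1)" using \<tau> by (simp add: \<eta>_def)
      then have "\<tau> * (norm (\<nu> p) + 1) < m" using np by (simp add: pos_less_divide_eq)
      then have "\<tau> * norm (\<nu> p) < m" using \<tau> by (simp add: algebra_simps)
      then have d: "dist (p + \<tau> *\<^sub>R \<nu> p) p < m" "dist (p - \<tau> *\<^sub>R \<nu> p) p < m" using \<tau> by (simp_all add: dist_norm)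
      have F2: "F p (p + \<tau> *\<^sub>R \<nu> p) > 0" "F p (p - \<tau> *\<^sub>R \<nu> p) < 0" using \<eta>1(2)[of \<tau>] \<tau> by (simp_all add: \<eta>_def)
      have "sgn (\<theta> (p + \<tau> *\<^sub>R \<nu> p)) = 1" using sg[OF d(1)] FS[OF d(1)] F2 by simp
      moreover have "sgn (\<theta> (p - \<tau> *\<^sub>R \<nu> p)) = -1" using sg[OF d(2)] FS[OF d(2)] F2 by simp
      ultimately show "\<theta> (p + \<tau> *\<^sub>R \<nu> p) > 0" "\<theta> (p - \<tau> *\<^sub>R \<nu> p) < 0" by (simp_all add: sgn_1_pos sgn_1_neg)
    qed
  qed
  show ?thesis using c\<theta> nz sign by blast
qed


section \<open>Rigidity of hyperplanes\<close>

lemma shape_curvatures_uminus: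
  assumes S: "C2_hypersurface S" "unit_normal_field S \<nu>" "p \<in> S"
  shows "unit_normal_field S (\<lambda>x. - \<nu> x)"
    and "elem_sym r (principal_curvatures S (\<lambda>x. - \<nu> x) p) = (-1) ^ r * elem_sym r (principal_curvatures S \<nu> p)"
proof -
  show U': "unit_normal_field S (\<lambda>x. - \<nu> x)"
    using S(2) unfolding unit_normal_field_def hyp_metric_def by (auto intro: continuous_on_minus)
  obtain U f G G' where U: "p \<in> U" "oriented_chart S \<nu> U f G G'"
    using oriented_chart_exists[OF S(1,3,2)] by (elim exE conjE) (rule that)
  have oc: "oriented_chart S (\<lambda>x. - \<nu> x) U (\<lambda>x. - f x) (\<lambda>x. - G x) (\<lambda>x. - G' x)"
    using U(2) chart_uminus[of S U f G G'] unfolding oriented_chart_def by auto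
  have w: "weingarten (\<lambda>x. - G x) (\<lambda>x. - G' x) p X = - weingarten G G' p X" for X
    by (simp add: weingarten_def blinfun.minus_left algebra_simps)
  obtain e where e: "eigenframe S \<nu> p (principal_curvatures S \<nu> p) e"
    using principal_curvatures_eigenframe[OF S] by (elim exE) (rule that)
  have "eigenframe S (\<lambda>x. - \<nu> x) p (\<lambda>i. (-1) * principal_curvatures S \<nu> p i) e"
    using e unfolding eigenframe_chart[OF U(2) S(3) U(1)] eigenframe_chart[OF oc S(3) U(1)] w by simp
  then have "elem_sym r (principal_curvatures S (\<lambda>x. - \<nu> x) p) = elem_sym r (\<lambda>i. (-1) * principal_curvatures S \<nu> p i)"
    by (rule elem_sym_principal_curvatures[OF S(1) U' S(3)])
  then show "elem_sym r (principal_curvatures S (\<lambda>x. - \<nu> x) p) = (-1) ^ r * elem_sym r (principal_curvatures S \<nu> p)"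
    by (simp only: elem_sym_scale)
qed

lemma elem_sym_const: "elem_sym r (\<lambda>_::'n::finite. b) = real (CARD('n) choose r) * b ^ r"
proof -
  have "card {I::'n set. card I = r} = CARD('n) choose r" using n_subsets[of "UNIV::'n set" r] by simp
  then show ?thesis by (simp add: elem_sym_def)
qed

text \<open>
  Where \<open>S\<close> coincides with a hyperplane, the height is a local maximum and a local minimum at once, so the
  comparison inequality holds in both directions.
\<close>

lemma principal_curvatures_hyperplane:
  fixes S :: "('n::finite pt) set" and N :: "'n pt"
  assumes S: "C2_hypersurface S" "unit_normal_field S \<nu>" "p \<in> S" and V: "open V" "p \<in> V"
    and flat: "\<And>x. x \<in> S \<inter> V \<Longrightarrow> inner x N = inner p N" and N: "norm N = 1"
  shows "\<exists>k. N = k *\<^sub>R \<nu> p" and "inner N (\<nu> p) \<noteq> 0"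
    and "sgn (inner N (\<nu> p)) * principal_curvatures S \<nu> p i = snd N"
proof -
  have m1: "inner x N + 0 * exp (- 1 * (norm (x - 0))\<^sup>2) \<le> inner p N + 0 * exp (- 1 * (norm (p - 0))\<^sup>2)" if "x \<in> S \<inter> V" for x
    using flat[OF that] by simp
  have m2: "inner x (- N) + 0 * exp (- 1 * (norm (x - 0))\<^sup>2) \<le> inner p (- N) + 0 * exp (- 1 * (norm (p - 0))\<^sup>2)" if "x \<in> S \<inter> V" for x
    using flat[OF that] by simp
  note b1 = barrier_curvature[OF S V m1] and b2 = barrier_curvature[OF S V m2]
  have ex: "\<exists>k. N = k *\<^sub>R \<nu> p" using b1(1) by simp
  then show "\<exists>k. N = k *\<^sub>R \<nu> p" .
  from ex obtain k where k: "N = k *\<^sub>R \<nu> p" by blast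
  have "N \<noteq> 0" using N by auto
  then show nz: "inner N (\<nu> p) \<noteq> 0" using k by auto
  have 1: "sgn (inner N (\<nu> p)) * principal_curvatures S \<nu> p i \<le> snd N"
    using b1(2) N by auto
  have 2: "sgn (inner (- N) (\<nu> p)) * principal_curvatures S \<nu> p i \<le> snd (- N)"
    using b2(2) N by auto
  show "sgn (inner N (\<nu> p)) * principal_curvatures S \<nu> p i = snd N"
    using 1 2 by (simp add: sgn_minus)
qed

definition hyperplane :: "'n::finite pt \<Rightarrow> real \<Rightarrow> ('n pt) set"
  where "hyperplane N c = {p \<in> halfspace. inner p N = c}"

lemma convex_hyperplane_halfspace: "convex (hyperplane N c)"
proof -
  have "hyperplane N c = halfspace \<inter> {p. inner N p = c}" by (auto simp: hyperplane_def inner_commute)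
  then show ?thesis using convex_Int[OF convex_halfspace convex_hyperplane] by metis
qed

text \<open>
  The line through \<open>m\<close> orthogonal to the hyperplane avoids \<open>B\<close> if \<open>m\<close> is moved far enough along the hyperplane in a direction that
  does not decrease the last coordinate.
\<close>

lemma hyperplane_far_line:
  fixes N :: "'n::finite pt"
  assumes N: "N \<noteq> 0" and ne: "p \<in> hyperplane N c" and B: "bounded B"
  shows "\<exists>m\<in>hyperplane N c. \<forall>t. m + t *\<^sub>R N \<notin> B"
proof -
  have "dim {v. inner N v = 0} = CARD('n)" by (rule dim_tangent[OF N])
  then have "{v. inner N v = 0} \<noteq> {0}" using dim_singleton by (metis dim_eq_0 order_refl zero_less_card_finite less_irrefl)
  moreover have "0 \<in> {v. inner N v = 0}" by simp
  ultimately obtain w where w: "inner N w = 0" "w \<noteq> 0" by blast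
  (* moving in the direction v does not leave the half-space *)
  define v where "v = (if snd w \<ge> 0 then w else - w)"
  have v: "inner v N = 0" "v \<noteq> 0" "snd v \<ge> 0" using w by (auto simp: v_def inner_commute)
  obtain b where b: "\<And>x. x \<in> B \<Longrightarrow> norm x \<le> b" using B bounded_iff by blast
  have vv: "inner v v > 0" using v by simp
  define s where "s = (\<bar>b * norm v\<bar> + \<bar>inner p v\<bar> + 1) / inner v v"
  have s0: "s \<ge> 0" using vv by (simp add: s_def)
  have sv: "s * inner v v = \<bar>b * norm v\<bar> + \<bar>inner p v\<bar> + 1" using vv by (simp add: s_def)
  define m where "m = p + s *\<^sub>R v"
  have "m \<in> hyperplane N c"
    using ne v s0 by (auto simp: m_def hyperplane_def halfspace_def inner_add_left add_pos_nonneg)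
  moreover have "m + t *\<^sub>R N \<notin> B" for t
  proof
    assume "m + t *\<^sub>R N \<in> B"
    then have "norm (m + t *\<^sub>R N) \<le> b" by (rule b)
    then have "norm (m + t *\<^sub>R N) * norm v \<le> b * norm v" by (intro mult_right_mono) auto
    moreover have "inner (m + t *\<^sub>R N) v \<le> norm (m + t *\<^sub>R N) * norm v" by (rule norm_cauchy_schwarz)
    moreover have "inner (m + t *\<^sub>R N) v = inner p v + s * inner v v"
      using v(1) inner_commute[of N v] by (simp add: m_def inner_add_left)
    ultimately show False using sv by linarith
  qed
  ultimately show ?thesis by blast
qed

lemma hyperplane_subset_if_open:
  fixes S :: "('n::finite pt) set"
  assumes proper: "\<And>K. compact K \<Longrightarrow> K \<subseteq> halfspace \<Longrightarrow> compact (S \<inter> K)"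
    and op: "\<And>q. q \<in> S \<Longrightarrow> inner q N = \<tau> \<Longrightarrow> \<exists>\<delta>>0. \<forall>x. inner x N = \<tau> \<longrightarrow> dist x q < \<delta> \<longrightarrow> x \<in> S"
    and q: "q \<in> S" "q \<in> hyperplane N \<tau>"
  shows "hyperplane N \<tau> \<subseteq> S"
proof -
  let ?P = "hyperplane N \<tau>"
  have "openin (top_of_set ?P) (?P \<inter> S)"
    unfolding openin_euclidean_subtopology_iff
  proof (intro conjI ballI)
    fix x assume x: "x \<in> ?P \<inter> S"
    then obtain \<delta> where "\<delta> > 0" "\<forall>y. inner y N = \<tau> \<longrightarrow> dist y x < \<delta> \<longrightarrow> y \<in> S"
      using op[of x] by (auto simp: hyperplane_def)
    then show "\<exists>e>0. \<forall>x'\<in>?P. dist x' x < e \<longrightarrow> x' \<in> ?P \<inter> S"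
      by (intro exI[of _ \<delta>]) (auto simp: hyperplane_def)
  qed auto
  moreover have "openin (top_of_set ?P) (?P - S)"
    unfolding openin_euclidean_subtopology_iff
  proof (intro conjI ballI)
    fix x assume x: "x \<in> ?P - S"
    have "infdist x S > 0"
      by (rule infdist_pos_halfspace[OF proper]) (use x q in \<open>auto simp: hyperplane_def\<close>)
    moreover have "x' \<notin> S" if "dist x' x < infdist x S" for x'
      using infdist_le[of x' S x] that by (auto simp: dist_commute)
    ultimately show "\<exists>e>0. \<forall>x'\<in>?P. dist x' x < e \<longrightarrow> x' \<in> ?P - S"
      by (intro exI[of _ "infdist x S"]) auto
  qed auto
  then have "closedin (top_of_set ?P) (?P \<inter> S)" by (simp add: closedin_def Diff_Int)
  ultimately have "?P \<inter> S = {} \<or> ?P \<inter> S = ?P"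
    using convex_connected[OF convex_hyperplane_halfspace, of N \<tau>] unfolding connected_clopen by blast
  then show ?thesis using q by blast
qed

text \<open>
  At a point \<open>q\<close> of the hyperplane the gradient of a defining function of \<open>S\<close> is a multiple of \<open>N\<close>, so the defining function is strictly monotone along \<open>N\<close>
  near \<open>q\<close> and has no zeros besides those on the hyperplane.  Hence the hyperplane is open in \<open>S\<close>.
\<close>

lemma hypersurface_eq_contained_hyperplane:
  fixes S :: "('n::finite pt) set"
  assumes S: "C2_hypersurface S" "connected S" and N: "norm N = 1"
    and sub: "hyperplane N c \<subseteq> S" and ne: "hyperplane N c \<noteq> {}"
  shows "S = hyperplane N c"
proof -
  let ?M = "hyperplane N c"
  have SH: "S \<subseteq> halfspace" using S(1) unfolding C2_hypersurface_def by blast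
  have NN: "inner N N = 1" using N by (simp add: dot_square_norm)
  have "openin (top_of_set S) ?M"
    unfolding openin_euclidean_subtopology_iff
  proof (intro conjI ballI sub)
    fix q assume q: "q \<in> ?M"
    then have qS: "q \<in> S" and qN: "inner q N = c" using sub by (auto simp: hyperplane_def)
    obtain U f G G' where U: "q \<in> U" "chart S U f G G'" using chart_exists[OF S(1) qS] by (elim exE conjE) (rule that)
    have open_U: "open U" and UH: "U \<subseteq> halfspace" and Df: "\<And>x. x \<in> U \<Longrightarrow> (f has_derivative (\<lambda>v. inner (G x) v)) (at x)"
      and SU: "S \<inter> U = {x \<in> U. f x = 0}" and G0: "G q \<noteq> 0"
      using U unfolding chart_def by auto
    obtain d0 where d0: "d0 > 0" "ball q d0 \<subseteq> U" using open_U U(1) open_contains_ball by blast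
    have "inner (G q) v = 0" if v: "inner N v = 0" for v
    proof -
      have "((\<lambda>t. q + t *\<^sub>R v) has_vector_derivative v) (at 0)"
        by (auto intro!: derivative_eq_intros)
      moreover have "(\<lambda>t. q + t *\<^sub>R v) ` {-(d0 / (norm v + 1))<..<d0 / (norm v + 1)} \<subseteq> S"
      proof (rule image_subsetI)
        fix t assume t: "t \<in> {-(d0 / (norm v + 1))<..<d0 / (norm v + 1)}"
        have p: "norm v + 1 > 0" by (simp add: add_nonneg_pos)
        have "\<bar>t\<bar> < d0 / (norm v + 1)" using t by (auto simp: abs_less_iff)
        then have "\<bar>t\<bar> * (norm v + 1) < d0" using p by (simp add: pos_less_divide_eq)
        then have "\<bar>t\<bar> * norm v < d0" by (simp add: algebra_simps)
        then have "q + t *\<^sub>R v \<in> ball q d0" by (simp add: dist_norm)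
        then have "q + t *\<^sub>R v \<in> halfspace" using d0 UH by blast
        then have "q + t *\<^sub>R v \<in> ?M" using qN v inner_commute[of v N] by (simp add: hyperplane_def inner_add_left)
        then show "q + t *\<^sub>R v \<in> S" using sub by blast
      qed
      moreover have "d0 / (norm v + 1) > 0" using d0 by (simp add: add_nonneg_pos)
      ultimately have "v \<in> tangent_space S q"
        unfolding tangent_space_def
        by (intro CollectI exI[of _ "\<lambda>t. q + t *\<^sub>R v"] exI[of _ "d0 / (norm v + 1)"]) simp
      then show ?thesis using chart_tangent_space[OF U(2) qS U(1)] by simp
    qed
    then have "G q = (inner (G q) N / inner N N) *\<^sub>R N" using N by (intro orthogonal_to_kernel) auto
    then have GN: "inner (G q) N \<noteq> 0" using G0 by auto
    have "isCont (\<lambda>x. inner (G x) N) q"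
      using chart_continuous_gradient[OF U(2)] open_U U(1) continuous_on_eq_continuous_at by (intro continuous_intros) blast
    then obtain d1 where d1: "d1 > 0" "\<And>x. dist x q < d1 \<Longrightarrow> dist (inner (G x) N) (inner (G q) N) < \<bar>inner (G q) N\<bar>"
      using GN unfolding continuous_at_eps_delta by (metis zero_less_abs_iff)
    define d where "d = min d0 d1"
    have d: "d > 0" using d0 d1 by (simp add: d_def)
    have "x \<in> ?M" if x: "x \<in> S" "dist x q < d" for x
    proof (rule ccontr)
      assume nM: "x \<notin> ?M"
      (* x' is the projection of x to the hyperplane; f vanishes at both points *)
      define s where "s = inner x N - c"
      have s0: "s \<noteq> 0" using nM x SH by (auto simp: hyperplane_def s_def)
      define x' where "x' = x - s *\<^sub>R N"
      have x'N: "inner x' N = c" by (simp add: x'_def inner_diff_left NN s_def)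
      have bx: "x \<in> ball q d" using x(2) by (simp add: dist_commute)
      have "inner (x' - q) N = 0" using x'N qN by (simp add: inner_diff_left)
      have "(norm (x - q))\<^sup>2 = (norm (x' - q))\<^sup>2 + s\<^sup>2"
      proof -
        have "x - q = (x' - q) + s *\<^sub>R N" by (simp add: x'_def)
        then have "(norm (x - q))\<^sup>2 = inner ((x' - q) + s *\<^sub>R N) ((x' - q) + s *\<^sub>R N)" by (simp only: power2_norm_eq_inner)
        also have "\<dots> = inner (x' - q) (x' - q) + 2 * s * inner (x' - q) N + s\<^sup>2 * inner N N"
        proof -
          have "inner (a + s *\<^sub>R N) (a + s *\<^sub>R N) = inner a a + 2 * s * inner a N + s\<^sup>2 * inner N N" for a
            using inner_commute[of N a] by (simp add: inner_add_left inner_add_right power2_eq_square algebra_simps)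
          then show ?thesis .
        qed
        finally show ?thesis using \<open>inner (x' - q) N = 0\<close> NN by (simp add: power2_norm_eq_inner)
      qed
      then have "(norm (x' - q))\<^sup>2 \<le> (norm (x - q))\<^sup>2" by simp
      then have "norm (x' - q) \<le> norm (x - q)" by (rule power2_le_imp_le) simp
      then have bx': "x' \<in> ball q d" using x(2) by (simp add: dist_norm norm_minus_commute)
      have ballU: "ball q d \<subseteq> U" using d0 by (auto simp: d_def)
      have "x' \<in> ?M" using x'N bx' ballU UH by (auto simp: hyperplane_def)
      then have fx': "f x' = 0" using sub SU bx' ballU by blast
      have fx: "f x = 0" using x(1) SU bx ballU by blast
      define g where "g t = f (x' + t *\<^sub>R (s *\<^sub>R N))" for t
      have seg: "x' + t *\<^sub>R (s *\<^sub>R N) \<in> ball q d" if "0 \<le> t" "t \<le> 1" for t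
      proof -
        have "x' + t *\<^sub>R (s *\<^sub>R N) = (1 - t) *\<^sub>R x' + t *\<^sub>R x" by (simp add: x'_def algebra_simps)
        then show ?thesis using convexD_alt[OF convex_ball bx' bx that] by simp
      qed
      have "DERIV g t :> s * inner (G (x' + t *\<^sub>R (s *\<^sub>R N))) N" if "0 \<le> t" "t \<le> 1" for t
      proof -
        have "((\<lambda>t. x' + t *\<^sub>R (s *\<^sub>R N)) has_derivative (\<lambda>h. h *\<^sub>R (s *\<^sub>R N))) (at t)"
          by (auto intro!: derivative_eq_intros)
        moreover have "x' + t *\<^sub>R (s *\<^sub>R N) \<in> U" using seg[OF that] ballU by blast
        ultimately have "(g has_derivative (\<lambda>h. inner (G (x' + t *\<^sub>R (s *\<^sub>R N))) (h *\<^sub>R (s *\<^sub>R N)))) (at t)"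
          unfolding g_def by (intro has_derivative_compose[OF _ Df])
        then show ?thesis by (simp add: has_field_derivative_def mult_commute_abs mult.assoc)
      qed
      then obtain \<xi> where xi: "0 < \<xi>" "\<xi> < 1" "g 1 - g 0 = (1 - 0) * (s * inner (G (x' + \<xi> *\<^sub>R (s *\<^sub>R N))) N)"
        using MVT2[of 0 1 g "\<lambda>t. s * inner (G (x' + t *\<^sub>R (s *\<^sub>R N))) N"] by auto
      moreover have "g 1 = 0" "g 0 = 0" using fx fx' by (simp_all add: g_def x'_def)
      ultimately have z: "inner (G (x' + \<xi> *\<^sub>R (s *\<^sub>R N))) N = 0" using s0 by simp
      have "dist (x' + \<xi> *\<^sub>R (s *\<^sub>R N)) q < d1" using seg[of \<xi>] xi by (simp add: d_def dist_commute)
      from d1(2)[OF this] show False unfolding z by (simp add: dist_real_def)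
    qed
    then show "\<exists>e>0. \<forall>x'\<in>S. dist x' q < e \<longrightarrow> x' \<in> ?M" using d by blast
  qed
  moreover have "closedin (top_of_set S) ?M"
  proof -
    have "?M = S \<inter> {x. inner x N = c}" using sub SH by (auto simp: hyperplane_def)
    moreover have "closed {x. inner x N = c}" by (intro closed_Collect_eq continuous_intros)
    ultimately show ?thesis by (auto simp: closedin_closed)
  qed
  ultimately show ?thesis using S(2) ne unfolding connected_clopen by blast
qed


text \<open>
  The situation of the rigidity theorem with \<open>M\<close> replaced by a hyperplane.
\<close>

locale compact_perturbation =
  fixes S B :: "('n::finite pt) set" and N :: "'n pt" and c :: real and \<nu> :: "'n pt \<Rightarrow> 'n pt"
  assumes S: "C2_hypersurface S" and \<nu>: "unit_normal_field S \<nu>"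
    and proper: "\<And>K. compact K \<Longrightarrow> K \<subseteq> halfspace \<Longrightarrow> compact (S \<inter> K)"
    and con: "connected S"
    and B: "compact B" "B \<subseteq> halfspace" and eq: "S - B = hyperplane N c - B"
    and N: "norm N = 1" "snd N > 0" and ne: "hyperplane N c \<noteq> {}"
begin

lemma S_subset_halfspace: "S \<subseteq> halfspace" using S unfolding C2_hypersurface_def by blast

lemma N_nonzero: "N \<noteq> 0" using N by auto

lemma far_line: "\<exists>far_point\<in>hyperplane N c. \<forall>t. far_point + t *\<^sub>R N \<notin> B"
proof -
  obtain p where "p \<in> hyperplane N c" using ne by blast
  then show ?thesis using hyperplane_far_line[OF N_nonzero _ compact_imp_bounded[OF B(1)]] by blast
qed

definition far_point where "far_point = (SOME far_point. far_point \<in> hyperplane N c \<and> (\<forall>t. far_point + t *\<^sub>R N \<notin> B))"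

lemma far_point: "far_point \<in> hyperplane N c" "\<And>t. far_point + t *\<^sub>R N \<notin> B"
  using someI_ex[of "\<lambda>far_point. far_point \<in> hyperplane N c \<and> (\<forall>t. far_point + t *\<^sub>R N \<notin> B)"] far_line unfolding far_point_def by blast+

lemma far_point_notin_B: "far_point \<notin> B" using far_point(2)[of 0] by simp

lemma far_point_in_S: "far_point \<in> S" using eq far_point(1) far_point_notin_B by blast

lemma height_outside: "x \<in> S - B \<Longrightarrow> inner x N = c" using eq by (auto simp: hyperplane_def)

lemma attains_max_height:
  assumes "\<And>x. x \<in> S - B \<Longrightarrow> inner x w = d"
  shows "\<exists>q\<in>S. \<forall>x\<in>S. inner x w \<le> inner q w"
proof (cases "\<exists>x\<in>S \<inter> B. inner x w > d")
  case True
  then obtain x1 where x1: "x1 \<in> S \<inter> B" "inner x1 w > d" by blast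
  have "\<exists>q\<in>S \<inter> B. \<forall>x\<in>S \<inter> B. inner x w \<le> inner q w"
    using x1(1) by (intro continuous_attains_sup proper B continuous_intros) auto
  then obtain q where q: "q \<in> S \<inter> B" "\<And>x. x \<in> S \<inter> B \<Longrightarrow> inner x w \<le> inner q w" by blast
  have "inner x w \<le> inner q w" if "x \<in> S" for x
    using q(2)[of x] q(2)[OF x1(1)] x1(2) assms[of x] that by (cases "x \<in> B") auto
  then show ?thesis using q(1) by blast
next
  case False
  have "inner far_point w = d" using assms far_point_in_S far_point_notin_B by blast
  then have "\<forall>x\<in>S. inner x w \<le> inner far_point w" using False assms by (metis DiffI IntI linorder_not_le order_refl)
  then show ?thesis using far_point_in_S by blast
qed

text \<open>
  A leaf contained in \<open>S\<close> contains points outside \<open>B\<close>, where all heights are \<open>c\<close>.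
\<close>

lemma eq_if_plane_subset:
  assumes "q \<in> S" "inner q N = \<tau>" "hyperplane N \<tau> \<subseteq> S"
  shows "S = hyperplane N c"
proof -
  have "q \<in> hyperplane N \<tau>" using assms S_subset_halfspace by (auto simp: hyperplane_def)
  then obtain m' where m': "m' \<in> hyperplane N \<tau>" "\<And>t. m' + t *\<^sub>R N \<notin> B"
    using hyperplane_far_line[OF N_nonzero _ compact_imp_bounded[OF B(1)]] by blast
  have "m' \<in> S - B" using m'(1) m'(2)[of 0] assms(3) by auto
  then have "\<tau> = c" using height_outside[of m'] m'(1) by (simp add: hyperplane_def)
  then show ?thesis using hypersurface_eq_contained_hyperplane[OF S con N(1) _ ne] assms(3) by blast
qed

lemma curvatures_outside:
  assumes "p \<in> S - B"
  shows "\<exists>k. N = k *\<^sub>R \<nu> p" and "inner N (\<nu> p) \<noteq> 0"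
    and "sgn (inner N (\<nu> p)) * principal_curvatures S \<nu> p i = snd N"
proof -
  have V: "open (- B)" "p \<in> - B" using compact_imp_closed[OF B(1)] assms by (auto simp: open_Compl)
  have flat: "inner x N = inner p N" if "x \<in> S \<inter> - B" for x using height_outside[of x] height_outside[of p] that assms by simp
  have pS: "p \<in> S" using assms by blast
  show "\<exists>k. N = k *\<^sub>R \<nu> p" by (rule principal_curvatures_hyperplane(1)[OF S \<nu> pS V flat N(1)])
  show "inner N (\<nu> p) \<noteq> 0" by (rule principal_curvatures_hyperplane(2)[OF S \<nu> pS V flat N(1)])
  show "sgn (inner N (\<nu> p)) * principal_curvatures S \<nu> p i = snd N"
    by (rule principal_curvatures_hyperplane(3)[OF S \<nu> pS V flat N(1)])
qed

lemma rigidity_bounded_curvature: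
  assumes r: "1 \<le> r" "r \<le> CARD('n)"
    and bound: "\<And>x. x \<in> S \<Longrightarrow> \<bar>elem_sym r (principal_curvatures S \<nu> x)\<bar> \<le> real (CARD('n) choose r) * snd N ^ r"
  shows "S = hyperplane N c"
proof -
  obtain q where q: "q \<in> S" and min: "\<And>x. x \<in> S \<Longrightarrow> inner q N \<le> inner x N"
    using attains_max_height[of "- N" "- c"] height_outside by auto
  have op: "\<exists>\<delta>>0. \<forall>x. inner x N = inner q N \<longrightarrow> dist x k < \<delta> \<longrightarrow> x \<in> S"
    if "k \<in> S" "inner k N = inner q N" for k
    by (rule contact_open_symmetric_curvature[OF S \<nu> _ N r that]) (fact proper min bound)+
  have "hyperplane N (inner q N) \<subseteq> S"
    by (rule hyperplane_subset_if_open[OF _ _ q]) (use proper op q S_subset_halfspace in \<open>auto simp: hyperplane_def\<close>)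
  then show ?thesis using eq_if_plane_subset[OF q refl] by blast
qed

text \<open>
  The region \<open>T1\<close> above the highest points and the ray \<open>T2\<close> above the far point form a connected set that does not meet
  \<open>S\<close>, so the separating function has one sign there.  Near \<open>far_point\<close> the sign is positive; if \<open>\<nu> q\<close> pointed downwards, it
  would be negative near \<open>q\<close>.
\<close>

lemma orientation_at_top:
  assumes far: "inner N (\<nu> far_point) > 0" and q: "q \<in> S" and max: "\<And>x. x \<in> S \<Longrightarrow> inner x N \<le> inner q N"
  shows "inner (\<nu> q) N > 0"
proof (rule ccontr)
  assume neg: "\<not> inner (\<nu> q) N > 0"
  have NN: "inner N N = 1" using N by (simp add: dot_square_norm)
  have "((\<lambda>x. inner x N) has_derivative (\<lambda>v. inner N v)) (at q)"
    by (auto intro!: derivative_eq_intros simp: inner_commute)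
  then obtain k where k: "N = k *\<^sub>R \<nu> q"
    using gradient_parallel_normal_at_max[OF S \<nu> q open_UNIV UNIV_I, of "\<lambda>x. inner x N" N] max by auto
  have "k * inner (\<nu> q) N = 1" using NN k by (metis inner_scaleR_left)
  then have k0: "k < 0" using neg by (metis less_linear linorder_not_le mult_nonneg_nonneg mult_zero_left not_less zero_less_one zero_neq_one mult_pos_neg mult_neg_neg not_one_less_zero mult.commute less_le)
  obtain k' where k': "N = k' *\<^sub>R \<nu> far_point" using curvatures_outside(1)[of far_point] far_point_in_S far_point_notin_B by blast
  have "inner N (\<nu> far_point) = k' * inner (\<nu> far_point) (\<nu> far_point)" by (subst k') simp
  then have k'0: "k' > 0" using far by (metis inner_ge_zero zero_less_mult_pos2 mult_eq_0_iff less_le less_irrefl)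
  have "S \<noteq> {}" using q by blast
  have "\<exists>\<theta> :: 'n pt \<Rightarrow> real. continuous_on halfspace \<theta> \<and> (\<forall>x\<in>halfspace - S. \<theta> x \<noteq> 0) \<and>
    (\<forall>p\<in>S. \<exists>\<eta>>0. \<forall>\<tau>. 0 < \<tau> \<and> \<tau> < \<eta> \<longrightarrow> \<theta> (p + \<tau> *\<^sub>R \<nu> p) > 0 \<and> \<theta> (p - \<tau> *\<^sub>R \<nu> p) < 0)"
    by (rule separating_function[OF S \<nu> _ con \<open>S \<noteq> {}\<close>]) (fact proper)
  then obtain \<theta> :: "'n pt \<Rightarrow> real" where \<theta>: "continuous_on halfspace \<theta>" "\<And>x. x \<in> halfspace - S \<Longrightarrow> \<theta> x \<noteq> 0"
    and cross: "\<And>p. p \<in> S \<Longrightarrow> \<exists>\<eta>>0. \<forall>\<tau>. 0 < \<tau> \<and> \<tau> < \<eta> \<longrightarrow> \<theta> (p + \<tau> *\<^sub>R \<nu> p) > 0 \<and> \<theta> (p - \<tau> *\<^sub>R \<nu> p) < 0"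
    by blast
  define T1 where "T1 = {y \<in> halfspace. inner y N > inner q N}"
  define T2 where "T2 = (\<lambda>t. far_point + t *\<^sub>R N) ` {0<..}"
  have mN: "inner far_point N = c" and my: "snd far_point > 0" using far_point(1) by (auto simp: hyperplane_def halfspace_def)
  have hm: "inner (far_point + t *\<^sub>R N) N = c + t" for t by (simp add: inner_add_left mN NN)
  have up: "p + t *\<^sub>R N \<in> halfspace" if "p \<in> halfspace" "t \<ge> 0" for p t
    using that N(2) by (simp add: halfspace_def add_pos_nonneg)
  have T1: "T1 \<subseteq> halfspace - S" using max by (auto simp: T1_def not_le[symmetric])
  have T2: "T2 \<subseteq> halfspace - S"
  proof
    fix y assume "y \<in> T2"
    then obtain t where t: "t > 0" "y = far_point + t *\<^sub>R N" by (auto simp: T2_def)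
    have "y \<in> halfspace" using up[of far_point t] t far_point(1) by (auto simp: hyperplane_def)
    moreover have "y \<notin> S"
    proof
      assume "y \<in> S"
      then have "inner y N = c" using height_outside[of y] far_point(2)[of t] t by blast
      then show False using hm[of t] t by simp
    qed
    ultimately show "y \<in> halfspace - S" by blast
  qed
  have "T1 = halfspace \<inter> {y. inner N y > inner q N}" by (auto simp: T1_def inner_commute)
  then have "convex T1" using convex_Int[OF convex_halfspace convex_halfspace_gt] by metis
  then have c1: "connected T1" by (rule convex_connected)
  have c2: "connected T2" unfolding T2_def
    by (intro connected_continuous_image continuous_intros) simp
  have "far_point + (\<bar>inner q N - c\<bar> + 1) *\<^sub>R N \<in> T1 \<inter> T2"
    using up[of far_point "\<bar>inner q N - c\<bar> + 1"] far_point(1) hm by (auto simp: T1_def T2_def hyperplane_def)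
  then have cT: "connected (T1 \<union> T2)" using connected_Un[OF c1 c2] by blast
  have ct: "continuous_on (T1 \<union> T2) \<theta>" using \<theta>(1) T1 T2 continuous_on_subset[of halfspace \<theta> "T1 \<union> T2"] by blast
  have cI: "connected (\<theta> ` (T1 \<union> T2))" by (rule connected_continuous_image[OF ct cT])
  obtain e1 where e1: "e1 > 0" "\<forall>\<tau>. 0 < \<tau> \<and> \<tau> < e1 \<longrightarrow> \<theta> (far_point + \<tau> *\<^sub>R \<nu> far_point) > 0 \<and> \<theta> (far_point - \<tau> *\<^sub>R \<nu> far_point) < 0"
    using cross[OF far_point_in_S] by blast
  have "far_point + (e1 / 2) *\<^sub>R \<nu> far_point = far_point + (e1 / (2 * k')) *\<^sub>R N" using k'0 by (subst k') simp
  moreover have "far_point + (e1 / (2 * k')) *\<^sub>R N \<in> T2" using e1(1) k'0 by (auto simp: T2_def)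
  moreover have "\<theta> (far_point + (e1 / 2) *\<^sub>R \<nu> far_point) > 0" using e1 by simp
  ultimately have "far_point + (e1 / 2) *\<^sub>R \<nu> far_point \<in> T1 \<union> T2" "\<theta> (far_point + (e1 / 2) *\<^sub>R \<nu> far_point) > 0" by (simp_all only: UnI2)
  then obtain y1 where y1: "y1 \<in> T1 \<union> T2" "\<theta> y1 > 0" by blast
  obtain e2 where e2: "e2 > 0" "\<forall>\<tau>. 0 < \<tau> \<and> \<tau> < e2 \<longrightarrow> \<theta> (q + \<tau> *\<^sub>R \<nu> q) > 0 \<and> \<theta> (q - \<tau> *\<^sub>R \<nu> q) < 0"
    using cross[OF q] by blast
  have "q - (e2 / 2) *\<^sub>R \<nu> q = q + (e2 / (2 * - k)) *\<^sub>R N" using k0 by (subst k) simp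
  moreover have "q + (e2 / (2 * - k)) *\<^sub>R N \<in> T1"
  proof -
    have "e2 / (2 * - k) > 0" using e2(1) k0 by (intro divide_pos_pos) auto
    moreover have "q + w *\<^sub>R N \<in> T1" if "w > 0" for w
      using up[of q w] q S_subset_halfspace that by (auto simp: T1_def inner_add_left NN)
    ultimately show ?thesis by blast
  qed
  moreover have "\<theta> (q - (e2 / 2) *\<^sub>R \<nu> q) < 0" using e2 by simp
  ultimately have "q - (e2 / 2) *\<^sub>R \<nu> q \<in> T1 \<union> T2" "\<theta> (q - (e2 / 2) *\<^sub>R \<nu> q) < 0" by (simp_all only: UnI1)
  then obtain y2 where y2: "y2 \<in> T1 \<union> T2" "\<theta> y2 < 0" by blast
  have "{\<theta> y2..\<theta> y1} \<subseteq> \<theta> ` (T1 \<union> T2)"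
    by (rule connected_contains_Icc[OF cI]) (use y1 y2 in auto)
  then have "0 \<in> \<theta> ` (T1 \<union> T2)" using y1(2) y2(2) by (auto simp: subset_iff)
  then obtain x where x: "x \<in> T1 \<union> T2" "\<theta> x = 0" unfolding image_iff by metis
  then have "x \<in> halfspace - S" using T1 T2 by blast
  then show False using \<theta>(2) x(2) by blast
qed

text \<open>
  The set \<open>Q\<close> of points at which \<open>\<sigma>\<^sub>1, \<dots>, \<sigma>\<^sub>r\<close> are positive is open, and closed by the first part of \<open>garding_maclaurin\<close>; it contains
  \<open>far_point\<close>.  So the Maclaurin inequality holds on all of \<open>S\<close>.
\<close>

lemma mean_curvature_lower_bound:
  assumes r: "1 \<le> r" "r \<le> CARD('n)" and far: "inner N (\<nu> far_point) > 0"
    and ge: "\<And>x. x \<in> S \<Longrightarrow> real (CARD('n) choose r) * snd N ^ r \<le> elem_sym r (principal_curvatures S \<nu> x)"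
    and x: "x \<in> S"
  shows "real CARD('n) * snd N \<le> elem_sym 1 (principal_curvatures S \<nu> x)"
proof -
  let ?k = "principal_curvatures S \<nu>" and ?c = "real (CARD('n) choose r)"
  have c0: "?c > 0" using r by simp
  have pos: "elem_sym r (?k x) > 0" if "x \<in> S" for x
  proof -
    have "0 < ?c * snd N ^ r" using c0 N by simp
    then show ?thesis using ge[OF that] by linarith
  qed
  define Q where "Q = S \<inter> {x. \<forall>j\<in>{..r}. elem_sym j (?k x) > 0}"
  note cont = continuous_on_elem_sym_principal_curvatures[OF S \<nu>]
  have Qo: "Q = (\<Inter>j\<in>{..r}. S \<inter> (\<lambda>x. elem_sym j (?k x)) -` {0<..})" by (auto simp: Q_def)
  have "openin (top_of_set S) Q"
    unfolding Qo
    by (intro openin_INT2 continuous_openin_preimage_gen[OF cont]) auto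
  moreover have Qc: "Q = (\<Inter>j\<in>{..r}. S \<inter> (\<lambda>x. elem_sym j (?k x)) -` {0..})"
  proof
    show "Q \<subseteq> (\<Inter>j\<in>{..r}. S \<inter> (\<lambda>x. elem_sym j (?k x)) -` {0..})" by (auto simp: Q_def less_imp_le)
    show "(\<Inter>j\<in>{..r}. S \<inter> (\<lambda>x. elem_sym j (?k x)) -` {0..}) \<subseteq> Q"
    proof
      fix y assume y: "y \<in> (\<Inter>j\<in>{..r}. S \<inter> (\<lambda>x. elem_sym j (?k x)) -` {0..})"
      then have yS: "y \<in> S" by auto
      have "elem_sym j (?k y) > 0" if "j \<le> r" for j
        by (rule garding_maclaurin(1)[OF r _ pos[OF yS] that]) (use y in auto)
      then show "y \<in> Q" using yS by (auto simp: Q_def)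
    qed
  qed
  have "closedin (top_of_set S) Q"
    unfolding Qc by (intro closedin_INT continuous_closedin_preimage[OF cont]) auto
  ultimately have "Q = {} \<or> Q = S" using con unfolding connected_clopen by blast
  moreover have "far_point \<in> Q"
  proof -
    have "?k far_point = (\<lambda>_. snd N)"
      using curvatures_outside(3)[of far_point] far_point_in_S far_point_notin_B far by (intro ext) simp
    then show ?thesis using far_point_in_S N by (simp add: Q_def elem_sym_const Suc_le_eq r(2) order_trans[OF _ r(2)])
  qed
  ultimately have "x \<in> Q" using x by blast
  then have q: "elem_sym j (?k x) > 0" if "j \<le> r" for j using that by (auto simp: Q_def)
  have "snd N ^ r \<le> elem_sym r (?k x) / ?c" using ge[OF x] c0 by (simp add: pos_le_divide_eq mult.commute)
  also have "\<dots> \<le> (elem_sym 1 (?k x) / real CARD('n)) ^ r"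
    by (rule garding_maclaurin(2)[OF r]) (use q in \<open>auto simp: less_imp_le\<close>)
  finally have "snd N ^ r \<le> (elem_sym 1 (?k x) / real CARD('n)) ^ r" .
  then have "snd N \<le> elem_sym 1 (?k x) / real CARD('n)"
    using q[of 1] r(1) by (subst (asm) power_mono_iff) (use N in auto)
  then show ?thesis by (simp add: pos_le_divide_eq mult.commute)
qed

lemma rigidity_large_curvature_oriented:
  assumes r: "1 \<le> r" "r \<le> CARD('n)" and far: "inner N (\<nu> far_point) > 0"
    and ge: "\<And>x. x \<in> S \<Longrightarrow> real (CARD('n) choose r) * snd N ^ r \<le> elem_sym r (principal_curvatures S \<nu> x)"
  shows "S = hyperplane N c"
proof -
  obtain q where q: "q \<in> S" and max: "\<And>x. x \<in> S \<Longrightarrow> inner x N \<le> inner q N"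
    using attains_max_height[of N c] height_outside by auto
  have ori: "inner (\<nu> k) N > 0" if "k \<in> S" "inner k N = inner q N" for k
    by (rule orientation_at_top[OF far that(1)]) (use max that in simp)
  have mean: "real CARD('n) * snd N \<le> elem_sym 1 (principal_curvatures S \<nu> x)" if "x \<in> S" for x
    by (rule mean_curvature_lower_bound[OF r far ge that])
  have op: "\<exists>\<delta>>0. \<forall>x. inner x N = inner q N \<longrightarrow> dist x k < \<delta> \<longrightarrow> x \<in> S"
    if "k \<in> S" "inner k N = inner q N" for k
    by (rule contact_open_mean_curvature[OF S \<nu> _ N that]) (fact proper max ori mean)+
  have "hyperplane N (inner q N) \<subseteq> S"
    by (rule hyperplane_subset_if_open[OF _ _ q]) (use proper op q S_subset_halfspace in \<open>auto simp: hyperplane_def\<close>)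
  then show ?thesis using eq_if_plane_subset[OF q refl] by blast
qed

end

text \<open>
  If the normal points downwards at \<open>far_point\<close>, the value of the curvature outside \<open>B\<close> forces \<open>r\<close> to be even, and reversing the normal
  changes nothing.
\<close>

theorem hyperplane_rigidity:
  fixes S B :: "('n::finite pt) set"
  assumes cp: "compact_perturbation S B N c \<nu>" and r: "1 \<le> r" "r \<le> CARD('n)"
    and out: "\<And>x. x \<in> S - B \<Longrightarrow> elem_sym r (principal_curvatures S \<nu> x) = real (CARD('n) choose r) * snd N ^ r"
    and alt: "(\<forall>x\<in>S. real (CARD('n) choose r) * snd N ^ r \<le> elem_sym r (principal_curvatures S \<nu> x)) \<or>
      (\<forall>x\<in>S. \<bar>elem_sym r (principal_curvatures S \<nu> x)\<bar> \<le> real (CARD('n) choose r) * snd N ^ r)"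
  shows "S = hyperplane N c"
  using alt
proof
  interpret compact_perturbation S B N c \<nu> by (rule cp)
  assume "\<forall>x\<in>S. \<bar>elem_sym r (principal_curvatures S \<nu> x)\<bar> \<le> real (CARD('n) choose r) * snd N ^ r"
  then show ?thesis using rigidity_bounded_curvature[OF r] by blast
next
  interpret compact_perturbation S B N c \<nu> by (rule cp)
  assume ge: "\<forall>x\<in>S. real (CARD('n) choose r) * snd N ^ r \<le> elem_sym r (principal_curvatures S \<nu> x)"
  have mSB: "far_point \<in> S - B" using far_point_in_S far_point_notin_B by blast
  show ?thesis
  proof (cases "inner N (\<nu> far_point) > 0")
    case True
    then show ?thesis using rigidity_large_curvature_oriented[OF r] ge by blast
  next
    case False
    then have neg: "inner N (\<nu> far_point) < 0" using curvatures_outside(2)[OF mSB] by simp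
    interpret neg: compact_perturbation S B N c "\<lambda>x. - \<nu> x"
      using cp shape_curvatures_uminus(1)[OF S \<nu> far_point_in_S] unfolding compact_perturbation_def by blast
    have "principal_curvatures S \<nu> far_point = (\<lambda>_. - snd N)"
    proof
      fix i
      show "principal_curvatures S \<nu> far_point i = - snd N" using curvatures_outside(3)[OF mSB, of i] neg by simp
    qed
    then have "real (CARD('n) choose r) * (- snd N) ^ r = real (CARD('n) choose r) * snd N ^ r"
      using out[OF mSB] by (simp only: elem_sym_const)
    then have "(- snd N) ^ r = snd N ^ r" using r by simp
    then have "(-1) ^ r * snd N ^ r = 1 * snd N ^ r" by (metis mult_1 mult_minus1 power_mult_distrib)
    then have e: "(-1 :: real) ^ r = 1" using N by simp
    have ge': "real (CARD('n) choose r) * snd N ^ r \<le> elem_sym r (principal_curvatures S (\<lambda>x. - \<nu> x) x)" if "x \<in> S" for x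
      using ge that unfolding shape_curvatures_uminus(2)[OF S \<nu> that] e by simp
    have "inner N (- \<nu> neg.far_point) > 0" using neg by simp
    then show ?thesis using neg.rigidity_large_curvature_oriented[OF r _ ge'] by blast
  qed
qed


section \<open>Isometries\<close>

lemma C2_on_compose:
  fixes F :: "'a::euclidean_space \<Rightarrow> 'b::euclidean_space" and f :: "'b \<Rightarrow> 'c::real_normed_vector"
  assumes f: "C2_on V f" and F: "C2_on U F" and sub: "F ` U \<subseteq> V"
  shows "C2_on U (\<lambda>x. f (F x))"
proof -
  obtain f' f'' where f': "\<And>x. x \<in> V \<Longrightarrow> (f has_derivative blinfun_apply (f' x)) (at x)"
    and f'': "\<And>x. x \<in> V \<Longrightarrow> (f' has_derivative blinfun_apply (f'' x)) (at x)" and cf: "continuous_on V f''"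
    using f unfolding C2_on_def by blast
  obtain F' F'' where F': "\<And>x. x \<in> U \<Longrightarrow> (F has_derivative blinfun_apply (F' x)) (at x)"
    and F'': "\<And>x. x \<in> U \<Longrightarrow> (F' has_derivative blinfun_apply (F'' x)) (at x)" and cF: "continuous_on U F''"
    using F unfolding C2_on_def by blast
  have FV: "F x \<in> V" if "x \<in> U" for x using sub that by blast
  define g' where "g' x = f' (F x) o\<^sub>L F' x" for x
  define h where "h x v = (blinfun_apply (f'' (F x)) (blinfun_apply (F' x) v) o\<^sub>L F' x) + (f' (F x) o\<^sub>L blinfun_apply (F'' x) v)" for x v
  have blh: "bounded_linear (h x)" for x
    unfolding h_def
    by (intro bounded_linear_add
        bounded_linear_compose[OF bounded_bilinear.bounded_linear_left[OF bounded_bilinear_blinfun_compose]]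
        bounded_linear_compose[OF bounded_bilinear.bounded_linear_right[OF bounded_bilinear_blinfun_compose]]
        bounded_linear_compose[OF blinfun.bounded_linear_right blinfun.bounded_linear_right] blinfun.bounded_linear_right)
  define g'' where "g'' x = Blinfun (h x)" for x
  have ap: "blinfun_apply (g'' x) = h x" for x unfolding g''_def by (rule bounded_linear_Blinfun_apply[OF blh])
  have "((\<lambda>x. f (F x)) has_derivative blinfun_apply (g' x)) (at x)" if "x \<in> U" for x
    using has_derivative_compose[OF F'[OF that] f'[OF FV[OF that]]]
    by (simp add: g'_def blinfun_compose.rep_eq comp_def)
  moreover have "(g' has_derivative blinfun_apply (g'' x)) (at x)" if "x \<in> U" for x
  proof -
    have "((\<lambda>x. f' (F x)) has_derivative (\<lambda>v. blinfun_apply (f'' (F x)) (blinfun_apply (F' x) v))) (at x)"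
      by (rule has_derivative_compose[OF F'[OF that] f''[OF FV[OF that]]])
    from bounded_bilinear.FDERIV[OF bounded_bilinear_blinfun_compose this F''[OF that]]
    show ?thesis unfolding g'_def ap h_def by (simp add: add.commute)
  qed
  moreover have "continuous_on U g''"
  proof (rule continuous_on_blinfun_componentwise)
    fix i :: 'a assume "i \<in> Basis"
    have cFF: "continuous_on U F" using F' by (meson continuous_at_imp_continuous_on has_derivative_continuous)
    have cF': "continuous_on U F'" using F'' by (meson continuous_at_imp_continuous_on has_derivative_continuous)
    have "continuous_on V f'" using f'' by (meson continuous_at_imp_continuous_on has_derivative_continuous)
    then have c1: "continuous_on U (\<lambda>x. f' (F x))" using continuous_on_compose2 cFF sub by blast
    have c2: "continuous_on U (\<lambda>x. f'' (F x))" using continuous_on_compose2[OF cf cFF sub] .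
    show "continuous_on U (\<lambda>x. blinfun_apply (g'' x) i)"
      unfolding ap h_def by (intro continuous_intros c1 c2 cF' cF)
  qed
  ultimately show ?thesis unfolding C2_on_def by blast
qed

text \<open>
  An isometry with names for its first two derivatives, since objects are pulled back by explicit formulas.
\<close>

locale isometry_derivatives =
  fixes F :: "'n::finite pt \<Rightarrow> 'n pt" and F' :: "'n pt \<Rightarrow> 'n pt \<Rightarrow>\<^sub>L 'n pt" and F'' :: "'n pt \<Rightarrow> 'n pt \<Rightarrow>\<^sub>L ('n pt \<Rightarrow>\<^sub>L 'n pt)"
  assumes bij: "bij_betw F halfspace halfspace"
    and F': "\<And>x. x \<in> halfspace \<Longrightarrow> (F has_derivative blinfun_apply (F' x)) (at x)"
    and F'': "\<And>x. x \<in> halfspace \<Longrightarrow> (F' has_derivative blinfun_apply (F'' x)) (at x)"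
    and cF'': "continuous_on halfspace F''"
    and metric: "\<And>x u v. x \<in> halfspace \<Longrightarrow> hyp_metric (F x) (F' x u) (F' x v) = hyp_metric x u v"
begin

lemma C2_F: "C2_on halfspace F"
  unfolding C2_on_def using F' F'' cF'' by blast

lemma F_in_halfspace: "x \<in> halfspace \<Longrightarrow> F x \<in> halfspace" using bij by (auto simp: bij_betw_def)

lemma heights_pos: "x \<in> halfspace \<Longrightarrow> snd x > 0" "x \<in> halfspace \<Longrightarrow> snd (F x) > 0"
  using F_in_halfspace by (auto simp: halfspace_def)

lemma inner_F':
  assumes "x \<in> halfspace"
  shows "inner (F' x u) (F' x v) * (snd x)\<^sup>2 = (snd (F x))\<^sup>2 * inner u v"
  using metric[OF assms, of u v] heights_pos[OF assms] unfolding hyp_metric_def by (simp add: field_simps)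

definition conformal_factor :: "'n pt \<Rightarrow> real" where "conformal_factor x = (snd (F x))\<^sup>2 / (snd x)\<^sup>2"

lemma conformal_factor: "x \<in> halfspace \<Longrightarrow> conformal_factor x > 0" "x \<in> halfspace \<Longrightarrow> inner (F' x u) (F' x v) = conformal_factor x * inner u v"
  using inner_F'[of x u v] heights_pos[of x] by (auto simp: conformal_factor_def field_simps)

lemma F'_inj: "x \<in> halfspace \<Longrightarrow> F' x u = 0 \<Longrightarrow> u = 0"
  using conformal_factor(2)[of x u u] conformal_factor(1)[of x] by simp

lemma F'_surj:
  assumes "x \<in> halfspace"
  shows "surj (blinfun_apply (F' x))"
proof -
  have "linear (blinfun_apply (F' x))" by (rule bounded_linear.linear[OF blinfun.bounded_linear_right])
  moreover from this have "inj (blinfun_apply (F' x))" using F'_inj[OF assms] linear_injective_0 by blast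
  ultimately show ?thesis by (rule linear_inj_imp_surj)
qed

lemma eq_if_inner_F':
  assumes x: "x \<in> halfspace" and "\<And>v. inner a (F' x v) = inner b (F' x v)"
  shows "a = b"
proof -
  obtain v where v: "a - b = F' x v" using F'_surj[OF x] by (metis surjD)
  have "inner (a - b) (a - b) = 0" using assms(2)[of v] by (subst (2) v) (simp add: inner_diff_left)
  then show ?thesis by simp
qed

text \<open>
  The derivative of the identity that expresses the invariance of the metric, in the direction \<open>z\<close>.
\<close>

lemma derivative_metric:
  assumes x: "x \<in> halfspace"
  shows "inner (F'' x z u) (F' x v) + inner (F' x u) (F'' x z v) =
    2 * inner (F' x u) (F' x v) * (snd (F' x z) / snd (F x) - snd z / snd x)"
proof -
  have d1: "((\<lambda>x. inner (F' x u) (F' x v) * (snd x)\<^sup>2) has_derivative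
     (\<lambda>z. inner (F' x u) (F' x v) * (2 * snd x * snd z) + (inner (F' x u) (F'' x z v) + inner (F'' x z u) (F' x v)) * (snd x)\<^sup>2)) (at x)"
    by (auto intro!: derivative_eq_intros F''[OF x] simp: blinfun.zero_right power2_eq_square algebra_simps)
  have d2: "((\<lambda>x. (snd (F x))\<^sup>2 * inner u v) has_derivative (\<lambda>z. (2 * snd (F x) * snd (F' x z)) * inner u v)) (at x)"
    by (auto intro!: derivative_eq_intros F'[OF x] simp: power2_eq_square algebra_simps)
  have "((\<lambda>x. (snd (F x))\<^sup>2 * inner u v) has_derivative
     (\<lambda>z. inner (F' x u) (F' x v) * (2 * snd x * snd z) + (inner (F' x u) (F'' x z v) + inner (F'' x z u) (F' x v)) * (snd x)\<^sup>2)) (at x)"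
    by (rule has_derivative_transform_within_open[OF d1 open_halfspace x]) (rule inner_F')
  from fun_cong[OF has_derivative_unique[OF this d2], of z]
  have e: "inner (F' x u) (F' x v) * (2 * snd x * snd z) + (inner (F' x u) (F'' x z v) + inner (F'' x z u) (F' x v)) * (snd x)\<^sup>2
    = (2 * snd (F x) * snd (F' x z)) * inner u v" .
  have uv: "inner u v = inner (F' x u) (F' x v) * (snd x)\<^sup>2 / (snd (F x))\<^sup>2"
    using inner_F'[OF x, of u v] heights_pos[OF x] by (simp add: field_simps)
  have alg: "A = 2 * I * (Z / Y - w / y)" if "I * (2 * y * w) + A * y\<^sup>2 = (2 * Y * Z) * (I * y\<^sup>2 / Y\<^sup>2)" "y > 0" "Y > 0"
    for A I y w Y Z :: real
  proof -
    have "(2 * Y * Z) * (I * y\<^sup>2 / Y\<^sup>2) = 2 * I * (Z / Y) * y\<^sup>2" using that(3) by (simp add: power2_eq_square)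
    moreover have "I * (2 * y * w) = 2 * I * (w / y) * y\<^sup>2" using that(2) by (simp add: power2_eq_square)
    ultimately have "A * y\<^sup>2 = (2 * I * (Z / Y - w / y)) * y\<^sup>2" using that(1) by (simp add: algebra_simps)
    then show ?thesis using that(2) by simp
  qed
  have "inner (F' x u) (F'' x z v) + inner (F'' x z u) (F' x v) = 2 * inner (F' x u) (F' x v) * (snd (F' x z) / snd (F x) - snd z / snd x)"
    by (rule alg[OF e[unfolded uv] heights_pos[OF x]])
  then show ?thesis by simp
qed

lemma second_derivative_sym: "x \<in> halfspace \<Longrightarrow> F'' x u v = F'' x v u"
  by (rule second_derivative_symmetric[where U = halfspace and f = F and f' = F' and f'' = "F'' x" and p = x])
    (auto intro: F' F'' open_halfspace)

text \<open>
  Isometries intertwine the Levi-Civita connections.  As in Koszul's formula, the expression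
  \<open>a u v w = F'' u v \<bullet> F' w\<close> is symmetric in its first two arguments, so it is determined by the sums \<open>a z p q + a z q p\<close>, which
  are known from the invariance of the metric.
\<close>

lemma christoffel_transform:
  assumes x: "x \<in> halfspace"
  shows "F'' x u v + christoffel (F x) (F' x u) (F' x v) = F' x (christoffel x u v)"
proof (rule eq_if_inner_F'[OF x])
  fix w
  define y where "y = snd x"
  define Y where "Y = snd (F x)"
  have y: "y > 0" "Y > 0" using heights_pos[OF x] by (auto simp: y_def Y_def)
  define a where "a p q r = inner (F'' x p q) (F' x r)" for p q r
  define I where "I p q = inner (F' x p) (F' x q)" for p q
  define R where "R p = snd (F' x p) / Y - snd p / y" for p
  have I: "I p q = I q p" for p q by (simp add: I_def inner_commute)
  have as: "a p q r = a q p r" for p q r by (simp add: a_def second_derivative_sym[OF x])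
  have K: "a z p q + a z q p = 2 * I p q * R z" for z p q
    using derivative_metric[OF x, of z p q] by (simp add: a_def I_def R_def Y_def y_def inner_commute)
  have "2 * a u v w = (a u v w + a u w v) + (a v u w + a v w u) - (a w u v + a w v u)"
    using as[of u v w] as[of u w v] as[of v w u] by linarith
  also have "\<dots> = 2 * (I v w * R u + I u w * R v - I u v * R w)" unfolding K by simp
  finally have a: "a u v w = I v w * R u + I u w * R v - I u v * R w" by simp
  have e: "inner ((0, 1) :: 'n pt) z = snd z" for z by (cases z) simp
  have l: "inner (christoffel (F x) (F' x u) (F' x v)) (F' x w) =
     - (snd (F' x u) / Y) * I v w - (snd (F' x v) / Y) * I u w + (I u v / Y) * snd (F' x w)"
    unfolding christoffel_eq[OF F_in_halfspace[OF x]] I_def Y_def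
    by (simp only: inner_add_left inner_diff_left inner_scaleR_left e)
  have r: "inner (F' x (christoffel x u v)) (F' x w) =
     - (snd u / y) * I v w - (snd v / y) * I u w + (I u v / y) * snd w"
    unfolding conformal_factor(2)[OF x] christoffel_eq[OF x] I_def y_def
    by (simp only: inner_add_left inner_diff_left inner_scaleR_left e) (simp add: algebra_simps)
  have "inner (F'' x u v + christoffel (F x) (F' x u) (F' x v)) (F' x w) = a u v w + inner (christoffel (F x) (F' x u) (F' x v)) (F' x w)"
    by (simp only: inner_add_left a_def)
  also have "\<dots> = inner (F' x (christoffel x u v)) (F' x w)"
  proof -
    have "ivw * (fu / Y - su / y) + iuw * (fv / Y - sv / y) - iuv * (fw / Y - sw / y) +
        (- (fu / Y) * ivw - (fv / Y) * iuw + (iuv / Y) * fw) =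
        - (su / y) * ivw - (sv / y) * iuw + (iuv / y) * sw" for ivw iuw iuv fu fv fw su sv sw :: real
      by (simp add: algebra_simps)
    then show ?thesis by (simp only: l r a R_def)
  qed
  finally show "inner (F'' x u v + christoffel (F x) (F' x u) (F' x v)) (F' x w) = inner (F' x (christoffel x u v)) (F' x w)" .
qed

text \<open>
  The inverse of \<open>F' x\<close>, written as a multiple of the adjoint, which makes its continuity in \<open>x\<close> obvious.
\<close>

definition pull :: "'n pt \<Rightarrow> 'n pt \<Rightarrow> 'n pt"
  where "pull x w = (1 / conformal_factor x) *\<^sub>R (\<Sum>b\<in>Basis. inner (F' x b) w *\<^sub>R b)"

lemma F'_pull:
  assumes x: "x \<in> halfspace"
  shows "F' x (pull x w) = w"
proof (rule eq_if_inner_F'[OF x])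
  fix v
  have lin: "linear (blinfun_apply (F' x))" by (rule bounded_linear.linear[OF blinfun.bounded_linear_right])
  have "inner (F' x (pull x w)) (F' x v) = conformal_factor x * inner (pull x w) v" by (rule conformal_factor(2)[OF x])
  also have "\<dots> = (\<Sum>b\<in>Basis. inner (F' x b) w * inner b v)"
    using conformal_factor(1)[OF x] by (simp add: pull_def inner_sum_left)
  also have "\<dots> = inner (\<Sum>b\<in>Basis. inner v b *\<^sub>R F' x b) w"
    by (simp add: inner_sum_left inner_commute[of v] mult.commute)
  also have "(\<Sum>b\<in>Basis. inner v b *\<^sub>R F' x b) = F' x v"
  proof -
    have "F' x (\<Sum>b\<in>Basis. inner v b *\<^sub>R b) = (\<Sum>b\<in>Basis. inner v b *\<^sub>R F' x b)"
      by (simp add: linear_sum[OF lin] linear_cmul[OF lin])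
    then show ?thesis by (simp add: euclidean_representation)
  qed
  finally show "inner (F' x (pull x w)) (F' x v) = inner w (F' x v)" by (simp add: inner_commute)
qed

definition pull_set :: "('n pt) set \<Rightarrow> ('n pt) set" where "pull_set S = {x \<in> halfspace. F x \<in> S}"

definition pull_field :: "('n pt \<Rightarrow> 'n pt) \<Rightarrow> 'n pt \<Rightarrow> 'n pt" where "pull_field \<nu> x = pull x (\<nu> (F x))"

lemma F'_pull_field: "x \<in> halfspace \<Longrightarrow> F' x (pull_field \<nu> x) = \<nu> (F x)"
  unfolding pull_field_def by (rule F'_pull)

lemma continuous_F: "continuous_on halfspace F"
  using F' by (meson continuous_at_imp_continuous_on has_derivative_continuous)

lemma continuous_F': "continuous_on halfspace F'"
  using F'' by (meson continuous_at_imp_continuous_on has_derivative_continuous)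

lemma inverse_exists: "\<exists>g. homeomorphism halfspace halfspace F g"
proof -
  have inj: "inj_on F halfspace" and im: "F ` halfspace = halfspace" using bij by (auto simp: bij_betw_def)
  obtain g where "homeomorphism halfspace (F ` halfspace) F g"
    by (rule invariance_of_domain_homeomorphism[OF open_halfspace continuous_F order_refl inj])
  then show ?thesis unfolding im by (rule exI[of "homeomorphism halfspace halfspace F" g])
qed

lemma pull_set_image:
  assumes "S \<subseteq> halfspace"
  shows "F ` pull_set S = S"
proof
  show "F ` pull_set S \<subseteq> S" by (auto simp: pull_set_def)
  show "S \<subseteq> F ` pull_set S"
  proof
    fix s assume s: "s \<in> S"
    have "s \<in> F ` halfspace" using bij s assms by (auto simp: bij_betw_def)
    then obtain x where "x \<in> halfspace" "s = F x" by (rule imageE)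
    then show "s \<in> F ` pull_set S" using s by (simp add: pull_set_def)
  qed
qed

lemma pull_set_eq_image:
  assumes "homeomorphism halfspace halfspace F g" "S \<subseteq> halfspace"
  shows "pull_set S = g ` S"
proof
  show "pull_set S \<subseteq> g ` S"
  proof
    fix x assume "x \<in> pull_set S"
    then have x: "x \<in> halfspace" "F x \<in> S" by (auto simp: pull_set_def)
    then show "x \<in> g ` S" using homeomorphism_apply1[OF assms(1) x(1)] by (intro image_eqI[of _ _ "F x"]) auto
  qed
  show "g ` S \<subseteq> pull_set S"
  proof (rule image_subsetI)
    fix s assume s: "s \<in> S"
    then have sH: "s \<in> halfspace" using assms(2) by blast
    have "g s \<in> halfspace" using homeomorphism_image2[OF assms(1)] sH by blast
    moreover have "F (g s) = s" by (rule homeomorphism_apply2[OF assms(1) sH])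
    ultimately show "g s \<in> pull_set S" using s by (simp add: pull_set_def)
  qed
qed

lemma pull_set_connected:
  assumes "connected S" "S \<subseteq> halfspace"
  shows "connected (pull_set S)"
proof -
  obtain g where g: "homeomorphism halfspace halfspace F g" using inverse_exists ..
  have "continuous_on S g" by (rule continuous_on_subset[OF homeomorphism_cont2[OF g] assms(2)])
  then show ?thesis unfolding pull_set_eq_image[OF g assms(2)] using assms(1) by (rule connected_continuous_image)
qed

lemma pull_set_compact:
  assumes "compact S" "S \<subseteq> halfspace"
  shows "compact (pull_set S)"
proof -
  obtain g where g: "homeomorphism halfspace halfspace F g" using inverse_exists ..
  have "continuous_on S g" by (rule continuous_on_subset[OF homeomorphism_cont2[OF g] assms(2)])
  then show ?thesis unfolding pull_set_eq_image[OF g assms(2)] using assms(1) by (rule compact_continuous_image)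
qed

lemma pull_set_proper:
  assumes proper: "\<And>K. compact K \<Longrightarrow> K \<subseteq> halfspace \<Longrightarrow> compact (S \<inter> K)" and K: "compact K" "K \<subseteq> halfspace"
  shows "compact (pull_set S \<inter> K)"
proof -
  have "compact (F ` K)" by (rule compact_continuous_image[OF continuous_on_subset[OF continuous_F K(2)] K(1)])
  moreover have FK: "F ` K \<subseteq> halfspace" using F_in_halfspace K by blast
  ultimately have "compact (S \<inter> F ` K)" by (rule proper)
  moreover have "pull_set S \<inter> K = pull_set (S \<inter> F ` K)"
  proof
    show "pull_set S \<inter> K \<subseteq> pull_set (S \<inter> F ` K)" by (auto simp: pull_set_def)
    show "pull_set (S \<inter> F ` K) \<subseteq> pull_set S \<inter> K"
    proof
      fix x assume "x \<in> pull_set (S \<inter> F ` K)"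
      then have x: "x \<in> halfspace" "F x \<in> S" "F x \<in> F ` K" by (auto simp: pull_set_def)
      from x(3) obtain k where k: "F x = F k" "k \<in> K" by (rule imageE)
      have "x = k"
        by (rule inj_onD[OF bij_betw_imp_inj_on[OF bij] k(1) x(1)]) (use k(2) K(2) in blast)
      then show "x \<in> pull_set S \<inter> K" using x k by (simp add: pull_set_def)
    qed
  qed
  moreover have "S \<inter> F ` K \<subseteq> halfspace" using FK by blast
  ultimately show ?thesis using pull_set_compact[of "S \<inter> F ` K"] by simp
qed

text \<open>
  A defining function of \<open>S\<close> is composed with \<open>F\<close>; its gradient does not vanish because \<open>F' x\<close> is bijective.
\<close>

lemma pull_set_hypersurface:
  assumes S: "C2_hypersurface S"
  shows "C2_hypersurface (pull_set S)"
  unfolding C2_hypersurface_def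
proof (intro conjI ballI)
  show "pull_set S \<subseteq> halfspace" by (auto simp: pull_set_def)
  fix p assume p: "p \<in> pull_set S"
  then have pH: "p \<in> halfspace" and "F p \<in> S" by (auto simp: pull_set_def)
  have "\<exists>U (f :: 'n pt \<Rightarrow> real). open U \<and> F p \<in> U \<and> U \<subseteq> halfspace \<and> C2_on U f \<and>
       (\<forall>x\<in>U. frechet_derivative f (at x) \<noteq> (\<lambda>_. 0)) \<and> S \<inter> U = {x \<in> U. f x = 0}"
    using S \<open>F p \<in> S\<close> unfolding C2_hypersurface_def by (elim conjE) (rule bspec)
  then obtain U and f :: "'n pt \<Rightarrow> real" where U: "open U" "F p \<in> U" "U \<subseteq> halfspace" "C2_on U f"
    and nz: "\<And>x. x \<in> U \<Longrightarrow> frechet_derivative f (at x) \<noteq> (\<lambda>_. 0)" and SU: "S \<inter> U = {x \<in> U. f x = 0}"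
    by (elim exE conjE) (rule that, assumption+, erule (1) bspec, assumption)
  define V where "V = halfspace \<inter> F -` U"
  have V: "open V" "p \<in> V" "V \<subseteq> halfspace"
    using continuous_open_preimage[OF continuous_F open_halfspace U(1)] pH U(2) by (auto simp: V_def)
  have c2: "C2_on V (\<lambda>x. f (F x))"
  proof (rule C2_on_compose[OF U(4)])
    show "C2_on V F" using C2_F V(3) unfolding C2_on_def by (meson continuous_on_subset subsetD)
  qed (auto simp: V_def)
  obtain f' where f': "\<And>x. x \<in> U \<Longrightarrow> (f has_derivative blinfun_apply (f' x)) (at x)"
    using U(4) unfolding C2_on_def by blast
  have "frechet_derivative (\<lambda>x. f (F x)) (at x) \<noteq> (\<lambda>_. 0)" if x: "x \<in> V" for x
  proof
    assume z: "frechet_derivative (\<lambda>x. f (F x)) (at x) = (\<lambda>_. 0)"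
    have xH: "x \<in> halfspace" and FU: "F x \<in> U" using x by (auto simp: V_def)
    have d: "((\<lambda>x. f (F x)) has_derivative (\<lambda>v. f' (F x) (F' x v))) (at x)"
      by (rule has_derivative_compose[OF F'[OF xH] f'[OF FU]])
    have "(\<lambda>v. blinfun_apply (f' (F x)) (F' x v)) = (\<lambda>_. 0)"
      using frechet_derivative_at[OF d] z by simp
    then have "blinfun_apply (f' (F x)) (F' x v) = 0" for v by (rule fun_cong)
    then have "blinfun_apply (f' (F x)) w = 0" for w 
    proof -
      obtain v where "w = F' x v" using F'_surj[OF xH] by (rule surjE)
      then show ?thesis by (simp add: \<open>\<And>v. blinfun_apply (f' (F x)) (F' x v) = 0\<close>)
    qed
    then have "blinfun_apply (f' (F x)) = (\<lambda>_. 0)" by (rule ext)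
    then show False using nz[OF FU] frechet_derivative_at[OF f'[OF FU]] by simp
  qed
  note nz' = this
  have level: "pull_set S \<inter> V = {x \<in> V. f (F x) = 0}" (is "?l = ?r")
  proof (intro set_eqI iffI)
    fix x assume "x \<in> ?l"
    then have "x \<in> V" "F x \<in> S \<inter> U" by (auto simp: pull_set_def V_def)
    then show "x \<in> ?r" unfolding SU by simp
  next
    fix x assume "x \<in> ?r"
    then have "x \<in> V" "F x \<in> S \<inter> U" unfolding SU by (auto simp: V_def)
    then show "x \<in> ?l" by (auto simp: pull_set_def V_def)
  qed
  show "\<exists>U (f :: 'n pt \<Rightarrow> real). open U \<and> p \<in> U \<and> U \<subseteq> halfspace \<and> C2_on U f \<and>
       (\<forall>x\<in>U. frechet_derivative f (at x) \<noteq> (\<lambda>_. 0)) \<and> pull_set S \<inter> U = {x \<in> U. f x = 0}"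
    by (rule exI[of _ V], rule exI[of _ "\<lambda>x. f (F x)"], intro conjI V c2 level ballI nz')
qed

lemma tangent_push:
  assumes "X \<in> tangent_space (pull_set S) p" and p: "p \<in> halfspace"
  shows "F' p X \<in> tangent_space S (F p)"
proof -
  obtain \<gamma> \<epsilon> where \<gamma>: "\<epsilon> > 0" "\<gamma> ` {-\<epsilon><..<\<epsilon>} \<subseteq> pull_set S" "\<gamma> 0 = p" "(\<gamma> has_vector_derivative X) (at 0)"
    using assms by (auto simp: tangent_space_def)
  have "(F has_derivative blinfun_apply (F' p)) (at (\<gamma> 0))" using F'[OF p] \<gamma>(3) by simp
  from has_derivative_compose[OF \<gamma>(4)[unfolded has_vector_derivative_def] this]
  have "((\<lambda>t. F (\<gamma> t)) has_vector_derivative F' p X) (at 0)"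
    by (simp add: has_vector_derivative_def blinfun.scaleR_right)
  moreover have "(\<lambda>t. F (\<gamma> t)) ` {-\<epsilon><..<\<epsilon>} \<subseteq> S" using \<gamma>(2) by (auto simp: pull_set_def)
  ultimately show ?thesis using \<gamma>(1,3) unfolding tangent_space_def
    by (intro CollectI exI[of _ "\<lambda>t. F (\<gamma> t)"] exI[of _ \<epsilon>]) simp
qed

lemma pull_field_unit_normal:
  assumes \<nu>: "unit_normal_field S \<nu>"
  shows "unit_normal_field (pull_set S) (pull_field \<nu>)"
  unfolding unit_normal_field_def
proof (intro conjI ballI)
  have sub: "pull_set S \<subseteq> halfspace" by (auto simp: pull_set_def)
  have c1: "continuous_on (pull_set S) F" "continuous_on (pull_set S) F'" using continuous_F continuous_F' sub continuous_on_subset by blast+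
  have "F ` pull_set S \<subseteq> S" by (auto simp: pull_set_def)
  then have c2: "continuous_on (pull_set S) (\<lambda>x. \<nu> (F x))"
    using \<nu> c1(1) continuous_on_compose2 unfolding unit_normal_field_def by blast
  have nz: "snd x \<noteq> 0" "snd (F x) \<noteq> 0" if "x \<in> pull_set S" for x using heights_pos[of x] sub that by auto
  have c3: "continuous_on (pull_set S) (\<lambda>x. 1 / conformal_factor x)"
    unfolding conformal_factor_def by (intro continuous_intros c1 ballI) (auto simp: nz)
  have "continuous_on (pull_set S) (\<lambda>x. \<Sum>b\<in>Basis. inner (F' x b) (\<nu> (F x)) *\<^sub>R b)"
    by (intro continuous_intros c1 c2)
  then show "continuous_on (pull_set S) (pull_field \<nu>)"
    unfolding pull_field_def pull_def by (rule continuous_on_scaleR[OF c3])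
  fix p assume p: "p \<in> pull_set S"
  then have pH: "p \<in> halfspace" and FS: "F p \<in> S" by (auto simp: pull_set_def)
  show "hyp_metric p (pull_field \<nu> p) (pull_field \<nu> p) = 1"
    using \<nu> FS unfolding metric[OF pH, symmetric] F'_pull_field[OF pH] unit_normal_field_def by blast
  fix X assume "X \<in> tangent_space (pull_set S) p"
  then have "F' p X \<in> tangent_space S (F p)" by (rule tangent_push[OF _ pH])
  then show "hyp_metric p (pull_field \<nu> p) X = 0"
    using \<nu> FS unfolding metric[OF pH, symmetric] F'_pull_field[OF pH] unit_normal_field_def by blast
qed

lemma normal_field_has_derivative:
  assumes "C2_hypersurface S" "unit_normal_field S \<nu>" "p \<in> S"
  shows "(\<nu> has_derivative frechet_derivative \<nu> (at p within S)) (at p within S)"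
proof -
  obtain U f G G' where U: "p \<in> U" "oriented_chart S \<nu> U f G G'"
    using oriented_chart_exists[OF assms(1,3,2)] by (elim exE conjE) (rule that)
  show ?thesis
    using oriented_chart_normal_derivative[OF U(2) assms(3) U(1)] differentiableI frechet_derivative_works by blast
qed

text \<open>
  The identity \<open>\<nu> (F x) = F' x (pull_field \<nu> x)\<close> is differentiated along a curve with velocity \<open>X\<close>; the extra term with \<open>F''\<close> is
  absorbed by \<open>christoffel_transform\<close>.
\<close>

lemma levi_civita_push:
  assumes S: "C2_hypersurface S" "unit_normal_field S \<nu>" and p: "p \<in> pull_set S"
    and X: "X \<in> tangent_space (pull_set S) p"
  shows "levi_civita S \<nu> (F p) (F' p X) = F' p (levi_civita (pull_set S) (pull_field \<nu>) p X)"
proof -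
  have pH: "p \<in> halfspace" and FS: "F p \<in> S" using p by (auto simp: pull_set_def)
  let ?D = "frechet_derivative \<nu> (at (F p) within S)"
  let ?D' = "frechet_derivative (pull_field \<nu>) (at p within pull_set S)"
  have D: "(\<nu> has_derivative ?D) (at (F p) within S)" by (rule normal_field_has_derivative[OF S FS])
  have D': "(pull_field \<nu> has_derivative ?D') (at p within pull_set S)"
    by (rule normal_field_has_derivative[OF pull_set_hypersurface[OF S(1)] pull_field_unit_normal[OF S(2)] p])
  obtain \<gamma> \<epsilon> where \<gamma>: "\<epsilon> > 0" "\<gamma> ` {-\<epsilon><..<\<epsilon>} \<subseteq> pull_set S" "\<gamma> 0 = p" "(\<gamma> has_vector_derivative X) (at 0)"
    using X by (auto simp: tangent_space_def)
  have v1: "((\<lambda>t. pull_field \<nu> (\<gamma> t)) has_vector_derivative ?D' X) (at 0)"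
    by (rule derivative_along_tangent_curve[OF D' \<gamma>])
  have "(F has_derivative blinfun_apply (F' p)) (at (\<gamma> 0))" using F'[OF pH] \<gamma>(3) by simp
  from has_derivative_compose[OF \<gamma>(4)[unfolded has_vector_derivative_def] this]
  have F\<gamma>: "((\<lambda>t. F (\<gamma> t)) has_vector_derivative F' p X) (at 0)"
    by (simp add: has_vector_derivative_def blinfun.scaleR_right)
  have F\<gamma>S: "(\<lambda>t. F (\<gamma> t)) ` {-\<epsilon><..<\<epsilon>} \<subseteq> S" using \<gamma>(2) by (auto simp: pull_set_def)
  have v2: "((\<lambda>t. \<nu> (F (\<gamma> t))) has_vector_derivative ?D (F' p X)) (at 0)"
    by (rule derivative_along_tangent_curve[OF D \<gamma>(1) F\<gamma>S _ F\<gamma>]) (simp add: \<gamma>(3))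
  have "(F' has_derivative blinfun_apply (F'' p)) (at (\<gamma> 0))" using F''[OF pH] \<gamma>(3) by simp
  from has_derivative_compose[OF \<gamma>(4)[unfolded has_vector_derivative_def] this]
  have F'\<gamma>: "((\<lambda>t. F' (\<gamma> t)) has_derivative (\<lambda>t. t *\<^sub>R F'' p X)) (at 0)"
    by (simp add: blinfun.scaleR_right)
  from bounded_bilinear.FDERIV[OF bounded_bilinear_blinfun_apply F'\<gamma> v1[unfolded has_vector_derivative_def]]
  have v3: "((\<lambda>t. F' (\<gamma> t) (pull_field \<nu> (\<gamma> t))) has_vector_derivative (F' p (?D' X) + F'' p X (pull_field \<nu> p))) (at 0)"
    by (simp add: has_vector_derivative_def \<gamma>(3) blinfun.scaleR_right blinfun.scaleR_left scaleR_add_right)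
  have "((\<lambda>t. \<nu> (F (\<gamma> t))) has_vector_derivative (F' p (?D' X) + F'' p X (pull_field \<nu> p))) (at 0)"
  proof (rule has_vector_derivative_transform_within_open[OF v3, of "{-\<epsilon><..<\<epsilon>}"])
    fix t assume "t \<in> {-\<epsilon><..<\<epsilon>}"
    then have "\<gamma> t \<in> pull_set S" using \<gamma>(2) by blast
    then have "\<gamma> t \<in> halfspace" by (simp add: pull_set_def)
    then show "F' (\<gamma> t) (pull_field \<nu> (\<gamma> t)) = \<nu> (F (\<gamma> t))" by (rule F'_pull_field)
  qed (use \<gamma>(1) in auto)
  from vector_derivative_unique_at[OF this v2]
  have e: "?D (F' p X) = F' p (?D' X) + F'' p X (pull_field \<nu> p)" by simp
  have "levi_civita S \<nu> (F p) (F' p X) = F' p (?D' X) + (F'' p X (pull_field \<nu> p) + christoffel (F p) (F' p X) (F' p (pull_field \<nu> p)))"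
    unfolding levi_civita_def e F'_pull_field[OF pH] by simp
  also have "\<dots> = F' p (?D' X) + F' p (christoffel p X (pull_field \<nu> p))"
    unfolding christoffel_transform[OF pH] ..
  finally show ?thesis by (simp add: levi_civita_def blinfun.add_right)
qed

theorem elem_sym_pull:
  assumes S: "C2_hypersurface S" "unit_normal_field S \<nu>" and p: "p \<in> pull_set S"
  shows "elem_sym r (principal_curvatures S \<nu> (F p)) =
    elem_sym r (principal_curvatures (pull_set S) (pull_field \<nu>) p)"
proof -
  have pH: "p \<in> halfspace" and FS: "F p \<in> S" using p by (auto simp: pull_set_def)
  let ?k = "principal_curvatures (pull_set S) (pull_field \<nu>) p"
  obtain e where e: "eigenframe (pull_set S) (pull_field \<nu>) p ?k e"
    using principal_curvatures_eigenframe[OF pull_set_hypersurface[OF S(1)] pull_field_unit_normal[OF S(2)] p]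
    by (elim exE) (rule that)
  have "eigenframe S \<nu> (F p) ?k (\<lambda>i. F' p (e i))"
    unfolding eigenframe_def
  proof (intro conjI allI)
    fix i j
    have ei: "e i \<in> tangent_space (pull_set S) p" using e by (simp add: eigenframe_def)
    show "F' p (e i) \<in> tangent_space S (F p)" by (rule tangent_push[OF ei pH])
    show "hyp_metric (F p) (F' p (e i)) (F' p (e j)) = (if i = j then 1 else 0)"
      unfolding metric[OF pH] using e by (simp add: eigenframe_def)
    have sh: "shape_operator (pull_set S) (pull_field \<nu>) p (e i) = ?k i *\<^sub>R e i" using e by (simp add: eigenframe_def)
    have lc: "levi_civita (pull_set S) (pull_field \<nu>) p (e i) = - (?k i *\<^sub>R e i)"
      using arg_cong[OF sh, of uminus] by (simp only: shape_operator_def minus_minus)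
    show "shape_operator S \<nu> (F p) (F' p (e i)) = ?k i *\<^sub>R F' p (e i)"
      unfolding shape_operator_def levi_civita_push[OF S p ei] lc
      by (simp add: blinfun.minus_right blinfun.scaleR_right)
  qed
  then show ?thesis by (rule elem_sym_principal_curvatures[OF S FS])
qed

end

lemma hyp_isometry_derivatives:
  assumes "hyp_isometry F"
  shows "\<exists>F' F''. isometry_derivatives F F' F''"
proof -
  note a = assms[unfolded hyp_isometry_def]
  note h = conjunct1[OF a] conjunct1[OF conjunct2[OF a]] conjunct2[OF conjunct2[OF a]]
  obtain F' F'' where F: "\<forall>x\<in>halfspace. (F has_derivative blinfun_apply (F' x)) (at x)"
    "\<forall>x\<in>halfspace. (F' has_derivative blinfun_apply (F'' x)) (at x)" "continuous_on halfspace F''"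
    using h(2) unfolding C2_on_def by (elim exE conjE) (rule that)
  have "hyp_metric (F x) (F' x u) (F' x v) = hyp_metric x u v" if x: "x \<in> halfspace" for x u v
  proof -
    have "frechet_derivative F (at x) = blinfun_apply (F' x)"
      using frechet_derivative_at[OF bspec[OF F(1) x]] by simp
    then show ?thesis using bspec[OF h(3) x, rule_format, of u v] by (simp only:)
  qed
  note m = this
  have "isometry_derivatives F F' F''"
    by (rule isometry_derivatives.intro[OF h(1) bspec[OF F(1)] bspec[OF F(2)] F(3) m])
  then have "\<exists>F''. isometry_derivatives F F' F''" by (rule exI[of "isometry_derivatives F F'" F''])
  then show ?thesis by (rule exI[of "\<lambda>F'. \<exists>F''. isometry_derivatives F F' F''" F'])
qed


section \<open>Horospheres and equidistant spheres are isometric to hyperplanes\<close>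

text \<open>
  The inversion at the unit sphere around \<open>A\<close>; for a centre on the boundary hyperplane it is an isometry of the
  half-space.
\<close>

definition inversion :: "'n::finite pt \<Rightarrow> 'n pt \<Rightarrow> 'n pt"
  where "inversion A x = A + (1 / inner (x - A) (x - A)) *\<^sub>R (x - A)"

lemma boundary_difference_nonzero:
  assumes "snd A = 0" "x \<in> halfspace"
  shows "inner (x - A) (x - A) > 0" and "inner (x - A) (x - A) \<noteq> 0"
proof -
  have "snd (x - A) > 0" using assms by (simp add: halfspace_def)
  then have "x - A \<noteq> 0" by (metis snd_zero less_irrefl)
  then show "inner (x - A) (x - A) > 0" "inner (x - A) (x - A) \<noteq> 0" by simp_all
qed

lemma inversion_involution:
  assumes "inner (x - A) (x - A) \<noteq> 0"
  shows "inversion A (inversion A x) = x"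
proof -
  let ?d = "x - A" and ?q = "1 / inner (x - A) (x - A)"
  have i: "inversion A x - A = ?q *\<^sub>R ?d" by (simp add: inversion_def)
  have "inner ((1 / inner d d) *\<^sub>R d) ((1 / inner d d) *\<^sub>R d) = 1 / inner d d" if "inner d d \<noteq> 0" for d :: "'a pt"
    using that by simp
  from this[OF assms] have "inner (?q *\<^sub>R ?d) (?q *\<^sub>R ?d) = ?q" .
  then have "inversion A (inversion A x) = A + (1 / ?q) *\<^sub>R (?q *\<^sub>R ?d)"
    unfolding inversion_def[of A "inversion A x"] i by simp
  then show ?thesis using assms by simp
qed

lemma inversion_halfspace:
  assumes "snd A = 0" "x \<in> halfspace"
  shows "inversion A x \<in> halfspace"
  using boundary_difference_nonzero[OF assms] assms by (simp add: inversion_def halfspace_def)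

definition rank_one :: "'n::finite pt \<Rightarrow> 'n pt \<Rightarrow> 'n pt \<Rightarrow>\<^sub>L 'n pt"
  where "rank_one a b = blinfun_scaleR_left a o\<^sub>L blinfun_inner_right b"

lemma rank_one_apply: "blinfun_apply (rank_one a b) h = inner b h *\<^sub>R a"
  by (simp add: rank_one_def blinfun_inner_right.rep_eq blinfun_scaleR_left.rep_eq)

lemma rank_one_has_derivative:
  "((\<lambda>x. rank_one (x - A) (x - A)) has_derivative (\<lambda>h. rank_one (x - A) h + rank_one h (x - A))) (at x)"
proof -
  have d: "((\<lambda>x. x - A) has_derivative (\<lambda>h. h)) (at x)" by (auto intro!: derivative_eq_intros)
  show ?thesis
    unfolding rank_one_def
    by (rule bounded_bilinear.FDERIV[OF bounded_bilinear_blinfun_compose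
          bounded_linear.has_derivative[OF bounded_linear_blinfun_scaleR_left d]
          bounded_linear.has_derivative[OF bounded_linear_blinfun_inner_right d]])
qed

lemma continuous_on_rank_one:
  assumes "continuous_on U f" "continuous_on U g"
  shows "continuous_on U (\<lambda>x. rank_one (f x) (g x))"
  unfolding rank_one_def
  by (intro continuous_intros bounded_linear.continuous_on[OF bounded_linear_blinfun_scaleR_left]
      bounded_linear.continuous_on[OF bounded_linear_blinfun_inner_right] assms)

lemma inversion_C2:
  assumes A: "snd A = 0"
  defines "q \<equiv> \<lambda>x. 1 / inner (x - A) (x - A)"
  defines "J' \<equiv> \<lambda>x. q x *\<^sub>R id_blinfun - (2 * (q x)\<^sup>2) *\<^sub>R rank_one (x - A) (x - A)"
  shows "\<And>x. x \<in> halfspace \<Longrightarrow> (inversion A has_derivative blinfun_apply (J' x)) (at x)"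
    and "C2_on halfspace (inversion A)"
proof -
  have qd: "(q has_derivative (\<lambda>h. - 2 * (q x)\<^sup>2 * inner (x - A) h)) (at x)" if "x \<in> halfspace" for x
    unfolding q_def using boundary_difference_nonzero[OF A that]
    by (auto intro!: derivative_eq_intros simp: inner_commute power2_eq_square field_simps)
  show J': "(inversion A has_derivative blinfun_apply (J' x)) (at x)" if x: "x \<in> halfspace" for x
  proof -
    have inv: "inversion A = (\<lambda>x. A + q x *\<^sub>R (x - A))" by (auto simp: inversion_def q_def)
    show ?thesis
      unfolding inv
      by (rule has_derivative_eq_rhs, (rule derivative_intros qd[OF x])+)
        (auto simp: J'_def blinfun.diff_left blinfun.scaleR_left rank_one_apply algebra_simps)
  qed
  define D where "D x h = (- 2 * (q x)\<^sup>2 * inner (x - A) h) *\<^sub>R id_blinfun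
     - ((2 * (q x)\<^sup>2) *\<^sub>R (rank_one (x - A) h + rank_one h (x - A))
        + (2 * (2 * q x * (- 2 * (q x)\<^sup>2 * inner (x - A) h))) *\<^sub>R rank_one (x - A) (x - A))" for x h
  have J'': "(J' has_derivative D x) (at x)" if x: "x \<in> halfspace" for x
  proof -
    have q2: "((\<lambda>x. 2 * (q x)\<^sup>2) has_derivative (\<lambda>h. 2 * (2 * q x * (- 2 * (q x)\<^sup>2 * inner (x - A) h)))) (at x)"
      by (auto intro!: derivative_eq_intros qd[OF x] simp: power2_eq_square algebra_simps)
    have a: "((\<lambda>x. q x *\<^sub>R (id_blinfun :: 'a pt \<Rightarrow>\<^sub>L 'a pt)) has_derivative (\<lambda>h. (- 2 * (q x)\<^sup>2 * inner (x - A) h) *\<^sub>R id_blinfun)) (at x)"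
      by (rule has_derivative_scaleR_left[OF qd[OF x]])
    show ?thesis
      unfolding J'_def D_def
      by (rule has_derivative_diff[OF a has_derivative_scaleR[OF q2 rank_one_has_derivative]])
  qed
  have ap: "blinfun_apply (Blinfun (D x)) = D x" if "x \<in> halfspace" for x
    using has_derivative_bounded_linear[OF J''[OF that]] by (rule bounded_linear_Blinfun_apply)
  have "continuous_on halfspace (\<lambda>x. Blinfun (D x))"
  proof (rule continuous_on_blinfun_componentwise)
    fix i :: "'a pt" assume "i \<in> Basis"
    have cq: "continuous_on halfspace q"
      unfolding q_def using boundary_difference_nonzero(2)[OF A] by (intro continuous_intros) blast
    have "continuous_on halfspace (\<lambda>x. D x i)"
      unfolding D_def by (intro continuous_intros cq continuous_on_rank_one)
    then show "continuous_on halfspace (\<lambda>x. blinfun_apply (Blinfun (D x)) i)"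
      by (rule continuous_on_eq) (simp add: ap)
  qed
  note cD = this
  have dD: "(J' has_derivative blinfun_apply (Blinfun (D x))) (at x)" if "x \<in> halfspace" for x
    unfolding ap[OF that] by (rule J''[OF that])
  show "C2_on halfspace (inversion A)"
    unfolding C2_on_def
    by (rule exI[of _ J'], rule exI[of _ "\<lambda>x. Blinfun (D x)"], intro conjI ballI J' dD cD)
qed

lemma hyp_isometry_inversion:
  fixes A :: "'n::finite pt"
  assumes A: "snd A = 0"
  shows "hyp_isometry (inversion A)"
  unfolding hyp_isometry_def
proof (intro conjI ballI allI)
  show "bij_betw (inversion A) halfspace halfspace"
    by (rule bij_betwI[where g = "inversion A"])
      (auto simp: inversion_halfspace[OF A] inversion_involution[OF boundary_difference_nonzero(2)[OF A]] simp del: prod.collapse)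
  show "C2_on halfspace (inversion A)" by (rule inversion_C2(2)[OF A])
  fix p u v :: "'n pt" assume p: "p \<in> halfspace"
  define d where "d = p - A"
  define q where "q = 1 / inner d d"
  have dd: "inner d d \<noteq> 0" "inner d d > 0" using boundary_difference_nonzero[OF A p] by (auto simp: d_def)
  have fd: "frechet_derivative (inversion A) (at p) h = q *\<^sub>R h - (2 * q\<^sup>2 * inner d h) *\<^sub>R d" for h
    unfolding frechet_derivative_at[OF inversion_C2(1)[OF A p], symmetric]
    by (simp add: blinfun.diff_left blinfun.scaleR_left rank_one_apply d_def q_def)
  have qd: "q * inner d d = 1" using dd by (simp add: q_def)
  have "inner (q *\<^sub>R u - (2 * q\<^sup>2 * inner d u) *\<^sub>R d) (q *\<^sub>R v - (2 * q\<^sup>2 * inner d v) *\<^sub>R d)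
    = q\<^sup>2 * inner u v - 4 * q ^ 3 * inner d u * inner d v + 4 * q ^ 3 * inner d u * inner d v * (q * inner d d)"
    using inner_commute[of u d]
    by (simp add: inner_diff_left inner_diff_right power2_eq_square power3_eq_cube algebra_simps)
  also have "\<dots> = q\<^sup>2 * inner u v" unfolding qd by simp
  finally have i: "inner (q *\<^sub>R u - (2 * q\<^sup>2 * inner d u) *\<^sub>R d) (q *\<^sub>R v - (2 * q\<^sup>2 * inner d v) *\<^sub>R d) = q\<^sup>2 * inner u v" .
  have s: "snd (inversion A p) = q * snd p" using A by (simp add: inversion_def d_def q_def)
  have "q \<noteq> 0" "snd p \<noteq> 0" using dd p by (auto simp: q_def halfspace_def)
  then show "hyp_metric (inversion A p) (frechet_derivative (inversion A) (at p) u) (frechet_derivative (inversion A) (at p) v)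
    = hyp_metric p u v"
    unfolding hyp_metric_def fd i s by (simp add: power_mult_distrib)
qed

lemma hyp_isometry_id: "hyp_isometry (\<lambda>x :: 'n::finite pt. x)"
proof -
  have "C2_on halfspace (\<lambda>x::'n pt. x)"
    unfolding C2_on_def
    by (intro exI[of _ "\<lambda>_. id_blinfun"] exI[of _ "\<lambda>_. 0"]) (auto intro!: derivative_eq_intros simp: blinfun.zero_left id_def)
  moreover have "frechet_derivative (\<lambda>x. x) (at p) = (\<lambda>x. x)" for p :: "'n pt"
    by (rule frechet_derivative_at[symmetric]) (rule has_derivative_ident)
  ultimately show ?thesis unfolding hyp_isometry_def by (simp add: bij_betw_def)
qed

lemma hyp_isometry_compose:
  fixes F K :: "'n::finite pt \<Rightarrow> 'n pt"
  assumes F: "hyp_isometry F" and K: "hyp_isometry K"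
  shows "hyp_isometry (\<lambda>x. F (K x))"
proof -
  obtain F' F'' where "isometry_derivatives F F' F''" using hyp_isometry_derivatives[OF F] by (elim exE) (rule that)
  then interpret F: isometry_derivatives F F' F'' .
  obtain K' K'' where "isometry_derivatives K K' K''" using hyp_isometry_derivatives[OF K] by (elim exE) (rule that)
  then interpret K: isometry_derivatives K K' K'' .
  have "bij_betw (\<lambda>x. F (K x)) halfspace halfspace"
    using bij_betw_trans[OF K.bij F.bij] by (simp add: comp_def)
  moreover have "C2_on halfspace (\<lambda>x. F (K x))"
    by (rule C2_on_compose[OF F.C2_F K.C2_F]) (use K.F_in_halfspace in blast)
  moreover have "hyp_metric (F (K p)) (frechet_derivative (\<lambda>x. F (K x)) (at p) u) (frechet_derivative (\<lambda>x. F (K x)) (at p) v) = hyp_metric p u v"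
    if p: "p \<in> halfspace" for p u v
  proof -
    have "((\<lambda>x. F (K x)) has_derivative (\<lambda>h. F' (K p) (K' p h))) (at p)"
      by (rule has_derivative_compose[OF K.F'[OF p] F.F'[OF K.F_in_halfspace[OF p]]])
    then have fd: "frechet_derivative (\<lambda>x. F (K x)) (at p) = (\<lambda>h. F' (K p) (K' p h))"
      by (rule frechet_derivative_at[symmetric])
    show ?thesis unfolding fd using F.metric[OF K.F_in_halfspace[OF p]] K.metric[OF p] by simp
  qed
  ultimately show ?thesis unfolding hyp_isometry_def by blast
qed

text \<open>
  Inversion at a point of a sphere maps the sphere to a hyperplane.
\<close>

lemma sphere_through_boundary_point:
  fixes A C :: "'n::finite pt"
  assumes A: "snd A = 0" and \<rho>: "\<rho> > 0" and AC: "norm (C - A) = \<rho>"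
  defines "N \<equiv> (1 / \<rho>) *\<^sub>R (C - A)"
  shows "sphere C \<rho> \<inter> halfspace = inversion A ` hyperplane N ((1 / \<rho>) * (1 / 2 + inner A (C - A)))"
proof -
  have inv: "inversion A (inversion A x) = x" if "x \<in> halfspace" for x
    by (rule inversion_involution[OF boundary_difference_nonzero(2)[OF A that]])
  have key: "x \<in> sphere C \<rho> \<longleftrightarrow> inner (inversion A x) N = (1 / \<rho>) * (1 / 2 + inner A (C - A))" if x: "x \<in> halfspace" for x
  proof -
    define d where "d = x - A"
    have dd: "inner d d > 0" using boundary_difference_nonzero(1)[OF A x] by (simp add: d_def)
    have "x \<in> sphere C \<rho> \<longleftrightarrow> (norm (d - (C - A)))\<^sup>2 = \<rho>\<^sup>2"
      using \<rho> by (simp add: d_def dist_norm norm_minus_commute)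
    also have "(norm (d - (C - A)))\<^sup>2 = inner d d - 2 * inner d (C - A) + \<rho>\<^sup>2"
      using inner_commute[of "C - A" d] unfolding power2_norm_eq_inner AC[symmetric]
      by (simp add: inner_diff_left[of d "C - A"] inner_diff_right[of _ d "C - A"])
    also have "inner d d - 2 * inner d (C - A) + \<rho>\<^sup>2 = \<rho>\<^sup>2 \<longleftrightarrow> inner d (C - A) / inner d d = 1 / 2"
      using dd by (auto simp: field_simps)
    also have "inner d (C - A) / inner d d = inner (inversion A x) (C - A) - inner A (C - A)"
      by (simp add: inversion_def d_def[symmetric] inner_add_left)
    also have "inner (inversion A x) (C - A) - inner A (C - A) = 1 / 2 \<longleftrightarrow> inner (inversion A x) N = (1 / \<rho>) * (1 / 2 + inner A (C - A))"
    proof -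
      have "inner (inversion A x) N = (1 / \<rho>) * inner (inversion A x) (C - A)" by (simp only: N_def inner_scaleR_right)
      then show ?thesis using \<rho> by (simp only: mult_cancel_left) auto
    qed
    finally show ?thesis .
  qed
  show ?thesis
  proof (intro set_eqI iffI)
    fix x assume x: "x \<in> sphere C \<rho> \<inter> halfspace"
    then have "inversion A x \<in> hyperplane N ((1 / \<rho>) * (1 / 2 + inner A (C - A)))"
      using key[of x] inversion_halfspace[OF A, of x] by (simp add: hyperplane_def)
    then show "x \<in> inversion A ` hyperplane N ((1 / \<rho>) * (1 / 2 + inner A (C - A)))"
      using inv[of x] x by (intro image_eqI[of _ _ "inversion A x"]) auto
  next
    fix x assume "x \<in> inversion A ` hyperplane N ((1 / \<rho>) * (1 / 2 + inner A (C - A)))"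
    then obtain z where z: "x = inversion A z" "z \<in> hyperplane N ((1 / \<rho>) * (1 / 2 + inner A (C - A)))" by (rule imageE)
    have zH: "z \<in> halfspace" using z(2) by (simp add: hyperplane_def)
    have xH: "x \<in> halfspace" unfolding z(1) by (rule inversion_halfspace[OF A zH])
    moreover have "x \<in> sphere C \<rho>"
      unfolding key[OF xH] using z inv[OF zH] by (simp add: hyperplane_def)
    ultimately show "x \<in> sphere C \<rho> \<inter> halfspace" by blast
  qed
qed

text \<open>
  A horosphere that is not horizontal is inverted at its point of tangency, a Euclidean sphere that crosses the boundary
  at one of its boundary points.
\<close>

theorem isometric_to_hyperplane:
  fixes M :: "('n::finite pt) set"
  assumes "horosphere M \<or> equidistant_sphere M"
  shows "\<exists>F N c. hyp_isometry F \<and> norm N = 1 \<and> hyperplane N c \<noteq> {} \<and> M = F ` hyperplane N c"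
proof -
  have sph: "\<exists>N c. norm N = 1 \<and> hyperplane N c \<noteq> {} \<and> sphere C \<rho> \<inter> halfspace = inversion A ` hyperplane N c"
    if A: "snd A = 0" and \<rho>: "\<rho> > 0" and AC: "norm (C - A) = \<rho>" and nn: "snd C + \<rho> > 0" for A C :: "'n pt" and \<rho>
  proof -
    let ?N = "(1 / \<rho>) *\<^sub>R (C - A)" and ?c = "(1 / \<rho>) * (1 / 2 + inner A (C - A))"
    have eq: "sphere C \<rho> \<inter> halfspace = inversion A ` hyperplane ?N ?c"
      by (rule sphere_through_boundary_point[OF A \<rho> AC])
    have "C + (0, \<rho>) \<in> sphere C \<rho> \<inter> halfspace"
      using nn \<rho> by (simp add: halfspace_def dist_norm norm_Pair)
    then have "hyperplane ?N ?c \<noteq> {}" using eq by auto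
    moreover have "norm ?N = 1" using AC \<rho> by simp
    ultimately show ?thesis using eq by blast
  qed
  show ?thesis
    using assms
  proof
    assume "horosphere M"
    then consider c where "c > 0" "M = {p. snd p = c}" | a \<rho> where "\<rho> > 0" "M = sphere (a, \<rho>) \<rho> - {(a, 0)}"
      unfolding horosphere_def by blast
    then show ?thesis
    proof cases
      case 1
      have e: "inner p ((0, 1) :: 'n pt) = snd p" for p :: "'n pt" by (cases p) simp
      have M: "M = hyperplane (0, 1) c" using 1 by (auto simp: hyperplane_def halfspace_def e)
      have "(0, c) \<in> hyperplane ((0, 1) :: 'n pt) c" using 1 by (simp add: hyperplane_def halfspace_def)
      then have "hyperplane ((0, 1) :: 'n pt) c \<noteq> {}" by blast
      moreover have "norm ((0, 1) :: 'n pt) = 1" by (simp add: norm_Pair)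
      ultimately show ?thesis using hyp_isometry_id M
        by (intro exI[of _ "\<lambda>x. x"] exI[of _ "(0, 1)"] exI[of _ c]) simp
    next
      case 2
      have A: "snd (a, 0 :: real) = 0" by simp
      have n: "norm ((a, \<rho>) - (a, 0)) = \<rho>" using 2(1) by (simp add: norm_Pair)
      have M: "M = sphere (a, \<rho>) \<rho> \<inter> halfspace"
      proof (intro set_eqI iffI)
        fix x assume x: "x \<in> M"
        have dx: "dist (a, \<rho>) x = \<rho>" and nx: "x \<noteq> (a, 0)" using x 2(2) by auto
        have "(norm (x - (a, \<rho>)))\<^sup>2 = (norm (fst x - a))\<^sup>2 + (snd x - \<rho>)\<^sup>2"
          by (simp add: norm_prod_def)
        then have d: "(norm (fst x - a))\<^sup>2 + (snd x - \<rho>)\<^sup>2 = \<rho>\<^sup>2"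
          using dx by (simp add: dist_norm norm_minus_commute)
        have "snd x > 0"
        proof (rule ccontr)
          assume "\<not> snd x > 0"
          then have "(snd x - \<rho>)\<^sup>2 = \<rho>\<^sup>2 + (snd x)\<^sup>2 + 2 * (\<rho> * - snd x)" "\<rho> * - snd x \<ge> 0"
            using 2(1) by (simp_all add: power2_eq_square algebra_simps mult_nonneg_nonpos)
          then have "(norm (fst x - a))\<^sup>2 + (snd x)\<^sup>2 \<le> 0" using d by linarith
          then have "norm (fst x - a) = 0 \<and> snd x = 0"
            by (simp only: sum_power2_le_zero_iff)
          then have "x = (a, 0)" by (intro prod_eqI) auto
          then show False using nx by blast
        qed
        then show "x \<in> sphere (a, \<rho>) \<rho> \<inter> halfspace" using x 2(2) by (auto simp: halfspace_def)
      qed (use 2(2) in \<open>auto simp: halfspace_def\<close>)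
      obtain N c where "norm N = 1" "hyperplane N c \<noteq> {}" "M = inversion (a, 0) ` hyperplane N c"
        using sph[OF A 2(1) n] 2(1) M by auto
      then show ?thesis using hyp_isometry_inversion[OF A] by blast
    qed
  next
    assume "equidistant_sphere M"
    then obtain F C \<rho> where F: "hyp_isometry F" and C: "\<bar>snd C\<bar> < \<rho>" and M: "M = F ` (sphere C \<rho> \<inter> halfspace)"
      unfolding equidistant_sphere_def by blast
    have \<rho>: "\<rho> > 0" using C by linarith
    have sq: "(snd C)\<^sup>2 < \<rho>\<^sup>2" using power_strict_mono[of "\<bar>snd C\<bar>" \<rho> 2] C by simp
    obtain w :: "real ^ 'n" where w: "norm w = sqrt (\<rho>\<^sup>2 - (snd C)\<^sup>2)"
      using vector_choose_size[of "sqrt (\<rho>\<^sup>2 - (snd C)\<^sup>2)"] sq by auto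
    define A :: "'n pt" where "A = (fst C + w, 0)"
    have A: "snd A = 0" by (simp add: A_def)
    have "C - A = (- w, snd C)" by (cases C) (simp add: A_def)
    then have "norm (C - A) = sqrt ((norm w)\<^sup>2 + (snd C)\<^sup>2)" by (simp add: norm_Pair)
    also have "\<dots> = \<rho>" using sq \<rho> by (simp add: w)
    finally have n: "norm (C - A) = \<rho>" .
    have "snd C + \<rho> > 0" using C by linarith
    from sph[OF A \<rho> n this] obtain N c where N: "norm N = 1" "hyperplane N c \<noteq> {}"
      "sphere C \<rho> \<inter> halfspace = inversion A ` hyperplane N c" by (elim exE conjE) (rule that)
    have "M = (\<lambda>x. F (inversion A x)) ` hyperplane N c" unfolding M N(3) by (simp add: image_image)
    then show ?thesis using hyp_isometry_compose[OF F hyp_isometry_inversion[OF A]] N(1,2) by blast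
  qed
qed


section \<open>Locality of the curvatures\<close>

lemma tangent_space_diff_closed:
  assumes B: "closed B" "p \<notin> B"
  shows "tangent_space (S - B) p = tangent_space S p"
proof
  show "tangent_space (S - B) p \<subseteq> tangent_space S p" unfolding tangent_space_def by blast
  show "tangent_space S p \<subseteq> tangent_space (S - B) p"
  proof
    fix v assume "v \<in> tangent_space S p"
    then obtain \<gamma> \<epsilon> where \<gamma>: "\<epsilon> > 0" "\<gamma> ` {-\<epsilon><..<\<epsilon>} \<subseteq> S" "\<gamma> 0 = p" "(\<gamma> has_vector_derivative v) (at 0)"
      by (auto simp: tangent_space_def)
    have "isCont \<gamma> 0" using has_vector_derivative_continuous[OF \<gamma>(4)] by simp
    then have "eventually (\<lambda>t. \<gamma> t \<in> - B) (at 0)"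
      using B \<gamma>(3) by (intro topological_tendstoD[of \<gamma> p]) (auto simp: isCont_def)
    then obtain d where d: "d > 0" "\<And>t. t \<noteq> 0 \<Longrightarrow> dist t 0 < d \<Longrightarrow> \<gamma> t \<in> - B"
      unfolding eventually_at by auto
    have "\<gamma> t \<in> S - B" if t: "t \<in> {- (min d \<epsilon>)<..<min d \<epsilon>}" for t
    proof -
      have "t \<in> {-\<epsilon><..<\<epsilon>}" "dist t 0 < d" using t by (auto simp: dist_real_def abs_less_iff)
      then show ?thesis using d(2)[of t] \<gamma>(2,3) B(2) by (cases "t = 0") auto
    qed
    then show "v \<in> tangent_space (S - B) p"
      unfolding tangent_space_def using \<gamma> d
      by (intro CollectI exI[of _ \<gamma>] exI[of _ "min d \<epsilon>"]) (auto simp: image_subset_iff)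
  qed
qed

text \<open>
  All ingredients are local, so the choice operator in the definition is applied to the same predicate.
\<close>

lemma principal_curvatures_diff_closed:
  assumes B: "closed B" "p \<notin> B"
  shows "principal_curvatures (S - B) \<nu> p = principal_curvatures S \<nu> p"
proof -
  have "at p within (S - B) = at p within S"
    by (rule at_within_nhd[of p "- B"]) (use B in auto)
  then have "shape_operator (S - B) \<nu> p = shape_operator S \<nu> p"
    by (intro ext) (simp add: shape_operator_def levi_civita_def)
  then show ?thesis
    unfolding principal_curvatures_def tangent_space_diff_closed[OF B] by simp
qed

lemma unit_normal_field_diff_closed:
  assumes "closed B" "unit_normal_field S \<nu>"
  shows "unit_normal_field (S - B) \<nu>"
  using assms tangent_space_diff_closed[OF assms(1)] unfolding unit_normal_field_def
  by (auto intro: continuous_on_subset)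

lemma C2_hypersurface_diff_closed:
  assumes S: "C2_hypersurface (S :: ('n::finite pt) set)" and B: "closed B"
  shows "C2_hypersurface (S - B)"
  unfolding C2_hypersurface_def
proof (intro conjI ballI)
  show "S - B \<subseteq> halfspace" using S unfolding C2_hypersurface_def by blast
  fix p assume p: "p \<in> S - B"
  then have "p \<in> S" by blast
  have "\<exists>U (f :: 'n pt \<Rightarrow> real). open U \<and> p \<in> U \<and> U \<subseteq> halfspace \<and> C2_on U f \<and>
       (\<forall>x\<in>U. frechet_derivative f (at x) \<noteq> (\<lambda>_. 0)) \<and> S \<inter> U = {x \<in> U. f x = 0}"
    using S \<open>p \<in> S\<close> unfolding C2_hypersurface_def by (elim conjE) (rule bspec)
  then obtain U and f :: "'n pt \<Rightarrow> real" where U: "open U" "p \<in> U" "U \<subseteq> halfspace" "C2_on U f"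
    and nz: "\<And>x. x \<in> U \<Longrightarrow> frechet_derivative f (at x) \<noteq> (\<lambda>_. 0)" and SU: "S \<inter> U = {x \<in> U. f x = 0}"
    by (elim exE conjE) (rule that, assumption+, erule (1) bspec, assumption)
  have c: "C2_on (U \<inter> - B) f" using U(4) unfolding C2_on_def by (meson IntD1 continuous_on_subset inf_le1)
  have o: "open (U \<inter> - B)" "p \<in> U \<inter> - B" "U \<inter> - B \<subseteq> halfspace" using U B p by (auto simp: open_Int)
  have l: "(S - B) \<inter> (U \<inter> - B) = {x \<in> U \<inter> - B. f x = 0}"
  proof -
    have "(S - B) \<inter> (U \<inter> - B) = (S \<inter> U) \<inter> - B" by blast
    then show ?thesis unfolding SU by blast
  qed
  have nz': "frechet_derivative f (at x) \<noteq> (\<lambda>_. 0)" if "x \<in> U \<inter> - B" for x using nz that by blast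
  show "\<exists>U (f :: 'n pt \<Rightarrow> real). open U \<and> p \<in> U \<and> U \<subseteq> halfspace \<and> C2_on U f \<and>
       (\<forall>x\<in>U. frechet_derivative f (at x) \<noteq> (\<lambda>_. 0)) \<and> (S - B) \<inter> U = {x \<in> U. f x = 0}"
    by (rule exI[of _ "U \<inter> - B"], rule exI[of _ f], intro conjI o c l ballI nz')
qed

section \<open>The rigidity theorem\<close>

theorem theorem5p1:
  fixes M \<Sigma> B :: "((real ^ 'n::finite) \<times> real) set"
    and \<eta> \<nu> :: "(real ^ 'n) \<times> real \<Rightarrow> (real ^ 'n) \<times> real"
    and r :: nat and H\<^sub>M :: real
  assumes "CARD('n) \<ge> 2" and "1 \<le> r" and "r \<le> CARD('n)"
    and "horosphere M \<or> equidistant_sphere M"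
    and "unit_normal_field M \<eta>"
    and "\<And>p. p \<in> M \<Longrightarrow> r_mean_curvature 1 M \<eta> p > 0"
    and "\<And>p. p \<in> M \<Longrightarrow> r_mean_curvature r M \<eta> p = H\<^sub>M"
    and "properly_embedded_C2_hypersurface \<Sigma>" and "connected \<Sigma>"
    and "compact B" and "B \<subseteq> halfspace" and "\<Sigma> - B = M - B"
    and "unit_normal_field \<Sigma> \<nu>"
    and "\<And>p. p \<in> \<Sigma> - B \<Longrightarrow> r_mean_curvature r \<Sigma> \<nu> p = H\<^sub>M"
    and "(\<forall>p\<in>\<Sigma>. r_mean_curvature r \<Sigma> \<nu> p \<ge> H\<^sub>M) \<or>
         (\<forall>p\<in>\<Sigma>. \<bar>r_mean_curvature r \<Sigma> \<nu> p\<bar> \<le> H\<^sub>M)"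
  shows "\<Sigma> = M"
proof -
  note r = assms(2,3)
  let ?c = "real (CARD('n) choose r)"
  have c0: "?c > 0" using r by simp
  have \<Sigma>: "C2_hypersurface \<Sigma>" and proper: "\<And>K. compact K \<Longrightarrow> K \<subseteq> halfspace \<Longrightarrow> compact (\<Sigma> \<inter> K)"
    using assms(8) unfolding properly_embedded_C2_hypersurface_def by blast+
  have \<Sigma>H: "\<Sigma> \<subseteq> halfspace" using \<Sigma> unfolding C2_hypersurface_def by blast
  have clB: "closed B" using assms(10) by (rule compact_imp_closed)
  obtain F N c where F: "hyp_isometry F" and N: "norm N = 1" and ne: "hyperplane N c \<noteq> {}"
    and M: "M = F ` hyperplane N c"
    using isometric_to_hyperplane[OF assms(4)] by (elim exE conjE) (rule that)
  obtain F' F'' where "isometry_derivatives F F' F''" using hyp_isometry_derivatives[OF F] by (elim exE) (rule that)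
  then interpret isometry_derivatives F F' F'' .
  have hpH: "hyperplane N c \<subseteq> halfspace" by (auto simp: hyperplane_def)
  have MH: "M \<subseteq> halfspace" unfolding M using F_in_halfspace hpH by blast
  have pM: "pull_set M = hyperplane N c"
  proof (intro set_eqI iffI)
    fix x assume "x \<in> pull_set M"
    then have x: "x \<in> halfspace" "F x \<in> F ` hyperplane N c" by (auto simp: pull_set_def M)
    from x(2) obtain k where k: "F x = F k" "k \<in> hyperplane N c" by (rule imageE)
    have "x = k" by (rule inj_onD[OF bij_betw_imp_inj_on[OF bij] k(1) x(1)]) (use k(2) hpH in blast)
    then show "x \<in> hyperplane N c" using k(2) by simp
  next
    fix x assume "x \<in> hyperplane N c"
    then show "x \<in> pull_set M" using hpH by (auto simp: pull_set_def M)
  qed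
  have pdiff: "pull_set (S - B) = pull_set S - pull_set B" for S by (auto simp: pull_set_def)
  have cpB: "compact (pull_set B)" by (rule pull_set_compact[OF assms(10,11)])

  (* M is known to be a hypersurface only outside B, where it coincides with \<Sigma>;
     its curvature is read off at one such point. *)
  define S0 where "S0 = \<Sigma> - B"
  have S0M: "S0 = M - B" using assms(12) by (simp add: S0_def)
  have S0: "C2_hypersurface S0" unfolding S0_def by (rule C2_hypersurface_diff_closed[OF \<Sigma> clB])
  have \<eta>0: "unit_normal_field S0 \<eta>" unfolding S0M by (rule unit_normal_field_diff_closed[OF clB assms(5)])
  have "N \<noteq> 0" using N by auto
  obtain m0 where "m0 \<in> hyperplane N c" using ne by blast
  then obtain m where m: "m \<in> hyperplane N c" "\<forall>t. m + t *\<^sub>R N \<notin> pull_set B"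
    using hyperplane_far_line[OF \<open>N \<noteq> 0\<close> _ compact_imp_bounded[OF cpB]] by blast
  have "m \<notin> pull_set B" using m(2)[rule_format, of 0] by simp
  then have mS0: "m \<in> pull_set S0" using m(1) unfolding S0M pdiff pM by blast
  have FmM: "F m \<in> M" "F m \<notin> B" using mS0 by (auto simp: pull_set_def S0M)
  (* the sign by which N has to be multiplied to point in the direction of the mean curvature vector *)
  define s where "s = sgn (inner N (pull_field \<eta> m))"
  have flat: "inner x N = inner m N" if "x \<in> pull_set S0 \<inter> UNIV" for x
    using that m(1) unfolding S0M pdiff pM by (simp add: hyperplane_def)
  note ph = principal_curvatures_hyperplane[OF pull_set_hypersurface[OF S0] pull_field_unit_normal[OF \<eta>0] mS0 open_UNIV UNIV_I flat N]
  have s: "s = 1 \<or> s = -1" using ph(2) by (auto simp: s_def sgn_if)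
  have pc: "principal_curvatures (pull_set S0) (pull_field \<eta>) m = (\<lambda>_. s * snd N)"
  proof
    fix i
    have "s * principal_curvatures (pull_set S0) (pull_field \<eta>) m i = snd N" using ph(3) by (simp only: s_def)
    then show "principal_curvatures (pull_set S0) (pull_field \<eta>) m i = s * snd N" using s by auto
  qed
  have HM: "elem_sym j (principal_curvatures M \<eta> (F m)) = real (CARD('n) choose j) * (s * snd N) ^ j" for j
  proof -
    have "principal_curvatures S0 \<eta> (F m) = principal_curvatures M \<eta> (F m)"
      unfolding S0M by (rule principal_curvatures_diff_closed[OF clB FmM(2)])
    then show ?thesis using elem_sym_pull[OF S0 \<eta>0 mS0, of j] by (simp only: pc elem_sym_const)
  qed
  have "r_mean_curvature 1 M \<eta> (F m) = s * snd N"
    unfolding r_mean_curvature_def HM by simp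
  then have pos: "s * snd N > 0" using assms(6)[OF FmM(1)] by simp
  have HMv: "H\<^sub>M = (s * snd N) ^ r"
    using assms(7)[OF FmM(1)] c0 unfolding r_mean_curvature_def HM by simp

  (* In the hyperplane model the sign s makes the last coordinate of the unit normal positive. *)
  define N1 where "N1 = s *\<^sub>R N"
  define c1 where "c1 = s * c"
  have hp: "hyperplane N1 c1 = hyperplane N c" using s by (auto simp: hyperplane_def N1_def c1_def)
  have N1: "norm N1 = 1" "snd N1 > 0" "snd N1 = s * snd N" using N s pos by (auto simp: N1_def)
  have es: "elem_sym r (principal_curvatures (pull_set \<Sigma>) (pull_field \<nu>) x) = ?c * r_mean_curvature r \<Sigma> \<nu> (F x)"
    if "x \<in> pull_set \<Sigma>" for x
    using elem_sym_pull[OF \<Sigma> assms(13) that, of r] c0 by (simp add: r_mean_curvature_def)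
  have "compact_perturbation (pull_set \<Sigma>) (pull_set B) N1 c1 (pull_field \<nu>)"
  proof
    show "compact (pull_set \<Sigma> \<inter> K)" if "compact K" "K \<subseteq> halfspace" for K
      by (rule pull_set_proper[OF proper that])
    show "pull_set \<Sigma> - pull_set B = hyperplane N1 c1 - pull_set B"
      unfolding hp pM[symmetric] pdiff[symmetric] assms(12) ..
    show "hyperplane N1 c1 \<noteq> {}" unfolding hp by (rule ne)
    show "pull_set B \<subseteq> halfspace" by (auto simp: pull_set_def)
  qed (use pull_set_hypersurface[OF \<Sigma>] pull_field_unit_normal[OF assms(13)] pull_set_connected[OF assms(9) \<Sigma>H] cpB N1 in auto)
  then have "pull_set \<Sigma> = hyperplane N1 c1"
  proof (rule hyperplane_rigidity[OF _ r])
    fix x assume x: "x \<in> pull_set \<Sigma> - pull_set B"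
    then have "F x \<in> \<Sigma> - B" by (auto simp: pull_set_def)
    then show "elem_sym r (principal_curvatures (pull_set \<Sigma>) (pull_field \<nu>) x) = ?c * snd N1 ^ r"
      using es[of x] x assms(14) by (simp add: HMv N1(3))
  next
    have F\<Sigma>: "F x \<in> \<Sigma>" if "x \<in> pull_set \<Sigma>" for x using that by (simp add: pull_set_def)
    show "(\<forall>x\<in>pull_set \<Sigma>. ?c * snd N1 ^ r \<le> elem_sym r (principal_curvatures (pull_set \<Sigma>) (pull_field \<nu>) x)) \<or>
      (\<forall>x\<in>pull_set \<Sigma>. \<bar>elem_sym r (principal_curvatures (pull_set \<Sigma>) (pull_field \<nu>) x)\<bar> \<le> ?c * snd N1 ^ r)"
      using assms(15)
    proof
      assume "\<forall>p\<in>\<Sigma>. r_mean_curvature r \<Sigma> \<nu> p \<ge> H\<^sub>M"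
      then have "?c * snd N1 ^ r \<le> elem_sym r (principal_curvatures (pull_set \<Sigma>) (pull_field \<nu>) x)" if "x \<in> pull_set \<Sigma>" for x
        unfolding es[OF that] using F\<Sigma>[OF that] c0 by (simp add: HMv N1(3))
      then show ?thesis by blast
    next
      assume "\<forall>p\<in>\<Sigma>. \<bar>r_mean_curvature r \<Sigma> \<nu> p\<bar> \<le> H\<^sub>M"
      then have "\<bar>elem_sym r (principal_curvatures (pull_set \<Sigma>) (pull_field \<nu>) x)\<bar> \<le> ?c * snd N1 ^ r" if "x \<in> pull_set \<Sigma>" for x
        unfolding es[OF that] abs_mult using F\<Sigma>[OF that] c0 by (simp add: HMv N1(3))
      then show ?thesis by blast
    qed
  qed
  then have "pull_set \<Sigma> = pull_set M" unfolding hp pM .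
  then show ?thesis using pull_set_image[OF \<Sigma>H] pull_set_image[OF MH] by metis
qed

end
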